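(* Let $k$ and $\mathbb{F}$ be fields of characteristic zero, and let $G$ and $H$ be finite groups. If $\widehat{kR_{\mathbb{F},G}}(H)\neq 0$, then $\widehat{kR_{\mathbb{Q}}}(H)\neq 0$.
   Context: For a field $\mathbb{F}$ of characteristic zero and a finite group $H$, $R_{\mathbb{F}}(H)$ is the Grothendieck ring of finitely generated $\mathbb{F}H$-modules and $kR_{\mathbb{F}}(H)=k\otimes_{\mathbb{Z}}R_{\mathbb{F}}(H)$. For a finite group $G$, the shifted Green biset functor $kR_{\mathbb{F},G}$ has values $kR_{\mathbb{F},G}(H)=kR_{\mathbb{F}}(H\times G)$; $kR_{\mathbb{F}}=kR_{\mathbb{F},1}$. The category $\mathcal{P}_{kR_{\mathbb{F},G}}$ has the finite groups as objects and $\mathrm{Hom}(H,K)=\mathcal{P}_{kR_{\mathbb{F},G}}(H,K)=kR_{\mathbb{F}}(K\times H\times G)$. The composite of the classes of an $\mathbb{F}[L\times K\times G]$-module $V$ and an $\mathbb{F}[K\times H\times G]$-module $W$ is $[V]\circ[W]=[(V\otimes_{\mathbb{F}}W)_K]$, the coinvariants under the diagonal action of $K$, with $G$ acting diagonally (on characters: $(\chi\circ\theta)(l,h,g)=\frac{1}{|K|}\sum_{x\in K}\chi(l,x,g)\theta(x,h,g)$), extended $k$-bilinearly. The identity of $H$ is the class of $\mathbb{F}H$ with $(h_1,h_2,g)\cdot x=h_1xh_2^{-1}$. For $A=kR_{\mathbb{F},G}$, the essential algebra at $H$ is $\widehat{A}(H)=\mathrm{End}_{\mathcal{P}_A}(H)/I_A(H)$,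 where $I_A(H)$ is the two-sided ideal $\sum_{|K|<|H|}\langle\mathcal{P}_A(K,H)\circ\mathcal{P}_A(H,K)\rangle$ ($k$-span of all endomorphisms of $H$ factoring through a group $K$ with $|K|<|H|$). *)

theory Defs
  imports
    "Jordan_Normal_Form.VS_Connect"
    "HOL-Algebra.Free_Abelian_Groups"
    "HOL-Algebra.Elementary_Groups"
    "HOL-Algebra.QuotRing"
begin

section \<open>Modules over group algebras\<close>

text \<open>
  A module over the group algebra \<open>F G\<close> is an \<open>F\<close>-vector space with a linear action of \<open>G\<close>.
  The field \<open>F\<close> is the type \<open>'f\<close>.
\<close>

record ('f, 'v, 'g) gmodule = "('f, 'v) module" +
  act :: "'g \<Rightarrow> 'v \<Rightarrow> 'v"

definition gmodule_hom ::
    "'g monoid \<Rightarrow> ('f::field, 'v, 'g) gmodule \<Rightarrow> ('f, 'w, 'g) gmodule \<Rightarrow> ('v \<Rightarrow> 'w) set" where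
  "gmodule_hom G V W =
    {f \<in> LinearCombinations.module_hom class_ring V W.
       \<forall>g\<in>carrier G. \<forall>v\<in>carrier V. f (act V g v) = act W g (f v)}"

definition gmodule_iso ::
    "'g monoid \<Rightarrow> ('f::field, 'v, 'g) gmodule \<Rightarrow> ('f, 'w, 'g) gmodule \<Rightarrow> bool" where
  "gmodule_iso G V W \<longleftrightarrow> (\<exists>f\<in>gmodule_hom G V W. bij_betw f (carrier V) (carrier W))"

definition short_exact ::
    "'g monoid \<Rightarrow> ('f::field, 'u, 'g) gmodule \<Rightarrow> ('f, 'v, 'g) gmodule \<Rightarrow>
      ('f, 'w, 'g) gmodule \<Rightarrow> bool" where
  "short_exact G U V W \<longleftrightarrow>
    (\<exists>i\<in>gmodule_hom G U V. \<exists>p\<in>gmodule_hom G V W.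
       inj_on i (carrier U) \<and>
       i ` carrier U = {v \<in> carrier V. p v = \<zero>\<^bsub>W\<^esub>} \<and>
       p ` carrier V = carrier W)"

text \<open>
  For finite \<open>G\<close> every finitely generated \<open>F G\<close>-module is isomorphic to some \<open>F\<^sup>n\<close> on which \<open>G\<close>
  acts through a homomorphism into the invertible \<open>n \<times> n\<close> matrices; these pairs \<open>(n, \<rho>)\<close> form a
  set of representatives for the finitely generated modules.
\<close>

type_synonym ('f, 'g) matrix_rep = "nat \<times> ('g \<Rightarrow> 'f mat)"

definition matrix_reps :: "'g monoid \<Rightarrow> ('f::field, 'g) matrix_rep set" where
  "matrix_reps G =
    {(n, \<rho>). (\<forall>g\<in>carrier G. \<rho> g \<in> carrier_mat n n) \<and>
       \<rho> \<one>\<^bsub>G\<^esub> = 1\<^sub>m n \<and>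
       (\<forall>g\<in>carrier G. \<forall>h\<in>carrier G. \<rho> (g \<otimes>\<^bsub>G\<^esub> h) = \<rho> g * \<rho> h)}"

definition vec_gmodule :: "('f::field, 'g) matrix_rep \<Rightarrow> ('f, 'f vec, 'g) gmodule" where
  "vec_gmodule = (\<lambda>(n, \<rho>).
    module.extend (module_vec TYPE('f) n) (gmodule.fields (\<lambda>g v. \<rho> g *\<^sub>v v)))"

definition matrix_form ::
    "'g monoid \<Rightarrow> ('f::field, 'v, 'g) gmodule \<Rightarrow> ('f, 'g) matrix_rep" where
  "matrix_form G M = (SOME V. V \<in> matrix_reps G \<and> gmodule_iso G (vec_gmodule V) M)"


section \<open>Abelian groups by generators and relations\<close>

definition relation_subgroup :: "'a set \<Rightarrow> ('a \<Rightarrow>\<^sub>0 int) set \<Rightarrow> ('a \<Rightarrow>\<^sub>0 int) set" where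
  "relation_subgroup S R = generate (free_Abelian_group S) R"

definition presented_group :: "'a set \<Rightarrow> ('a \<Rightarrow>\<^sub>0 int) set \<Rightarrow> ('a \<Rightarrow>\<^sub>0 int) set monoid" where
  "presented_group S R = free_Abelian_group S Mod relation_subgroup S R"

definition presented_class ::
    "'a set \<Rightarrow> ('a \<Rightarrow>\<^sub>0 int) set \<Rightarrow> ('a \<Rightarrow>\<^sub>0 int) \<Rightarrow> ('a \<Rightarrow>\<^sub>0 int) set" where
  "presented_class S R x = relation_subgroup S R #>\<^bsub>free_Abelian_group S\<^esub> x"

definition frag_biextend ::
    "('a \<Rightarrow> 'b \<Rightarrow> ('c \<Rightarrow>\<^sub>0 int)) \<Rightarrow> ('a \<Rightarrow>\<^sub>0 int) \<Rightarrow> ('b \<Rightarrow>\<^sub>0 int) \<Rightarrow> ('c \<Rightarrow>\<^sub>0 int)" where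
  "frag_biextend f x y = frag_extend (\<lambda>a. frag_extend (f a) y) x"


section \<open>The Grothendieck group and its scalar extension\<close>

text \<open>
  Isomorphic modules \<open>V\<close> and \<open>W\<close> have the same class, because of the exact sequence
  \<open>0 \<rightarrow> V \<rightarrow> W \<rightarrow> 0 \<rightarrow> 0\<close>.
\<close>

definition grothendieck_relations ::
    "'g monoid \<Rightarrow> (('f::field, 'g) matrix_rep \<Rightarrow>\<^sub>0 int) set" where
  "grothendieck_relations G =
    {frag_of V - frag_of U - frag_of W | U V W.
       U \<in> matrix_reps G \<and> V \<in> matrix_reps G \<and> W \<in> matrix_reps G \<and>
       short_exact G (vec_gmodule U) (vec_gmodule V) (vec_gmodule W)}"

type_synonym ('f, 'g) grothendieck = "(('f, 'g) matrix_rep \<Rightarrow>\<^sub>0 int) set"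

definition grothendieck_group ::
    "'f::field itself \<Rightarrow> 'g monoid \<Rightarrow> ('f, 'g) grothendieck monoid" where
  "grothendieck_group F G = presented_group (matrix_reps G) (grothendieck_relations G)"

definition grothendieck_class ::
    "'g monoid \<Rightarrow> (('f::field, 'g) matrix_rep \<Rightarrow>\<^sub>0 int) \<Rightarrow> ('f, 'g) grothendieck" where
  "grothendieck_class G = presented_class (matrix_reps G) (grothendieck_relations G)"

text \<open>
  \<open>k \<otimes>\<^sub>\<int> A\<close> for an abelian group \<open>A\<close> (written multiplicatively, as \<^const>\<open>free_Abelian_group\<close>
  is): the generator \<open>(a, x)\<close> stands for \<open>a \<otimes> x\<close>.
\<close>

definition tensor_relations :: "'a monoid \<Rightarrow> ('k::field \<times> 'a \<Rightarrow>\<^sub>0 int) set" where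
  "tensor_relations A =
    {frag_of (a + b, x) - frag_of (a, x) - frag_of (b, x) | a b x. x \<in> carrier A} \<union>
    {frag_of (a, x \<otimes>\<^bsub>A\<^esub> y) - frag_of (a, x) - frag_of (a, y) | a x y.
       x \<in> carrier A \<and> y \<in> carrier A}"

definition tensor_class :: "'a monoid \<Rightarrow> ('k::field \<times> 'a \<Rightarrow>\<^sub>0 int) \<Rightarrow> ('k \<times> 'a \<Rightarrow>\<^sub>0 int) set" where
  "tensor_class A = presented_class (UNIV \<times> carrier A) (tensor_relations A)"

text \<open>
  As in \<^const>\<open>module_vec\<close>, the ring fields of a record that only serves as a module are undefined.
\<close>

definition scalar_extension ::
    "'k::field itself \<Rightarrow> 'a monoid \<Rightarrow> ('k, ('k \<times> 'a \<Rightarrow>\<^sub>0 int) set) module" where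
  "scalar_extension k A =
    (let T = presented_group (UNIV \<times> carrier A) (tensor_relations A) in
     \<lparr>carrier = carrier T,
      monoid.mult = undefined, monoid.one = undefined,
      ring.zero = \<one>\<^bsub>T\<^esub>, ring.add = monoid.mult T,
      module.smult = (\<lambda>c X. \<Union>x\<in>X. tensor_class A (frag_extend (\<lambda>(a, r). frag_of (c * a, r)) x))\<rparr>)"

type_synonym ('k, 'f, 'g) kR = "('k \<times> ('f, 'g) grothendieck \<Rightarrow>\<^sub>0 int) set"

definition kR ::
    "'k::field itself \<Rightarrow> 'f::field itself \<Rightarrow> 'g monoid \<Rightarrow> ('k, ('k, 'f, 'g) kR) module" where
  "kR k F G = scalar_extension k (grothendieck_group F G)"

definition kR_class ::
    "'g monoid \<Rightarrow> ('k::field \<times> ('f::field, 'g) grothendieck \<Rightarrow>\<^sub>0 int) \<Rightarrow> ('k, 'f, 'g) kR" where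
  "kR_class G = tensor_class (grothendieck_group TYPE('f) G)"


section \<open>The category of a shifted Green biset functor\<close>

definition kronecker :: "'f::field mat \<Rightarrow> 'f mat \<Rightarrow> 'f mat" where
  "kronecker A B = mat (dim_row A * dim_row B) (dim_col A * dim_col B)
    (\<lambda>(i, j). A $$ (i div dim_row B, j div dim_col B) * B $$ (i mod dim_row B, j mod dim_col B))"

text \<open>
  \<open>V \<otimes>\<^sub>F W\<close> for a representation \<open>V\<close> of \<open>L \<times> K \<times> G\<close> and a representation \<open>W\<close> of \<open>K \<times> H \<times> G\<close>,
  as a representation of \<open>L \<times> K \<times> H \<times> G\<close> in which \<open>K\<close> and \<open>G\<close> act diagonally. Here
  \<open>F\<^sup>m \<otimes> F\<^sup>n\<close> is \<open>F\<^sup>m\<^sup>n\<close>, with \<open>e\<^sub>i \<otimes> e\<^sub>j\<close> the basis vector of index \<open>i n + j\<close>.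
\<close>

definition tensor_rep ::
    "('f::field, 'l \<times> 'c \<times> 'g) matrix_rep \<Rightarrow> ('f, 'c \<times> 'h \<times> 'g) matrix_rep \<Rightarrow>
      ('f, 'l \<times> 'c \<times> 'h \<times> 'g) matrix_rep" where
  "tensor_rep = (\<lambda>(m, \<rho>) (n, \<sigma>).
    (m * n, \<lambda>(l, x, h, g). kronecker (\<rho> (l, x, g)) (\<sigma> (x, h, g))))"

text \<open>The coinvariants \<open>T\<^sub>K\<close> of a module \<open>T\<close> over \<open>L \<times> K \<times> H \<times> G\<close>.\<close>

definition coinvariants ::
    "'g monoid \<Rightarrow> 'l monoid \<Rightarrow> 'c monoid \<Rightarrow> 'h monoid \<Rightarrow>
      ('f::field, 'v, 'l \<times> 'c \<times> 'h \<times> 'g) gmodule \<Rightarrow> ('f, 'v set, 'l \<times> 'h \<times> 'g) gmodule" where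
  "coinvariants G L K H T =
    (let D = LinearCombinations.module.span class_ring T
               {act T (\<one>\<^bsub>L\<^esub>, x, \<one>\<^bsub>H\<^esub>, \<one>\<^bsub>G\<^esub>) v \<ominus>\<^bsub>T\<^esub> v | x v. x \<in> carrier K \<and> v \<in> carrier T} in
     \<lparr>carrier = a_rcosets\<^bsub>T\<^esub> D,
      monoid.mult = undefined, monoid.one = undefined,
      ring.zero = D, ring.add = set_add T,
      module.smult = (\<lambda>c X. \<Union>v\<in>X. D +>\<^bsub>T\<^esub> (c \<odot>\<^bsub>T\<^esub> v)),
      act = (\<lambda>(l, h, g) X. \<Union>v\<in>X. D +>\<^bsub>T\<^esub> act T (l, \<one>\<^bsub>K\<^esub>, h, g) v)\<rparr>)"

definition rep_comp ::
    "'g monoid \<Rightarrow> 'l monoid \<Rightarrow> 'c monoid \<Rightarrow> 'h monoid \<Rightarrow>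
      ('f::field, 'l \<times> 'c \<times> 'g) matrix_rep \<Rightarrow> ('f, 'c \<times> 'h \<times> 'g) matrix_rep \<Rightarrow>
      ('f, 'l \<times> 'h \<times> 'g) matrix_rep" where
  "rep_comp G L K H V W =
    matrix_form (L \<times>\<times> H \<times>\<times> G) (coinvariants G L K H (vec_gmodule (tensor_rep V W)))"

text \<open>
  The biadditive extension to \<open>R\<^sub>F\<close> and the \<open>k\<close>-bilinear extension to \<open>k \<otimes> R\<^sub>F\<close>, where
  \<open>(a \<otimes> r) \<circ> (b \<otimes> s) = a b \<otimes> (r \<circ> s)\<close>. Like \<^const>\<open>rcoset_mult\<close>, they collect the results over
  all representatives of the two cosets.
\<close>

definition grothendieck_comp ::
    "'g monoid \<Rightarrow> 'l monoid \<Rightarrow> 'c monoid \<Rightarrow> 'h monoid \<Rightarrow>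
      ('f::field, 'l \<times> 'c \<times> 'g) grothendieck \<Rightarrow> ('f, 'c \<times> 'h \<times> 'g) grothendieck \<Rightarrow>
      ('f, 'l \<times> 'h \<times> 'g) grothendieck" where
  "grothendieck_comp G L K H X Y = (\<Union>x\<in>X. \<Union>y\<in>Y. grothendieck_class (L \<times>\<times> H \<times>\<times> G)
     (frag_biextend (\<lambda>V W. frag_of (rep_comp G L K H V W)) x y))"

definition kR_comp ::
    "'g monoid \<Rightarrow> 'l monoid \<Rightarrow> 'c monoid \<Rightarrow> 'h monoid \<Rightarrow>
      ('k::field, 'f::field, 'l \<times> 'c \<times> 'g) kR \<Rightarrow> ('k, 'f, 'c \<times> 'h \<times> 'g) kR \<Rightarrow>
      ('k, 'f, 'l \<times> 'h \<times> 'g) kR" where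
  "kR_comp G L K H X Y = (\<Union>x\<in>X. \<Union>y\<in>Y. kR_class (L \<times>\<times> H \<times>\<times> G)
     (frag_biextend (\<lambda>(a, r) (b, s). frag_of (a * b, grothendieck_comp G L K H r s)) x y))"

text \<open>\<open>P_hom k F G H K\<close> is the set of morphisms from \<open>H\<close> to \<open>K\<close>.\<close>

definition P_hom ::
    "'k::field itself \<Rightarrow> 'f::field itself \<Rightarrow> 'g monoid \<Rightarrow> 'h monoid \<Rightarrow> 'c monoid \<Rightarrow>
      ('k, ('k, 'f, 'c \<times> 'h \<times> 'g) kR) module" where
  "P_hom k F G H K = kR k F (K \<times>\<times> H \<times>\<times> G)"

definition group_algebra_bimodule ::
    "'h monoid \<Rightarrow> ('f::field, 'h \<Rightarrow>\<^sub>0 'f, 'h \<times> 'h \<times> 'g) gmodule" where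
  "group_algebra_bimodule H =
    \<lparr>carrier = {v. Poly_Mapping.keys v \<subseteq> carrier H},
     monoid.mult = undefined, monoid.one = undefined,
     ring.zero = 0, ring.add = (+), module.smult = (\<lambda>c. Poly_Mapping.map ((*) c)),
     act = (\<lambda>(h1, h2, g) v. \<Sum>x\<in>Poly_Mapping.keys v.
       Poly_Mapping.single (h1 \<otimes>\<^bsub>H\<^esub> x \<otimes>\<^bsub>H\<^esub> inv\<^bsub>H\<^esub> h2) (Poly_Mapping.lookup v x))\<rparr>"

definition P_id :: "'g monoid \<Rightarrow> 'h monoid \<Rightarrow> ('k::field, 'f::field, 'h \<times> 'h \<times> 'g) kR" where
  "P_id G H = kR_class (H \<times>\<times> H \<times>\<times> G) (frag_of (1, grothendieck_class (H \<times>\<times> H \<times>\<times> G)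
     (frag_of (matrix_form (H \<times>\<times> H \<times>\<times> G) (group_algebra_bimodule H)))))"

definition P_End ::
    "'k::field itself \<Rightarrow> 'f::field itself \<Rightarrow> 'g monoid \<Rightarrow> 'h monoid \<Rightarrow>
      ('k, ('k, 'f, 'h \<times> 'h \<times> 'g) kR) module" where
  "P_End k F G H = (P_hom k F G H H) \<lparr>monoid.mult := kR_comp G H H H, monoid.one := P_id G H\<rparr>"


section \<open>The essential algebra\<close>

text \<open>
  The intermediate groups \<open>K\<close> range over the finite groups whose elements are natural numbers;
  up to isomorphism these are all finite groups.
\<close>

definition essential_ideal ::
    "'k::field itself \<Rightarrow> 'f::field itself \<Rightarrow> 'g monoid \<Rightarrow> 'h monoid \<Rightarrow>
      ('k, 'f, 'h \<times> 'h \<times> 'g) kR set" where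
  "essential_ideal k F G H = LinearCombinations.module.span class_ring (P_End k F G H)
    {kR_comp G H K H u v | (K :: nat monoid) u v.
       group K \<and> finite (carrier K) \<and> card (carrier K) < card (carrier H) \<and>
       u \<in> carrier (P_hom k F G K H) \<and> v \<in> carrier (P_hom k F G H K)}"

definition essential_algebra ::
    "'k::field itself \<Rightarrow> 'f::field itself \<Rightarrow> 'g monoid \<Rightarrow> 'h monoid \<Rightarrow>
      ('k, 'f, 'h \<times> 'h \<times> 'g) kR set ring" where
  "essential_algebra k F G H = P_End k F G H Quot essential_ideal k F G H"

end

theory Submission
  imports Defs
begin

text \<open>
  Extending scalars from \<open>\<rat>\<close> to \<open>F\<close> and letting \<open>G\<close>
  act trivially turns a rational representation of \<open>K \<times> H\<close> into a
  representation of \<open>K \<times> H \<times> G\<close> over \<open>F\<close>. This is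
  compatible with the coinvariants of tensor products and takes \<open>\<rat>H\<close> to
  \<open>FH\<close>, so it induces a \<open>k\<close>-linear functor from the category of
  \<open>kR\<^sub>\<rat>\<close> to that of \<open>kR\<^sub>F\<^sub>,\<^sub>G\<close> which is
  the identity on objects. Such a functor maps endomorphisms of \<open>H\<close> that factor
  through a smaller group to endomorphisms that factor through the same group
  (\<open>essential_ideal_base_change\<close>). If the essential algebra of
  \<open>kR\<^sub>\<rat>\<close> at \<open>H\<close> is zero, then the identity of
  \<open>H\<close> lies in the ideal of such endomorphisms. Applying the functor, so does the
  identity of \<open>H\<close> in the category of \<open>kR\<^sub>F\<^sub>,\<^sub>G\<close>. The
  ideal absorbs composition from the left (\<open>essential_ideal_left\<close>), hence it is
  everything, and the essential algebra of \<open>kR\<^sub>F\<^sub>,\<^sub>G\<close> at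
  \<open>H\<close> is zero as well.

  The work lies in showing that these objects form a category and that the functor respects it.
  All of this is read off characters. The tool is \<open>grothendieck_class_eq_iff\<close>: in
  characteristic zero two formal differences of representations have the same class in the
  Grothendieck group iff they have the same character. One direction is the additivity of traces
  in exact sequences. For the other, \<open>same_char_same_class\<close> splits off common
  summands: two representations with the same nonzero character admit a nonzero intertwiner,
  because an averaging projection with trace zero would be zero
  (\<open>character_norm_nonzero\<close>), and averaging a generalized inverse of the
  intertwiner makes its image a direct summand on both sides.

  Coinvariants under \<open>K\<close> are the image of the averaging projection, which yields
  the character of a composite, \<open>(l, h, g) \<mapsto> (\<Sum>x\<in>K. \<chi> (l, x, g)
  \<theta> (x, h, g)) / |K|\<close> (\<open>class_char_comp\<close>). That composition is well
  defined and biadditive, associativity, the identity law and the compatibility with extension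
  of scalars thereby become identities between finite sums in \<open>F\<close>. They pass to
  \<open>k \<otimes> R\<close> by bilinearity.
\<close>

section \<open>Notation\<close>

abbreviation (input) RG :: "'f::field itself \<Rightarrow> 'g monoid \<Rightarrow> ('f, 'g) grothendieck monoid" where
  "RG \<equiv> grothendieck_group"

abbreviation (input) trivial_group :: "unit monoid" where
  "trivial_group \<equiv> singleton_group ()"

abbreviation (input) triple :: "'a monoid \<Rightarrow> 'b monoid \<Rightarrow> 'c monoid \<Rightarrow> ('a \<times> 'b \<times> 'c) monoid" where
  "triple A B C \<equiv> A \<times>\<times> B \<times>\<times> C"

text \<open>
  The free abelian group on the representations consists of their formal differences.
\<close>

abbreviation (input) virtual_rep :: "'g monoid \<Rightarrow> (('f::field, 'g) matrix_rep \<Rightarrow>\<^sub>0 int) \<Rightarrow> bool" where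
  "virtual_rep G x \<equiv> Poly_Mapping.keys x \<subseteq> matrix_reps G"

text \<open>
  The formal sums of generators \<open>a \<otimes> r\<close>, which represent the elements of
  \<open>k \<otimes> A\<close>.
\<close>

abbreviation (input) tensor_frag :: "'a monoid \<Rightarrow> ('k \<times> 'a \<Rightarrow>\<^sub>0 int) \<Rightarrow> bool" where
  "tensor_frag A x \<equiv> Poly_Mapping.keys x \<subseteq> UNIV \<times> carrier A"

section \<open>Traces, averages and rank factorizations\<close>

definition mtrace :: "'a::comm_ring_1 mat \<Rightarrow> 'a" where
  "mtrace A = (\<Sum>i<dim_row A. A $$ (i, i))"

lemma mtrace_mult:
  fixes A B :: "'a::comm_ring_1 mat"
  assumes "A \<in> carrier_mat n m" "B \<in> carrier_mat m n"
  shows "mtrace (A * B) = (\<Sum>i<n. \<Sum>j<m. A $$ (i, j) * B $$ (j, i))"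
  using assms by (auto simp: mtrace_def scalar_prod_def lessThan_atLeast0 intro!: sum.cong)

lemma mtrace_comm:
  fixes A B :: "'a::comm_ring_1 mat"
  assumes "A \<in> carrier_mat n m" "B \<in> carrier_mat m n"
  shows "mtrace (A * B) = mtrace (B * A)"
  unfolding mtrace_mult[OF assms] mtrace_mult[OF assms(2,1)]
  by (subst sum.swap) (simp add: mult.commute)

lemma mtrace_one [simp]: "mtrace (1\<^sub>m n) = of_nat n"
  by (simp add: mtrace_def)

lemma mtrace_add:
  assumes "A \<in> carrier_mat n n" "B \<in> carrier_mat n n"
  shows "mtrace (A + B) = mtrace A + mtrace B"
  using assms by (simp add: mtrace_def sum.distrib)

text \<open>
  Matrices of unspecified size do not form an additive monoid, so the mean of a family of
  matrices is taken entry by entry.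
\<close>

definition avg_mat :: "'x set \<Rightarrow> nat \<Rightarrow> nat \<Rightarrow> ('x \<Rightarrow> 'a::field mat) \<Rightarrow> 'a mat" where
  "avg_mat S n m f = mat n m (\<lambda>ij. (\<Sum>x\<in>S. f x $$ ij) / of_nat (card S))"

lemma avg_mat_carrier [simp]: "avg_mat S n m f \<in> carrier_mat n m"
  "dim_row (avg_mat S n m f) = n" "dim_col (avg_mat S n m f) = m"
  by (simp_all add: avg_mat_def)

lemma avg_mat_cong: "(\<And>x. x \<in> S \<Longrightarrow> f x = g x) \<Longrightarrow> avg_mat S n m f = avg_mat S n m g"
  by (simp add: avg_mat_def)

lemma mult_avg_mat:
  assumes "A \<in> carrier_mat l n" "\<And>x. x \<in> S \<Longrightarrow> f x \<in> carrier_mat n m"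
  shows "A * avg_mat S n m f = avg_mat S l m (\<lambda>x. A * f x)"
proof (rule eq_matI)
  fix i j assume ij: "i < dim_row (avg_mat S l m (\<lambda>x. A * f x))" "j < dim_col (avg_mat S l m (\<lambda>x. A * f x))"
  then have "(A * avg_mat S n m f) $$ (i, j) =
      (\<Sum>k = 0..<n. A $$ (i, k) * ((\<Sum>x\<in>S. f x $$ (k, j)) / of_nat (card S)))"
    using assms(1) by (simp add: scalar_prod_def avg_mat_def)
  also have "\<dots> = (\<Sum>x\<in>S. \<Sum>k = 0..<n. A $$ (i, k) * f x $$ (k, j)) / of_nat (card S)"
    by (subst sum.swap) (simp add: sum_divide_distrib sum_distrib_left)
  also have "\<dots> = avg_mat S l m (\<lambda>x. A * f x) $$ (i, j)"
    using ij assms by (auto simp: scalar_prod_def avg_mat_def intro!: arg_cong2[where f="(/)"] sum.cong dest!: assms(2))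
  finally show "(A * avg_mat S n m f) $$ (i, j) = avg_mat S l m (\<lambda>x. A * f x) $$ (i, j)" .
qed (use assms in auto)

lemma avg_mat_mult:
  assumes "A \<in> carrier_mat m l" "\<And>x. x \<in> S \<Longrightarrow> f x \<in> carrier_mat n m"
  shows "avg_mat S n m f * A = avg_mat S n l (\<lambda>x. f x * A)"
proof (rule eq_matI)
  fix i j assume ij: "i < dim_row (avg_mat S n l (\<lambda>x. f x * A))" "j < dim_col (avg_mat S n l (\<lambda>x. f x * A))"
  then have "(avg_mat S n m f * A) $$ (i, j) =
      (\<Sum>k = 0..<m. ((\<Sum>x\<in>S. f x $$ (i, k)) / of_nat (card S)) * A $$ (k, j))"
    using assms(1) by (simp add: scalar_prod_def avg_mat_def)
  also have "\<dots> = (\<Sum>x\<in>S. \<Sum>k = 0..<m. f x $$ (i, k) * A $$ (k, j)) / of_nat (card S)"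
    by (subst sum.swap) (simp add: sum_divide_distrib sum_distrib_right)
  also have "\<dots> = avg_mat S n l (\<lambda>x. f x * A) $$ (i, j)"
    using ij assms by (auto simp: scalar_prod_def avg_mat_def intro!: arg_cong2[where f="(/)"] sum.cong dest!: assms(2))
  finally show "(avg_mat S n m f * A) $$ (i, j) = avg_mat S n l (\<lambda>x. f x * A) $$ (i, j)" .
qed (use assms in auto)

lemma avg_mat_const:
  fixes A :: "'a::field_char_0 mat"
  assumes "finite S" "S \<noteq> {}" "A \<in> carrier_mat n m" "\<And>x. x \<in> S \<Longrightarrow> f x = A"
  shows "avg_mat S n m f = A"
proof (rule eq_matI)
  fix i j assume "i < dim_row A" "j < dim_col A"
  then show "avg_mat S n m f $$ (i, j) = A $$ (i, j)"
    using assms by (simp add: avg_mat_def)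
qed (use assms in auto)

lemma avg_mat_reindex:
  assumes "bij_betw h S S"
  shows "avg_mat S n m (\<lambda>x. f (h x)) = avg_mat S n m f"
  by (simp add: avg_mat_def sum.reindex_bij_betw[OF assms, where g = "\<lambda>x. f x $$ _"])

lemma mtrace_avg_mat:
  assumes "\<And>x. x \<in> S \<Longrightarrow> f x \<in> carrier_mat n n"
  shows "mtrace (avg_mat S n n f) = (\<Sum>x\<in>S. mtrace (f x)) / of_nat (card S)"
proof -
  have "mtrace (avg_mat S n n f) = (\<Sum>i<n. (\<Sum>x\<in>S. f x $$ (i, i)) / of_nat (card S))"
    by (simp add: mtrace_def avg_mat_def)
  also have "\<dots> = (\<Sum>x\<in>S. \<Sum>i<n. f x $$ (i, i)) / of_nat (card S)"
    by (subst sum.swap) (simp add: sum_divide_distrib)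
  also have "\<dots> = (\<Sum>x\<in>S. mtrace (f x)) / of_nat (card S)"
    using assms by (auto simp: mtrace_def intro!: arg_cong2[where f="(/)"] sum.cong dest!: assms)
  finally show ?thesis .
qed

lemma sum_mat_delta:
  fixes g :: "nat \<Rightarrow> 'a::semiring_1"
  shows "(\<Sum>k = 0..<n. (if k = c then 1 else 0) * g k) = (if c < n then g c else 0)"
    "(\<Sum>k = 0..<n. g k * (if k = c then 1 else 0)) = (if c < n then g c else 0)"
  by (simp_all add: if_distrib[where f="\<lambda>x. x * _"] if_distrib[where f="\<lambda>x. _ * x"] cong: if_cong)

text \<open>
  Let \<open>E = P A\<close> be the reduced row echelon form of \<open>A\<close>. The nonzero
  rows of \<open>E\<close> form \<open>D\<close>. They restrict to an identity matrix on the
  pivot columns, which \<open>D'\<close> selects. Putting these rows back in their places and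
  applying \<open>P\<inverse>\<close> is the injective map \<open>C\<close>. The two one-sided
  inverses make \<open>D' C'\<close> a generalized inverse of \<open>A\<close>.
\<close>

lemma rank_factorization:
  fixes A :: "'a::field mat"
  assumes A: "A \<in> carrier_mat nr nc"
  obtains r C D C' D' where
    "C \<in> carrier_mat nr r" "D \<in> carrier_mat r nc" "C' \<in> carrier_mat r nr" "D' \<in> carrier_mat nc r"
    "A = C * D" "C' * C = 1\<^sub>m r" "D * D' = 1\<^sub>m r"
proof -
  obtain E F where gj: "gauss_jordan A (0\<^sub>m nr 0) = (E, F)" by fastforce
  obtain P where P: "P \<in> Units (ring_mat TYPE('a) nr ())" and EPA: "E = P * A"
    using gauss_jordan_transform[OF A zero_carrier_mat gj, of "()"] by auto
  from P obtain Q where PQ: "P \<in> carrier_mat nr nr" "Q \<in> carrier_mat nr nr" "Q * P = 1\<^sub>m nr" "P * Q = 1\<^sub>m nr"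
    unfolding Units_def by (auto simp: ring_mat_simps)
  have E: "E \<in> carrier_mat nr nc" using EPA PQ A by auto
  obtain f where f: "pivot_fun E f nc"
    using gauss_jordan_row_echelon[OF A gj] E unfolding row_echelon_form_def by auto
  note pv = pivot_funD[OF carrier_matD(1)[OF E] f]
  \<comment> \<open>the rows that contain a pivot; \<open>f i = nc\<close> encodes a zero row\<close>
  define I where "I = {i. i < nr \<and> f i < nc}"
  have finI: "finite I" unfolding I_def by simp
  define r where "r = card I"
  obtain b where b: "bij_betw b {0..<r} I"
    using finI ex_bij_betw_nat_finite r_def by blast
  have bI: "b i < nr" "f (b i) < nc" if "i < r" for i
    using b that unfolding I_def bij_betw_def by auto
  have binj: "b i = b j \<longleftrightarrow> i = j" if "i < r" "j < r" for i j
    using b that unfolding bij_betw_def inj_on_def by auto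
  define D where "D = mat r nc (\<lambda>(i, j). E $$ (b i, j))"
  define D' where "D' = mat nc r (\<lambda>(j, i). if j = f (b i) then 1 else (0::'a))"
  \<comment> \<open>\<open>J\<close> puts the chosen rows back in place, \<open>J'\<close> picks them\<close>
  define J where "J = mat nr r (\<lambda>(i, j). if i = b j then 1 else (0::'a))"
  define J' where "J' = mat r nr (\<lambda>(j, i). if i = b j then 1 else (0::'a))"
  have DD: "D * D' = 1\<^sub>m r"
    by (rule eq_matI) (auto simp: D_def D'_def scalar_prod_def sum_mat_delta bI binj pv)
  have JJ: "J' * J = 1\<^sub>m r"
    by (rule eq_matI) (auto simp: J_def J'_def scalar_prod_def sum_mat_delta bI binj pv)
  have JD: "J * D = E"
  proof (rule eq_matI)
    fix i j assume ij: "i < dim_row E" "j < dim_col E"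
    then have ij': "i < nr" "j < nc" using E by auto
    have eq: "(J * D) $$ (i, j) = (\<Sum>k = 0..<r. (if i = b k then 1 else 0) * E $$ (b k, j))"
      using ij' by (simp add: J_def D_def scalar_prod_def)
    show "(J * D) $$ (i, j) = E $$ (i, j)"
    proof (cases "i \<in> I")
      case True
      then obtain c where c: "c < r" "i = b c" using b unfolding bij_betw_def by force
      have "(\<Sum>k = 0..<r. (if i = b k then 1 else 0) * E $$ (b k, j)) =
            (\<Sum>k = 0..<r. (if k = c then 1 else 0) * E $$ (b k, j))"
        using c binj by (auto intro!: sum.cong)
      then show ?thesis using eq c by (simp add: sum_mat_delta)
    next
      case False
      then have "f i = nc" using pv(1)[OF ij'(1)] ij' unfolding I_def by auto
      then have "E $$ (i, j) = 0" using pv(2)[OF ij'(1)] ij' by simp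
      moreover have "i \<noteq> b k" if "k < r" for k using False b that unfolding bij_betw_def by auto
      ultimately show ?thesis unfolding eq by (simp add: sum.neutral)
    qed
  qed (use E in \<open>auto simp: J_def D_def\<close>)
  have c: "D \<in> carrier_mat r nc" "D' \<in> carrier_mat nc r" "J \<in> carrier_mat nr r" "J' \<in> carrier_mat r nr"
    by (auto simp: D_def D'_def J_def J'_def)
  have "(Q * J) * D = Q * (P * A)" using c PQ JD EPA by simp
  also have "\<dots> = A" using PQ A assoc_mult_mat[OF PQ(2,1) A] by simp
  finally have "A = (Q * J) * D" by simp
  moreover have "(J' * P) * (Q * J) = J' * (P * (Q * J))"
    using c PQ by (meson assoc_mult_mat mult_carrier_mat)
  moreover have "P * (Q * J) = J" using c PQ assoc_mult_mat[OF PQ(1,2) c(3)] by simp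
  ultimately show ?thesis
    using that[of "Q * J" r D "J' * P" D'] c PQ DD JJ by auto
qed

text \<open>
  Cancelling \<open>C\<close> and \<open>D\<close> on the outside of \<open>C D C D = C
  D\<close> leaves \<open>D C = 1\<close>. A direct summand given by an idempotent is thereby
  realized on some \<open>F\<^sup>r\<close>, and the trace of the idempotent is the image of
  \<open>r\<close> in the field.
\<close>

lemma idempotent_splits:
  fixes e :: "'a::field mat"
  assumes e: "e \<in> carrier_mat n n" and idem: "e * e = e"
  obtains r P Q where "P \<in> carrier_mat n r" "Q \<in> carrier_mat r n" "Q * P = 1\<^sub>m r" "P * Q = e"
proof -
  obtain r C D C' D' where c: "C \<in> carrier_mat n r" "D \<in> carrier_mat r n" "C' \<in> carrier_mat r n" "D' \<in> carrier_mat n r"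
    and f: "e = C * D" "C' * C = 1\<^sub>m r" "D * D' = 1\<^sub>m r"
    using rank_factorization[OF e] by metis
  have "C' * (C * D * (C * D)) * D' = (C' * C) * (D * C) * (D * D')"
    using c by (simp add: assoc_mult_mat[of _ r n _ r _ r] assoc_mult_mat[of _ r n _ n _ r] assoc_mult_mat[of _ n r _ r _ r] assoc_mult_mat[of _ n r _ n _ r]
       assoc_mult_mat[of _ r n _ r _ n] assoc_mult_mat[of _ n n _ r _ r] assoc_mult_mat[of _ n r _ n _ n] assoc_mult_mat[of _ n r _ r _ n] assoc_mult_mat[of _ r r _ n _ r] assoc_mult_mat[of _ r r _ r _ r] assoc_mult_mat[of _ r n _ n _ n] assoc_mult_mat[of _ r r _ n _ n] )
  moreover have "C' * (C * D) * D' = (C' * C) * (D * D')"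
    using c by (simp add: assoc_mult_mat[of _ r n _ r _ r] assoc_mult_mat[of _ r n _ n _ r] assoc_mult_mat[of _ n r _ n _ r])
  ultimately have "D * C = 1\<^sub>m r" using f idem c by simp
  then show ?thesis using that c f by metis
qed

lemma mult_mat_vec_in_carrier [simp]: "A *\<^sub>v v \<in> carrier_vec n \<longleftrightarrow> dim_row A = n"
  by (metis carrier_vecD carrier_vecI dim_mult_mat_vec)

lemma zero_mat_mult_vec: "v \<in> carrier_vec m \<Longrightarrow> 0\<^sub>m n m *\<^sub>v v = 0\<^sub>v n"
  by (intro eq_vecI) auto

lemma mat_mult_zero_vec: "A \<in> carrier_mat n m \<Longrightarrow> A *\<^sub>v 0\<^sub>v m = 0\<^sub>v n"
  by (intro eq_vecI) auto

lemma unit_vec_decomp_step: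
  fixes v :: "'a::field vec"
  assumes "k < n"
  shows "vec n (\<lambda>i. if i < Suc k then v $ i else 0) =
    vec n (\<lambda>i. if i < k then v $ i else 0) + v $ k \<cdot>\<^sub>v unit_vec n k"
  using assms by (intro eq_vecI) (auto simp: less_Suc_eq unit_vec_def)

text \<open>
  The columns of \<open>A\<close> are the images of the unit vectors; agreement on all vectors
  follows by adding the coordinates of a vector one at a time.
\<close>

lemma linear_map_matrix:
  fixes f :: "'a::field vec \<Rightarrow> 'a vec"
  assumes cl: "\<And>v. v \<in> carrier_vec n \<Longrightarrow> f v \<in> carrier_vec m"
    and add: "\<And>v w. v \<in> carrier_vec n \<Longrightarrow> w \<in> carrier_vec n \<Longrightarrow> f (v + w) = f v + f w"
    and smult: "\<And>c v. v \<in> carrier_vec n \<Longrightarrow> f (c \<cdot>\<^sub>v v) = c \<cdot>\<^sub>v f v"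
  obtains A where "A \<in> carrier_mat m n" "\<And>v. v \<in> carrier_vec n \<Longrightarrow> f v = A *\<^sub>v v"
proof -
  define A where "A = mat m n (\<lambda>(i, j). f (unit_vec n j) $ i)"
  have A: "A \<in> carrier_mat m n" by (simp add: A_def)
  have col: "f (unit_vec n k) = A *\<^sub>v unit_vec n k" if "k < n" for k
  proof -
    have "A *\<^sub>v unit_vec n k = col A k"
      using that A by (auto intro!: eq_vecI)
    also have "\<dots> = f (unit_vec n k)"
      using that cl[of "unit_vec n k"] by (auto simp: A_def intro!: eq_vecI)
    finally show ?thesis ..
  qed
  have "f v = A *\<^sub>v v" if v: "v \<in> carrier_vec n" for v
  proof -
    define t where "t k = vec n (\<lambda>i. if i < k then v $ i else 0)" for k
    have tc: "t k \<in> carrier_vec n" for k by (simp add: t_def)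
    have "f (t k) = A *\<^sub>v t k" if "k \<le> n" for k
      using that
    proof (induction k)
      case 0
      have t0: "t 0 = 0 \<cdot>\<^sub>v t 0" "t 0 = 0\<^sub>v n" by (auto simp: t_def)
      have "f (t 0) = f (0 \<cdot>\<^sub>v t 0)" using t0(1) by (rule arg_cong)
      also have "\<dots> = 0 \<cdot>\<^sub>v f (t 0)" by (rule smult[OF tc])
      also have "\<dots> = 0\<^sub>v m" using cl[OF tc[of 0]] by (intro eq_vecI) auto
      also have "\<dots> = A *\<^sub>v 0\<^sub>v n" using A by (intro eq_vecI) auto
      finally show ?case using t0(2) by simp
    next
      case (Suc k)
      then have st: "t (Suc k) = t k + v $ k \<cdot>\<^sub>v unit_vec n k"
        using unit_vec_decomp_step[of k n v] by (simp add: t_def)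
      have "f (t (Suc k)) = f (t k) + v $ k \<cdot>\<^sub>v f (unit_vec n k)"
        unfolding st by (subst add) (auto simp: tc smult)
      also have "\<dots> = A *\<^sub>v t (Suc k)"
        using Suc A tc unfolding st
        by (subst mult_add_distrib_mat_vec[OF A]) (auto simp: col mult_mat_vec[OF A])
      finally show ?case .
    qed
    moreover have "t n = v" using v by (auto simp: t_def intro!: eq_vecI)
    ultimately show ?thesis by force
  qed
  then show ?thesis using that A by blast
qed

text \<open>
  Sections of surjective maps and factorizations through injective ones are found by lifting
  columns.
\<close>

lemma column_lift:
  fixes A B :: "'a::field mat"
  assumes A: "A \<in> carrier_mat m n" and B: "B \<in> carrier_mat m w"
    and ex: "\<And>j. j < w \<Longrightarrow> \<exists>x\<in>carrier_vec n. A *\<^sub>v x = col B j"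
  obtains S where "S \<in> carrier_mat n w" "A * S = B"
proof -
  obtain s where s: "\<And>j. j < w \<Longrightarrow> s j \<in> carrier_vec n \<and> A *\<^sub>v s j = col B j"
    using ex by metis
  define S where "S = mat n w (\<lambda>(i, j). s j $ i)"
  have S: "S \<in> carrier_mat n w" by (simp add: S_def)
  have "col S j = s j" if "j < w" for j
    using s[OF that] that by (auto simp: S_def intro!: eq_vecI)
  then have "col (A * S) j = col B j" if "j < w" for j
    using col_mult2[OF A S that] s[OF that] that by simp
  then have "A * S = B"
    by (rule mat_col_eqI) (use A B S in simp_all)
  then show ?thesis using that S by blast
qed

lemma mat_mult_cancel_left:
  fixes A X Y :: "'a::field mat"
  assumes A: "A \<in> carrier_mat m n" and X: "X \<in> carrier_mat n w" and Y: "Y \<in> carrier_mat n w"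
    and inj: "\<And>v v'. v \<in> carrier_vec n \<Longrightarrow> v' \<in> carrier_vec n \<Longrightarrow> A *\<^sub>v v = A *\<^sub>v v' \<Longrightarrow> v = v'"
    and eq: "A * X = A * Y"
  shows "X = Y"
proof (rule mat_col_eqI)
  fix j assume "j < dim_col Y"
  then have j: "j < w" using Y by simp
  have *: "A *\<^sub>v col X j = A *\<^sub>v col Y j"
    using col_mult2[OF A X j] col_mult2[OF A Y j] unfolding eq by (rule trans[OF sym])
  show "col X j = col Y j" using inj[OF _ _ *] carrier_matD(1)[OF X] carrier_matD(1)[OF Y] col_dim by metis
qed (simp_all add: carrier_matD[OF X] carrier_matD[OF Y])

section \<open>Matrix representations and exact sequences\<close>

lemma vec_gmodule_simps [simp]:
  "carrier (vec_gmodule (n, \<rho>)) = carrier_vec n"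
  "ring.add (vec_gmodule (n, \<rho>)) = (+)"
  "ring.zero (vec_gmodule (n, \<rho>)) = 0\<^sub>v n"
  "module.smult (vec_gmodule (n, \<rho>)) = (\<cdot>\<^sub>v)"
  "act (vec_gmodule (n, \<rho>)) = (\<lambda>g v. \<rho> g *\<^sub>v v)"
  apply (simp_all add: vec_gmodule_def module.defs)
  apply (simp_all add:  module_vec_def )
  apply (simp_all add:  gmodule.fields_def)
  done
lemma gmodule_hom_iff:
  "f \<in> gmodule_hom G V W \<longleftrightarrow>
    (\<forall>v\<in>carrier V. f v \<in> carrier W) \<and>
    (\<forall>v\<in>carrier V. \<forall>w\<in>carrier V. f (v \<oplus>\<^bsub>V\<^esub> w) = f v \<oplus>\<^bsub>W\<^esub> f w) \<and>
    (\<forall>c. \<forall>v\<in>carrier V. f (c \<odot>\<^bsub>V\<^esub> v) = c \<odot>\<^bsub>W\<^esub> f v) \<and>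
    (\<forall>g\<in>carrier G. \<forall>v\<in>carrier V. f (act V g v) = act W g (f v))"
  unfolding gmodule_hom_def LinearCombinations.module_hom_def by (auto simp: Pi_iff)

lemma matrix_repsD:
  assumes "(n, \<rho>) \<in> matrix_reps G"
  shows "g \<in> carrier G \<Longrightarrow> \<rho> g \<in> carrier_mat n n" "\<rho> \<one>\<^bsub>G\<^esub> = 1\<^sub>m n"
    "g \<in> carrier G \<Longrightarrow> h \<in> carrier G \<Longrightarrow> \<rho> (g \<otimes>\<^bsub>G\<^esub> h) = \<rho> g * \<rho> h"
  using assms unfolding matrix_reps_def by blast+

lemma mat_hom_gmodule_hom:
  assumes A: "(A::'a::field mat) \<in> carrier_mat m n"
    and V: "(n, \<rho>) \<in> matrix_reps G" and W: "(m, \<sigma>) \<in> matrix_reps G"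
    and int: "\<And>g. g \<in> carrier G \<Longrightarrow> A * \<rho> g = \<sigma> g * A"
  shows "(\<lambda>v. A *\<^sub>v v) \<in> gmodule_hom G (vec_gmodule (n, \<rho>)) (vec_gmodule (m, \<sigma>))"
  using A unfolding gmodule_hom_iff
  by (auto simp: mult_add_distrib_mat_vec[OF A] mult_mat_vec[OF A] int
      assoc_mult_mat_vec[OF A matrix_repsD(1)[OF V], symmetric]
      assoc_mult_mat_vec[OF matrix_repsD(1)[OF W] A, symmetric])

lemma gmodule_hom_matrix:
  fixes \<rho> :: "'g \<Rightarrow> 'a::field mat"
  assumes V: "(n, \<rho>) \<in> matrix_reps G" and W: "(m, \<sigma>) \<in> matrix_reps G"
    and f: "f \<in> gmodule_hom G (vec_gmodule (n, \<rho>)) (vec_gmodule (m, \<sigma>))"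
  obtains A where "A \<in> carrier_mat m n" "\<And>v. v \<in> carrier_vec n \<Longrightarrow> f v = A *\<^sub>v v"
    "\<And>g. g \<in> carrier G \<Longrightarrow> A * \<rho> g = \<sigma> g * A"
proof -
  note f' = f[unfolded gmodule_hom_iff, simplified]
  obtain A where A: "A \<in> carrier_mat m n" and fA: "\<And>v. v \<in> carrier_vec n \<Longrightarrow> f v = A *\<^sub>v v"
    using f' by (elim linear_map_matrix[of n f m, rotated -1]) auto
  have "A * \<rho> g = \<sigma> g * A" if g: "g \<in> carrier G" for g
  proof (rule mat_col_eqI)
    note R = matrix_repsD(1)[OF V g] and S = matrix_repsD(1)[OF W g]
    fix j assume "j < dim_col (\<sigma> g * A)"
    then have j: "j < n" using A by simp
    have "f (\<rho> g *\<^sub>v unit_vec n j) = \<sigma> g *\<^sub>v f (unit_vec n j)" using f' g by simp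
    then have "A *\<^sub>v (\<rho> g *\<^sub>v unit_vec n j) = \<sigma> g *\<^sub>v (A *\<^sub>v unit_vec n j)" using R fA by simp
    then have "(A * \<rho> g) *\<^sub>v unit_vec n j = (\<sigma> g * A) *\<^sub>v unit_vec n j"
      using assoc_mult_mat_vec[OF A R] assoc_mult_mat_vec[OF S A] by simp
    moreover have "X *\<^sub>v unit_vec n j = col X j" if "X \<in> carrier_mat m n" for X :: "'a mat"
      using that j by (auto intro!: eq_vecI)
    ultimately show "col (A * \<rho> g) j = col (\<sigma> g * A) j" using A R S by (metis mult_carrier_mat)
  qed (use A matrix_repsD(1)[OF V g] matrix_repsD(1)[OF W g] in auto)
  then show ?thesis using that A fA by blast
qed

abbreviation rep_char :: "('f::field, 'g) matrix_rep \<Rightarrow> 'g \<Rightarrow> 'f" where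
  "rep_char V g \<equiv> mtrace (snd V g)"

text \<open>
  An exact sequence splits linearly. If \<open>S\<close> is a section of the projection
  \<open>P\<close>, then \<open>1 - S P\<close> maps into the kernel of \<open>P\<close>, hence
  equals \<open>I L\<close> for the injection \<open>I\<close> and a retraction \<open>L\<close>
  of it. Inserting \<open>1 = S P + I L\<close> into the trace and moving the factors around
  cyclically, equivariance of \<open>P\<close> and \<open>I\<close> produces the traces on the
  quotient and on the submodule.
\<close>

lemma short_exact_char:
  fixes U V W :: "('f::field, 'g) matrix_rep"
  assumes U: "U \<in> matrix_reps G" and V: "V \<in> matrix_reps G" and W: "W \<in> matrix_reps G"
    and ses: "short_exact G (vec_gmodule U) (vec_gmodule V) (vec_gmodule W)" and g: "g \<in> carrier G"
  shows "rep_char V g = rep_char U g + rep_char W g"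
proof -
  obtain u \<alpha> n \<rho> w \<beta> where UVW: "U = (u, \<alpha>)" "V = (n, \<rho>)" "W = (w, \<beta>)" by (metis surj_pair)
  note U = U[unfolded UVW] and V = V[unfolded UVW] and W = W[unfolded UVW]
  obtain i p where i: "i \<in> gmodule_hom G (vec_gmodule (u, \<alpha>)) (vec_gmodule (n, \<rho>))"
    and p: "p \<in> gmodule_hom G (vec_gmodule (n, \<rho>)) (vec_gmodule (w, \<beta>))"
    and inj: "inj_on i (carrier_vec u)"
    and ex: "i ` carrier_vec u = {v \<in> carrier_vec n. p v = 0\<^sub>v w}"
    and sur: "p ` carrier_vec n = carrier_vec w"
    using ses unfolding short_exact_def UVW by auto
  obtain I where I: "I \<in> carrier_mat n u" and iI: "\<And>v. v \<in> carrier_vec u \<Longrightarrow> i v = I *\<^sub>v v"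
    and Iint: "I * \<alpha> g = \<rho> g * I"
    using gmodule_hom_matrix[OF U V i] g by metis
  obtain P where P: "P \<in> carrier_mat w n" and pP: "\<And>v. v \<in> carrier_vec n \<Longrightarrow> p v = P *\<^sub>v v"
    and Pint: "P * \<rho> g = \<beta> g * P"
    using gmodule_hom_matrix[OF V W p] g by metis
  note a = matrix_repsD(1)[OF U g] and r = matrix_repsD(1)[OF V g] and b = matrix_repsD(1)[OF W g]
  have ker: "\<exists>x\<in>carrier_vec u. I *\<^sub>v x = v" if "v \<in> carrier_vec n" "P *\<^sub>v v = 0\<^sub>v w" for v
  proof -
    have "v \<in> i ` carrier_vec u" using ex that pP by simp
    then show ?thesis using iI by auto
  qed
  have kerI: "P *\<^sub>v (I *\<^sub>v x) = 0\<^sub>v w" if "x \<in> carrier_vec u" for x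
  proof -
    have "i x \<in> {v \<in> carrier_vec n. p v = 0\<^sub>v w}" using ex that by blast
    then show ?thesis using that iI[OF that] pP[of "I *\<^sub>v x"] I by simp
  qed
  have injI: "v = v'" if "v \<in> carrier_vec u" "v' \<in> carrier_vec u" "I *\<^sub>v v = I *\<^sub>v v'" for v v'
    using inj that iI unfolding inj_on_def by simp
  have surP: "\<exists>x\<in>carrier_vec n. P *\<^sub>v x = v" if "v \<in> carrier_vec w" for v
    using that sur pP by (metis imageE)
  obtain S where S: "S \<in> carrier_mat n w" and PS: "P * S = 1\<^sub>m w"
    using surP by (rule column_lift[OF P one_carrier_mat[of w]]) auto
  define B where "B = 1\<^sub>m n - S * P"
  have B: "B \<in> carrier_mat n n" unfolding B_def by (intro minus_carrier_mat mult_carrier_mat[OF S P])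
  have "P * (S * P) = P" using assoc_mult_mat[OF P S P] PS P by simp
  then have PB: "P * B = 0\<^sub>m w n"
    using P S by (simp add: B_def mult_minus_distrib_mat[OF P one_carrier_mat])
  obtain L where L: "L \<in> carrier_mat u n" and IL: "I * L = B"
  proof (rule column_lift[OF I B])
    fix j assume j: "j < n"
    have "P *\<^sub>v col B j = 0\<^sub>v w" using col_mult2[OF P B j] PB j by simp
    then show "\<exists>x\<in>carrier_vec u. I *\<^sub>v x = col B j" using ker[of "col B j"] col_dim[of B j] carrier_matD(1)[OF B] by simp
  qed auto
  have PI: "P * I = 0\<^sub>m w u"
  proof (rule mat_col_eqI)
    fix j assume "j < dim_col (0\<^sub>m w u :: 'f mat)"
    then have j: "j < u" by simp
    have "col I j = I *\<^sub>v unit_vec u j" using I j by (auto intro!: eq_vecI)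
    then show "col (P * I) j = col (0\<^sub>m w u) j"
      using col_mult2[OF P I j] kerI[of "unit_vec u j"] j by simp
  qed (use P I in auto)
  have LI: "L * I = 1\<^sub>m u"
  proof (rule mat_mult_cancel_left[OF I _ _ injI])
    have "I * (L * I) = B * I" using assoc_mult_mat[OF I L I] IL by simp
    also have "\<dots> = I - S * (P * I)"
      using S P I by (simp add: B_def minus_mult_distrib_mat[OF one_carrier_mat] assoc_mult_mat[OF S P I])
    also have "\<dots> = I * 1\<^sub>m u" using PI S I by (auto intro!: eq_matI)
    finally show "I * (L * I) = I * 1\<^sub>m u" .
  qed (use L I in auto)
  have SP: "S * P + I * L = 1\<^sub>m n"
    unfolding IL B_def using S P by (auto intro!: eq_matI)
  have "mtrace (\<rho> g) = mtrace (\<rho> g * (S * P + I * L))" using SP r by simp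
  also have "\<dots> = mtrace (\<rho> g * (S * P)) + mtrace (\<rho> g * (I * L))"
    using r S P I L
    by (simp add: mult_add_distrib_mat[OF r mult_carrier_mat[OF S P] mult_carrier_mat[OF I L]] mtrace_add[of _ n])
  also have "mtrace (\<rho> g * (S * P)) = mtrace (P * (\<rho> g * S))"
    using mtrace_comm[of "\<rho> g * S" n w P] assoc_mult_mat[OF r S P] r S P by simp
  also have "P * (\<rho> g * S) = \<beta> g"
    using assoc_mult_mat[OF P r S] assoc_mult_mat[OF b P S] Pint PS b by simp
  also have "mtrace (\<rho> g * (I * L)) = mtrace (L * (\<rho> g * I))"
    using mtrace_comm[of "\<rho> g * I" n u L] assoc_mult_mat[OF r I L] r I L by simp
  also have "L * (\<rho> g * I) = \<alpha> g"
    using assoc_mult_mat[OF L I a] Iint LI a by simp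
  finally show ?thesis unfolding UVW by simp
qed

text \<open>
  Exactness is certified by matrices: a linear decomposition \<open>1 = P Q + P' Q'\<close> with
  an equivariant injection \<open>P\<close> and an equivariant projection \<open>Q'\<close>.
  Multiplying the decomposition by \<open>Q'\<close> shows \<open>Q' P = 0\<close>, and applying
  it to a vector of the kernel of \<open>Q'\<close> exhibits the preimage under
  \<open>P\<close>.
\<close>

lemma split_short_exact:
  fixes \<rho> :: "'g \<Rightarrow> 'a::field mat"
  assumes U: "(u, \<alpha>) \<in> matrix_reps G" and V: "(n, \<rho>) \<in> matrix_reps G" and W: "(w, \<beta>) \<in> matrix_reps G"
    and P: "P \<in> carrier_mat n u" and Q: "Q \<in> carrier_mat u n"
    and P': "P' \<in> carrier_mat n w" and Q': "Q' \<in> carrier_mat w n"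
    and QP: "Q * P = 1\<^sub>m u" and QP': "Q' * P' = 1\<^sub>m w" and sum: "P * Q + P' * Q' = 1\<^sub>m n"
    and iP: "\<And>g. g \<in> carrier G \<Longrightarrow> P * \<alpha> g = \<rho> g * P"
    and iQ: "\<And>g. g \<in> carrier G \<Longrightarrow> Q' * \<rho> g = \<beta> g * Q'"
  shows "short_exact G (vec_gmodule (u, \<alpha>)) (vec_gmodule (n, \<rho>)) (vec_gmodule (w, \<beta>))"
proof -
  have "Q' = Q' * (P * Q + P' * Q')" using sum Q' by simp
  also have "\<dots> = Q' * (P * Q) + Q' * (P' * Q')"
    using P Q P' Q' by (intro mult_add_distrib_mat[OF Q']) auto
  also have "Q' * (P' * Q') = Q'" using assoc_mult_mat[OF Q' P' Q'] QP' Q' by simp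
  finally have "Q' * (P * Q) + Q' = Q'" ..
  then have z: "Q' * (P * Q) = 0\<^sub>m w n"
  proof -
    assume eq: "Q' * (P * Q) + Q' = Q'"
    have "(Q' * (P * Q)) $$ (i, j) = 0" if "i < w" "j < n" for i j
    proof -
      have "(Q' * (P * Q) + Q') $$ (i, j) = (Q' * (P * Q)) $$ (i, j) + Q' $$ (i, j)"
        using that Q' by (intro index_add_mat) auto
      then show ?thesis using eq by simp
    qed
    then show ?thesis using P Q P' Q' by (intro eq_matI) auto
  qed
  have "Q' * P = (Q' * (P * Q)) * P"
    using QP P Q Q' assoc_mult_mat[OF Q' mult_carrier_mat[OF P Q] P] assoc_mult_mat[OF P Q P] by simp
  then have QP0: "Q' * P = 0\<^sub>m w u" using z P by simp
  have dec: "v = P *\<^sub>v (Q *\<^sub>v v) + P' *\<^sub>v (Q' *\<^sub>v v)" if v: "v \<in> carrier_vec n" for v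
  proof -
    have "v = (P * Q + P' * Q') *\<^sub>v v" using sum v by simp
    also have "\<dots> = (P * Q) *\<^sub>v v + (P' * Q') *\<^sub>v v"
      using P Q P' Q' v by (intro add_mult_distrib_mat_vec[where nr = n and nc = n]) auto
    finally show ?thesis using assoc_mult_mat_vec[OF P Q v] assoc_mult_mat_vec[OF P' Q' v] by simp
  qed
  show ?thesis
    unfolding short_exact_def
  proof (intro bexI conjI)
    show "(\<lambda>v. P *\<^sub>v v) \<in> gmodule_hom G (vec_gmodule (u, \<alpha>)) (vec_gmodule (n, \<rho>))"
      by (rule mat_hom_gmodule_hom[OF P U V iP])
    show "(\<lambda>v. Q' *\<^sub>v v) \<in> gmodule_hom G (vec_gmodule (n, \<rho>)) (vec_gmodule (w, \<beta>))"
      by (rule mat_hom_gmodule_hom[OF Q' V W iQ])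
    have inv: "Q *\<^sub>v (P *\<^sub>v v) = v" if "v \<in> carrier_vec u" for v
      using assoc_mult_mat_vec[OF Q P that] QP that by simp
    show "inj_on ((*\<^sub>v) P) (carrier (vec_gmodule (u, \<alpha>)))"
      by (rule inj_on_inverseI[where g = "\<lambda>v. Q *\<^sub>v v"]) (simp add: inv)
    have "Q' *\<^sub>v (P *\<^sub>v v) = 0\<^sub>v w" if "v \<in> carrier_vec u" for v
      using assoc_mult_mat_vec[OF Q' P that] QP0 that by (metis zero_mat_mult_vec)
    moreover have "v \<in> (*\<^sub>v) P ` carrier_vec u" if "v \<in> carrier_vec n" "Q' *\<^sub>v v = 0\<^sub>v w" for v
    proof (rule image_eqI[where x = "Q *\<^sub>v v"])
      show "v = P *\<^sub>v (Q *\<^sub>v v)" using dec[OF that(1)] that P P' Q by (simp add: mat_mult_zero_vec)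
    qed (use Q in simp)
    ultimately show "(*\<^sub>v) P ` carrier (vec_gmodule (u, \<alpha>)) =
        {v \<in> carrier (vec_gmodule (n, \<rho>)). Q' *\<^sub>v v = \<zero>\<^bsub>vec_gmodule (w, \<beta>)\<^esub>}"
      using P by auto
    have "v \<in> (*\<^sub>v) Q' ` carrier_vec n" if "v \<in> carrier_vec w" for v
    proof (rule image_eqI[where x = "P' *\<^sub>v v"])
      show "v = Q' *\<^sub>v (P' *\<^sub>v v)" using assoc_mult_mat_vec[OF Q' P' that] QP' that by simp
    qed (use P' in simp)
    then show "(*\<^sub>v) Q' ` carrier (vec_gmodule (n, \<rho>)) = carrier (vec_gmodule (w, \<beta>))"
      using Q' by auto
  qed
qed

definition zero_rep :: "('f::field, 'g) matrix_rep" where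
  "zero_rep = (0, \<lambda>g. 1\<^sub>m 0)"

lemma zero_rep_in [simp]: "zero_rep \<in> matrix_reps G"
  by (auto simp: zero_rep_def matrix_reps_def)

text \<open>
  The bijection \<open>V \<rightarrow> M \<rightarrow> W\<close> is the first map of an exact
  sequence ending in the zero representation, so additivity of characters applies. Hence the
  arbitrary choice in \<^const>\<open>matrix_form\<close> does not affect characters.
\<close>

lemma gmodule_iso_char:
  fixes V W :: "('f::field, 'g) matrix_rep" and M :: "('f, 'v, 'g) gmodule"
  assumes V: "V \<in> matrix_reps G" and W: "W \<in> matrix_reps G"
    and iV: "gmodule_iso G (vec_gmodule V) M" and iW: "gmodule_iso G (vec_gmodule W) M"
    and g: "g \<in> carrier G"
  shows "rep_char V g = rep_char W g"
proof -
  obtain n \<rho> m \<sigma> where VW: "V = (n, \<rho>)" "W = (m, \<sigma>)" by (metis surj_pair)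
  note V = V[unfolded VW] and W = W[unfolded VW]
  obtain f where f: "f \<in> gmodule_hom G (vec_gmodule (n, \<rho>)) M" "bij_betw f (carrier_vec n) (carrier M)"
    using iV unfolding gmodule_iso_def VW by auto
  obtain f' where f': "f' \<in> gmodule_hom G (vec_gmodule (m, \<sigma>)) M" "bij_betw f' (carrier_vec m) (carrier M)"
    using iW unfolding gmodule_iso_def VW by auto
  note fD = f(1)[unfolded gmodule_hom_iff, simplified] and fD' = f'(1)[unfolded gmodule_hom_iff, simplified]
  define h where "h v = inv_into (carrier_vec m) f' (f v)" for v
  have h: "h v \<in> carrier_vec m" "f' (h v) = f v" if "v \<in> carrier_vec n" for v
  proof -
    have "f v \<in> f' ` carrier_vec m" using f' fD that unfolding bij_betw_def by auto
    then show "h v \<in> carrier_vec m" "f' (h v) = f v"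
      unfolding h_def by (auto intro: inv_into_into f_inv_into_f)
  qed
  have eqI: "x = y" if "x \<in> carrier_vec m" "y \<in> carrier_vec m" "f' x = f' y" for x y
    using f'(2) that unfolding bij_betw_def inj_on_def by blast
  have actn: "\<rho> g *\<^sub>v v \<in> carrier_vec n" if "g \<in> carrier G" for g v
    using matrix_repsD(1)[OF V that] by simp
  have actm: "\<sigma> g *\<^sub>v v \<in> carrier_vec m" if "g \<in> carrier G" for g v
    using matrix_repsD(1)[OF W that] by simp
  have hh: "h \<in> gmodule_hom G (vec_gmodule (n, \<rho>)) (vec_gmodule (m, \<sigma>))"
    unfolding gmodule_hom_iff
    using fD fD' h actn actm by (auto simp del: mult_mat_vec_in_carrier intro!: eqI)
  have "inj_on h (carrier_vec n)"
    using f(2) h by (metis bij_betw_def inj_on_def)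
  moreover have "h ` carrier_vec n = carrier_vec m"
  proof safe
    fix x :: "'f vec" assume x: "x \<in> carrier_vec m"
    then obtain v where "v \<in> carrier_vec n" "f v = f' x"
      using fD' f(2) unfolding bij_betw_def by (metis imageE)
    then show "x \<in> h ` carrier_vec n" using h eqI x by (metis image_eqI)
  qed (use h in auto)
  moreover have zh: "(\<lambda>v. 0\<^sub>v 0) \<in> gmodule_hom G (vec_gmodule (m, \<sigma>)) (vec_gmodule (0, \<lambda>g. 1\<^sub>m 0))"
    unfolding gmodule_hom_iff by auto
  moreover have "(carrier_vec n :: 'f vec set) \<noteq> {}" by (metis empty_iff zero_carrier_vec)
  ultimately have "short_exact G (vec_gmodule (n, \<rho>)) (vec_gmodule (m, \<sigma>)) (vec_gmodule zero_rep)"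
    unfolding short_exact_def zero_rep_def
    by (intro bexI[OF bexI[OF _ zh] hh] conjI) (auto simp: image_constant_conv)
  from short_exact_char[OF V W zero_rep_in this g]
  show ?thesis unfolding VW by (simp add: zero_rep_def mtrace_def)
qed

section \<open>Abelian groups given by generators and relations\<close>

lemma frag_extend_fun_diff:
  "frag_extend (\<lambda>a. f a - g a) x = frag_extend f x - frag_extend g x"
proof -
  have "Poly_Mapping.keys x \<subseteq> UNIV" by simp
  then show ?thesis
    by (induction x rule: frag_induction) (auto simp: frag_extend_diff)
qed

lemma frag_extend_fun_0 [simp]: "frag_extend (\<lambda>a. 0) x = 0"
  using frag_extend_fun_diff[of "\<lambda>a. 0" "\<lambda>a. 0" x] by simp

lemma frag_biextend_simps [simp]:
  "frag_biextend f (frag_of a) y = frag_extend (f a) y"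
  "frag_biextend f x (frag_of b) = frag_extend (\<lambda>a. f a b) x"
  "frag_biextend f 0 y = 0" "frag_biextend f x 0 = 0"
  by (simp_all add: frag_biextend_def)

lemma frag_biextend_diff_left: "frag_biextend f (x - x') y = frag_biextend f x y - frag_biextend f x' y"
  by (simp add: frag_biextend_def frag_extend_diff)

lemma frag_biextend_diff_right: "frag_biextend f x (y - y') = frag_biextend f x y - frag_biextend f x y'"
  by (simp add: frag_biextend_def frag_extend_diff frag_extend_fun_diff)

lemma frag_keys_diff:
  "Poly_Mapping.keys x \<subseteq> S \<Longrightarrow> Poly_Mapping.keys y \<subseteq> S \<Longrightarrow> Poly_Mapping.keys (x - y :: 'a \<Rightarrow>\<^sub>0 int) \<subseteq> S"
  using keys_diff[of x y] by blast

lemma frag_keys_add: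
  "Poly_Mapping.keys x \<subseteq> S \<Longrightarrow> Poly_Mapping.keys y \<subseteq> S \<Longrightarrow> Poly_Mapping.keys (x + y :: 'a \<Rightarrow>\<^sub>0 int) \<subseteq> S"
  using keys_add[of x y] by blast

lemma frag_extend_keys:
  assumes "Poly_Mapping.keys x \<subseteq> S" "\<And>a. a \<in> S \<Longrightarrow> Poly_Mapping.keys (f a) \<subseteq> T"
  shows "Poly_Mapping.keys (frag_extend f x) \<subseteq> T"
  using keys_frag_extend[of f x] assms by blast

lemma frag_biextend_keys:
  assumes "Poly_Mapping.keys x \<subseteq> S" "Poly_Mapping.keys y \<subseteq> S'"
    "\<And>a b. a \<in> S \<Longrightarrow> b \<in> S' \<Longrightarrow> Poly_Mapping.keys (f a b) \<subseteq> T"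
  shows "Poly_Mapping.keys (frag_biextend f x y) \<subseteq> T"
  unfolding frag_biextend_def
  by (rule frag_extend_keys[OF assms(1)], rule frag_extend_keys[OF assms(2)], rule assms(3))

locale presentation =
  fixes S :: "'a set" and R :: "('a \<Rightarrow>\<^sub>0 int) set"
  assumes relations_keys: "r \<in> R \<Longrightarrow> Poly_Mapping.keys r \<subseteq> S"
begin

abbreviation "N \<equiv> relation_subgroup S R"

lemma N_subgroup: "subgroup N (free_Abelian_group S)"
  unfolding relation_subgroup_def
  by (rule group.generate_is_subgroup) (use relations_keys in auto)

lemma N_keys: "x \<in> N \<Longrightarrow> Poly_Mapping.keys x \<subseteq> S"
  using subsetD[OF subgroup.subset[OF N_subgroup]] by simp

lemma N_zero [simp]: "0 \<in> N"
  using subgroup.one_closed[OF N_subgroup] by simp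

lemma N_add: "x \<in> N \<Longrightarrow> y \<in> N \<Longrightarrow> x + y \<in> N"
  using subgroup.m_closed[OF N_subgroup] by fastforce

lemma N_minus: "x \<in> N \<Longrightarrow> - x \<in> N"
  using subgroup.m_inv_closed[OF N_subgroup] N_keys by fastforce

lemma N_diff: "x \<in> N \<Longrightarrow> y \<in> N \<Longrightarrow> x - y \<in> N"
  using N_add[OF _ N_minus, of x y] by simp

lemma N_induct [consumes 1, case_names zero gen minus add]:
  assumes "x \<in> N" "P 0" "\<And>r. r \<in> R \<Longrightarrow> P r" "\<And>x. P x \<Longrightarrow> P (- x)" "\<And>x y. P x \<Longrightarrow> P y \<Longrightarrow> P (x + y)"
  shows "P x"
  using assms(1) unfolding relation_subgroup_def
  by (induction rule: generate.induct) (use assms relations_keys in auto)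

lemma N_normal: "N \<lhd> free_Abelian_group S"
  using comm_group.normal_iff_subgroup[OF abelian_free_Abelian_group] N_subgroup by blast

abbreviation "cls \<equiv> presented_class S R"

lemma mem_cls_iff:
  assumes y: "Poly_Mapping.keys y \<subseteq> S"
  shows "x \<in> cls y \<longleftrightarrow> x - y \<in> N"
proof
  show "x \<in> cls y \<Longrightarrow> x - y \<in> N"
    by (auto simp: presented_class_def r_coset_def)
  assume "x - y \<in> N"
  then show "x \<in> cls y"
    unfolding presented_class_def r_coset_def by (auto intro!: bexI[of _ "x - y"])
qed

lemma mem_cls_keys:
  assumes y: "Poly_Mapping.keys y \<subseteq> S" and "x \<in> cls y"
  shows "Poly_Mapping.keys x \<subseteq> S"
proof -
  have "x - y \<in> N" using assms mem_cls_iff by blast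
  then have "Poly_Mapping.keys ((x - y) + y) \<subseteq> S" using N_keys y by (intro frag_keys_add) auto
  then show ?thesis by simp
qed

lemma self_mem_cls: "Poly_Mapping.keys y \<subseteq> S \<Longrightarrow> y \<in> cls y"
  by (simp add: mem_cls_iff)

lemma cls_eq_iff:
  assumes x: "Poly_Mapping.keys x \<subseteq> S" and y: "Poly_Mapping.keys y \<subseteq> S"
  shows "cls x = cls y \<longleftrightarrow> x - y \<in> N"
proof
  show "cls x = cls y \<Longrightarrow> x - y \<in> N" using self_mem_cls[OF x] mem_cls_iff[OF y] by auto
  assume xy: "x - y \<in> N"
  have "z - x \<in> N \<longleftrightarrow> z - y \<in> N" for z
    using N_add[OF _ xy, of "z - x"] N_diff[OF _ xy, of "z - y"] by auto
  then show "cls x = cls y" using mem_cls_iff x y by blast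
qed

lemma carrier_presented: "carrier (presented_group S R) = {cls x | x. Poly_Mapping.keys x \<subseteq> S}"
  unfolding presented_group_def FactGroup_def RCOSETS_def presented_class_def by auto

lemma presented_mult:
  "Poly_Mapping.keys x \<subseteq> S \<Longrightarrow> Poly_Mapping.keys y \<subseteq> S \<Longrightarrow>
    cls x \<otimes>\<^bsub>presented_group S R\<^esub> cls y = cls (x + y)"
  unfolding presented_group_def FactGroup_def presented_class_def
  using normal.rcos_sum[OF N_normal, of x y] by simp

lemma presented_one: "\<one>\<^bsub>presented_group S R\<^esub> = cls 0"
proof -
  have "x \<in> cls 0 \<longleftrightarrow> x \<in> N" for x using mem_cls_iff[of 0 x] by simp
  then show ?thesis unfolding presented_group_def FactGroup_def by auto
qed

lemma presented_comm_group: "comm_group (presented_group S R)"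
  unfolding presented_group_def
  by (rule comm_group.abelian_FactGroup[OF abelian_free_Abelian_group N_subgroup])

lemma UN_cls:
  assumes x: "Poly_Mapping.keys x \<subseteq> S" and "\<And>x'. Poly_Mapping.keys x' \<subseteq> S \<Longrightarrow> x' - x \<in> N \<Longrightarrow> F x' = F x"
  shows "(\<Union>x'\<in>cls x. F x') = F x"
proof -
  have "F x' = F x" if "x' \<in> cls x" for x'
    using assms that mem_cls_keys mem_cls_iff by blast
  then show ?thesis using self_mem_cls[OF x] by blast
qed

end

text \<open>
  A homomorphism of free groups passes to the presented groups as soon as it sends each relation
  to a consequence of relations.
\<close>

lemma frag_extend_respects:
  assumes p: "presentation S R" and p': "presentation S' R'"
    and gen: "\<And>r. r \<in> R \<Longrightarrow> frag_extend f r \<in> relation_subgroup S' R'"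
    and x: "x \<in> relation_subgroup S R"
  shows "frag_extend f x \<in> relation_subgroup S' R'"
proof -
  interpret presentation S R by (fact p)
  interpret p': presentation S' R' by (fact p')
  show ?thesis using x
    by (induction rule: N_induct)
      (auto simp: gen frag_extend_minus frag_extend_add intro: p'.N_minus p'.N_add)
qed

text \<open>
  Both arguments change by relations. With one argument fixed the biextension is a homomorphism
  in the other, so on relations it is enough to fix a generator.
\<close>

lemma frag_biextend_respects:
  assumes p: "presentation S1 R1" and p': "presentation S2 R2" and p'': "presentation S3 R3"
    and gen1: "\<And>r b. r \<in> R1 \<Longrightarrow> b \<in> S2 \<Longrightarrow> frag_extend (\<lambda>a. f a b) r \<in> relation_subgroup S3 R3"
    and gen2: "\<And>a r. a \<in> S1 \<Longrightarrow> r \<in> R2 \<Longrightarrow> frag_extend (f a) r \<in> relation_subgroup S3 R3"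
    and x: "Poly_Mapping.keys x \<subseteq> S1" "Poly_Mapping.keys x' \<subseteq> S1" "x' - x \<in> relation_subgroup S1 R1"
    and y: "Poly_Mapping.keys y \<subseteq> S2" "Poly_Mapping.keys y' \<subseteq> S2" "y' - y \<in> relation_subgroup S2 R2"
  shows "frag_biextend f x' y' - frag_biextend f x y \<in> relation_subgroup S3 R3"
proof -
  interpret p'': presentation S3 R3 by (fact p'')
  have l: "frag_biextend f d y \<in> relation_subgroup S3 R3"
    if d: "d \<in> relation_subgroup S1 R1" and y: "Poly_Mapping.keys y \<subseteq> S2" for d y
    using y
  proof (induction y rule: frag_induction)
    case (one b)
    then show ?case using frag_extend_respects[OF p p'' gen1 d] by simp
  qed (auto simp: frag_biextend_diff_right intro: p''.N_diff)
  have r: "frag_biextend f x e \<in> relation_subgroup S3 R3"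
    if e: "e \<in> relation_subgroup S2 R2" and x: "Poly_Mapping.keys x \<subseteq> S1" for e x
    using x
  proof (induction x rule: frag_induction)
    case (one a)
    then show ?case using frag_extend_respects[OF p' p'' gen2 e] by simp
  qed (auto simp: frag_biextend_diff_left intro: p''.N_diff)
  have "frag_biextend f x' y' - frag_biextend f x y =
      frag_biextend f (x' - x) y' + frag_biextend f x (y' - y)"
    by (simp add: frag_biextend_diff_right frag_biextend_diff_left)
  then show ?thesis using l[OF x(3) y(2)] r[OF y(3) x(1)] p''.N_add by simp
qed

text \<open>
  Both sides are triadditive, so it suffices to compare them on generators.
\<close>

lemma frag_biextend_assoc:
  assumes "\<And>a b c. a \<in> S1 \<Longrightarrow> b \<in> S2 \<Longrightarrow> c \<in> S3 \<Longrightarrow>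
      frag_extend (\<lambda>d. h d c) (f a b) = frag_extend (h' a) (f' b c)"
    and x: "Poly_Mapping.keys x \<subseteq> S1" and y: "Poly_Mapping.keys y \<subseteq> S2" and z: "Poly_Mapping.keys z \<subseteq> S3"
  shows "frag_biextend h (frag_biextend f x y) z = frag_biextend h' x (frag_biextend f' y z)"
  using x
proof (induction x rule: frag_induction)
  case (one a)
  then have a: "a \<in> S1" .
  show ?case using y
  proof (induction y rule: frag_induction)
    case (one b)
    then have b: "b \<in> S2" .
    show ?case using z
    proof (induction z rule: frag_induction)
      case (one c)
      show ?case using assms(1)[OF a b one] by simp
    qed (auto simp: frag_biextend_diff_right frag_extend_diff)
  qed (auto simp: frag_biextend_diff_right frag_biextend_diff_left frag_extend_diff)
qed (auto simp: frag_biextend_diff_left)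

section \<open>Kronecker products\<close>

text \<open>
  Stated with dimensions instead of carriers, associativity is usable for rewriting: its
  conditions introduce no unknowns.
\<close>

lemma mat_assoc: "dim_col A = dim_row B \<Longrightarrow> dim_col B = dim_row C \<Longrightarrow> (A * B) * C = A * (B * (C::'a::field mat))"
  by (rule assoc_mult_mat[of _ "dim_row A" "dim_col A" _ "dim_col B" _ "dim_col C"]) auto

lemma mat_cancel:
  "A * B = C \<Longrightarrow> dim_col A = dim_row B \<Longrightarrow> dim_col B = dim_row X \<Longrightarrow> A * (B * X) = C * (X::'a::field mat)"
  using mat_assoc[of A B X] by simp

lemma sum_div_mod:
  "(\<Sum>k<m * p. F (k div p) (k mod p)) = (\<Sum>a<m. \<Sum>b<(p::nat). (F a b :: 'a::comm_monoid_add))"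
proof (cases "p = 0")
  case False
  have "(\<Sum>a<m. \<Sum>b<p. F a b) = (\<Sum>(a, b)\<in>{..<m} \<times> {..<p}. F a b)"
    by (simp add: sum.cartesian_product)
  also have "\<dots> = (\<Sum>k<m * p. F (k div p) (k mod p))"
  proof (rule sum.reindex_bij_witness[of _ "\<lambda>k. (k div p, k mod p)" "\<lambda>(a, b). a * p + b"])
    fix ab assume "ab \<in> {..<m} \<times> {..<p}"
    then obtain a b where ab: "ab = (a, b)" "a < m" "b < p" by auto
    have "a * p + b < Suc a * p" using ab(3) by simp
    also have "\<dots> \<le> m * p" using ab by (intro mult_right_mono) auto
    finally show "(case ab of (a, b) \<Rightarrow> a * p + b) \<in> {..<m * p}" using ab by simp
  qed (use False in \<open>auto simp: less_mult_imp_div_less\<close>)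
  finally show ?thesis ..
qed simp

lemma div_less_dim: "(i::nat) < m * p \<Longrightarrow> i div p < m"
  by (simp add: less_mult_imp_div_less)

lemma mod_less_dim: "(i::nat) < m * p \<Longrightarrow> i mod p < p"
  by (metis less_nat_zero_code mod_less_divisor mult_0_right neq0_conv)

lemma kronecker_carrier [simp]:
  "A \<in> carrier_mat m n \<Longrightarrow> B \<in> carrier_mat p q \<Longrightarrow> kronecker A B \<in> carrier_mat (m * p) (n * q)"
  by (simp add: kronecker_def)

lemma kronecker_index:
  "A \<in> carrier_mat m n \<Longrightarrow> B \<in> carrier_mat p q \<Longrightarrow> i < m * p \<Longrightarrow> j < n * q \<Longrightarrow>
    kronecker A B $$ (i, j) = A $$ (i div p, j div q) * B $$ (i mod p, j mod q)"
  by (simp add: kronecker_def)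

lemma kronecker_mult:
  assumes A: "A \<in> carrier_mat m n" and B: "B \<in> carrier_mat p q"
    and C: "C \<in> carrier_mat n r" and D: "D \<in> carrier_mat q s"
  shows "kronecker A B * kronecker C D = kronecker (A * C) (B * D)"
proof (rule eq_matI)
  fix i j assume "i < dim_row (kronecker (A * C) (B * D))" "j < dim_col (kronecker (A * C) (B * D))"
  then have ij: "i < m * p" "j < r * s" using A B C D by (auto simp: kronecker_def)
  note ij' = div_less_dim[OF ij(1)] mod_less_dim[OF ij(1)] div_less_dim[OF ij(2)] mod_less_dim[OF ij(2)]
  have "(kronecker A B * kronecker C D) $$ (i, j) =
      (\<Sum>k<n * q. kronecker A B $$ (i, k) * kronecker C D $$ (k, j))"
    using ij kronecker_carrier[OF A B] kronecker_carrier[OF C D]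
    by (simp add: scalar_prod_def lessThan_atLeast0)
  also have "\<dots> = (\<Sum>k<n * q. (A $$ (i div p, k div q) * B $$ (i mod p, k mod q)) * (C $$ (k div q, j div s) * D $$ (k mod q, j mod s)))"
    using ij by (intro sum.cong) (auto simp: kronecker_index[OF A B] kronecker_index[OF C D])
  also have "\<dots> = (\<Sum>a<n. \<Sum>b<q. (A $$ (i div p, a) * B $$ (i mod p, b)) * (C $$ (a, j div s) * D $$ (b, j mod s)))"
    by (rule sum_div_mod)
  also have "\<dots> = (\<Sum>a<n. A $$ (i div p, a) * C $$ (a, j div s)) * (\<Sum>b<q. B $$ (i mod p, b) * D $$ (b, j mod s))"
    by (simp add: sum_product mult.assoc mult.left_commute)
  also have "\<dots> = (A * C) $$ (i div p, j div s) * (B * D) $$ (i mod p, j mod s)"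
    using ij' A B C D by (simp add: scalar_prod_def lessThan_atLeast0)
  also have "\<dots> = kronecker (A * C) (B * D) $$ (i, j)"
    using ij by (simp add: kronecker_index[OF mult_carrier_mat[OF A C] mult_carrier_mat[OF B D]])
  finally show "(kronecker A B * kronecker C D) $$ (i, j) = kronecker (A * C) (B * D) $$ (i, j)" .
qed (use A B C D in \<open>auto simp: kronecker_def\<close>)

lemma kronecker_one: "kronecker (1\<^sub>m m) (1\<^sub>m p) = 1\<^sub>m (m * p)"
proof (rule eq_matI)
  fix i j assume "i < dim_row (1\<^sub>m (m * p))" "j < dim_col (1\<^sub>m (m * p))"
  then have ij: "i < m * p" "j < m * p" by auto
  have "i = j \<longleftrightarrow> i div p = j div p \<and> i mod p = j mod p" by (metis div_mult_mod_eq)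
  then show "kronecker (1\<^sub>m m) (1\<^sub>m p) $$ (i, j) = 1\<^sub>m (m * p) $$ (i, j)"
    using ij div_less_dim[OF ij(1)] mod_less_dim[OF ij(1)] div_less_dim[OF ij(2)] mod_less_dim[OF ij(2)]
    by (auto simp: kronecker_index[OF one_carrier_mat one_carrier_mat])
qed (auto simp: kronecker_def)

lemma mtrace_kronecker:
  assumes A: "A \<in> carrier_mat m m" and B: "B \<in> carrier_mat p p"
  shows "mtrace (kronecker A B) = mtrace A * mtrace B"
proof -
  have "mtrace (kronecker A B) = (\<Sum>k<m * p. A $$ (k div p, k div p) * B $$ (k mod p, k mod p))"
    using A B by (auto simp: mtrace_def kronecker_def intro!: sum.cong)
  also have "\<dots> = (\<Sum>a<m. \<Sum>b<p. A $$ (a, a) * B $$ (b, b))" by (rule sum_div_mod)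
  also have "\<dots> = mtrace A * mtrace B" using A B by (simp add: mtrace_def sum_product)
  finally show ?thesis .
qed

section \<open>Averages over a finite group\<close>

locale finite_group = group G for G :: "'a monoid" (structure) +
  assumes finite_carrier: "finite (carrier G)"
begin

lemma card_carrier_ne0: "of_nat (card (carrier G)) \<noteq> (0::'f::field_char_0)"
  using finite_carrier one_closed by (metis card_eq_0_iff empty_iff of_nat_eq_0_iff)

lemma left_mult_bij: "h \<in> carrier G \<Longrightarrow> bij_betw (\<lambda>x. h \<otimes> x) (carrier G) (carrier G)"
  by (rule bij_betw_byWitness[where f' = "\<lambda>x. inv h \<otimes> x"])
    (auto simp: m_assoc[symmetric])

lemma avg_left_mult:
  assumes "\<And>x. x \<in> carrier G \<Longrightarrow> f (h \<otimes> x) = f' x" "h \<in> carrier G"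
  shows "avg_mat (carrier G) n m f' = avg_mat (carrier G) n m f"
proof -
  have "avg_mat (carrier G) n m f' = avg_mat (carrier G) n m (\<lambda>x. f (h \<otimes> x))"
    by (rule avg_mat_cong) (simp add: assms(1))
  then show ?thesis using avg_mat_reindex[OF left_mult_bij[OF assms(2)]] by metis
qed

lemma avg_mat_const_group:
  assumes "(A :: 'f::field_char_0 mat) \<in> carrier_mat n m" "\<And>x. x \<in> carrier G \<Longrightarrow> f x = A"
  shows "avg_mat (carrier G) n m f = A"
  by (rule avg_mat_const[OF finite_carrier _ assms]) (use one_closed in auto)

text \<open>
  Translation by an element of the group permutes the summands of the average. The average is
  the projection onto the fixed vectors, so its trace is their dimension.
\<close>

lemma average_idempotent:
  fixes \<tau> :: "'a \<Rightarrow> 'f::field_char_0 mat"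
  assumes V: "(n, \<tau>) \<in> matrix_reps G"
  defines "e \<equiv> avg_mat (carrier G) n n \<tau>"
  shows "x \<in> carrier G \<Longrightarrow> \<tau> x * e = e" "x \<in> carrier G \<Longrightarrow> e * \<tau> x = e" "e * e = e"
    "mtrace e = (\<Sum>x\<in>carrier G. mtrace (\<tau> x)) / of_nat (card (carrier G))"
proof -
  note c = matrix_repsD(1)[OF V] and m = matrix_repsD(3)[OF V]
  show 1: "\<tau> x * e = e" if x: "x \<in> carrier G" for x
  proof -
    have "\<tau> x * e = avg_mat (carrier G) n n (\<lambda>y. \<tau> x * \<tau> y)"
      unfolding e_def by (rule mult_avg_mat[OF c[OF x] c])
    also have "\<dots> = e"
      unfolding e_def by (rule avg_left_mult[where h = x]) (use x m in auto)
    finally show ?thesis .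
  qed
  show 2: "e * \<tau> x = e" if x: "x \<in> carrier G" for x
  proof -
    have "e * \<tau> x = avg_mat (carrier G) n n (\<lambda>y. \<tau> y * \<tau> x)"
      unfolding e_def by (rule avg_mat_mult[OF c[OF x] c])
    also have "\<dots> = avg_mat (carrier G) n n (\<lambda>y. \<tau> (y \<otimes> x))"
      by (rule avg_mat_cong) (use x m in auto)
    also have "\<dots> = e"
      unfolding e_def
      by (rule avg_mat_reindex, rule bij_betw_byWitness[where f' = "\<lambda>y. y \<otimes> inv x"])
        (use x in \<open>auto simp: m_assoc\<close>)
    finally show ?thesis .
  qed
  have ec: "e \<in> carrier_mat n n" by (simp add: e_def)
  have "e * e = avg_mat (carrier G) n n (\<lambda>y. e * \<tau> y)"
    using mult_avg_mat[OF ec c, of "carrier G"] unfolding e_def by simp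
  then show "e * e = e" using avg_mat_const_group[OF ec 2] by simp
  show "mtrace e = (\<Sum>x\<in>carrier G. mtrace (\<tau> x)) / of_nat (card (carrier G))"
    unfolding e_def by (rule mtrace_avg_mat[OF c])
qed

lemma average_intertwines:
  fixes \<rho> :: "'a \<Rightarrow> 'f::field_char_0 mat"
  assumes V: "(n, \<rho>) \<in> matrix_reps G" and W: "(m, \<sigma>) \<in> matrix_reps G"
    and X: "X \<in> carrier_mat m n" and h: "h \<in> carrier G"
  defines "f \<equiv> avg_mat (carrier G) m n (\<lambda>g. \<sigma> g * X * \<rho> (inv g))"
  shows "f * \<rho> h = \<sigma> h * f"
proof -
  note r = carrier_matD[OF matrix_repsD(1)[OF V]] and s = carrier_matD[OF matrix_repsD(1)[OF W]]
  note x = carrier_matD[OF X]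
  have c: "\<sigma> g * X * \<rho> (inv g) \<in> carrier_mat m n" if "g \<in> carrier G" for g
    by (rule mult_carrier_mat[OF mult_carrier_mat[OF matrix_repsD(1)[OF W that] X] matrix_repsD(1)[OF V inv_closed[OF that]]])
  have "f * \<rho> h = avg_mat (carrier G) m n (\<lambda>g. \<sigma> g * X * \<rho> (inv g) * \<rho> h)"
    unfolding f_def by (rule avg_mat_mult[OF matrix_repsD(1)[OF V h] c])
  also have "\<dots> = avg_mat (carrier G) m n (\<lambda>g. \<sigma> h * (\<sigma> g * X * \<rho> (inv g)))"
  proof (rule avg_left_mult[OF _ h, symmetric])
    fix g assume g: "g \<in> carrier G"
    have "\<rho> (inv (h \<otimes> g)) * \<rho> h = \<rho> (inv g)"
      using g h by (simp add: matrix_repsD(3)[OF V, symmetric] inv_mult_group m_assoc)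
    moreover have "\<sigma> (h \<otimes> g) = \<sigma> h * \<sigma> g" using matrix_repsD(3)[OF W h g] .
    ultimately show "\<sigma> (h \<otimes> g) * X * \<rho> (inv (h \<otimes> g)) * \<rho> h = \<sigma> h * (\<sigma> g * X * \<rho> (inv g))"
      using g h by (simp add: mat_assoc r s x)
  qed
  also have "\<dots> = \<sigma> h * f"
    unfolding f_def by (rule mult_avg_mat[OF matrix_repsD(1)[OF W h] c, symmetric])
  finally show ?thesis .
qed

text \<open>
  The sum is the order of \<open>G\<close> times the trace of the averaging projection on the
  space of matrices, where \<open>g\<close> acts by conjugation with \<open>\<rho> g\<close>. In
  characteristic zero an idempotent of trace zero is zero, but this projection fixes the
  identity matrix. In the Kronecker model, the pairs \<open>(a, a)\<close> sit at index \<open>a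
  n + a\<close>.
\<close>

lemma character_norm_nonzero:
  fixes \<rho> :: "'a \<Rightarrow> 'f::field_char_0 mat"
  assumes V: "(n, \<rho>) \<in> matrix_reps G" and n: "n > 0"
  shows "(\<Sum>g\<in>carrier G. mtrace (\<rho> g) * mtrace (\<rho> (inv g))) \<noteq> 0"
proof
  assume z: "(\<Sum>g\<in>carrier G. mtrace (\<rho> g) * mtrace (\<rho> (inv g))) = 0"
  note c = matrix_repsD(1)[OF V]
  define \<tau> where "\<tau> g = kronecker (\<rho> g) (transpose_mat (\<rho> (inv g)))" for g
  have ct: "transpose_mat (\<rho> (inv g)) \<in> carrier_mat n n" if "g \<in> carrier G" for g
    using c[of "inv g"] that by simp
  have T: "(n * n, \<tau>) \<in> matrix_reps G"
    unfolding matrix_reps_def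
  proof safe
    fix g h assume g: "g \<in> carrier G" and h: "h \<in> carrier G"
    show "\<tau> g \<in> carrier_mat (n * n) (n * n)"
      unfolding \<tau>_def using c[OF g] ct[OF g] by (rule kronecker_carrier)
    have "transpose_mat (\<rho> (inv (g \<otimes> h))) = transpose_mat (\<rho> (inv h) * \<rho> (inv g))"
      using g h matrix_repsD(3)[OF V, of "inv h" "inv g"] by (simp add: inv_mult_group)
    also have "\<dots> = transpose_mat (\<rho> (inv g)) * transpose_mat (\<rho> (inv h))"
      using c g h by (intro transpose_mult) auto
    finally show "\<tau> (g \<otimes> h) = \<tau> g * \<tau> h"
      unfolding \<tau>_def using kronecker_mult[OF c[OF g] ct[OF g] c[OF h] ct[OF h]]
      by (simp add: matrix_repsD(3)[OF V g h])
  next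
    show "\<tau> \<one> = 1\<^sub>m (n * n)"
      by (simp add: \<tau>_def matrix_repsD(2)[OF V] kronecker_one)
  qed
  define e where "e = avg_mat (carrier G) (n * n) (n * n) \<tau>"
  have ec: "e \<in> carrier_mat (n * n) (n * n)" by (simp add: e_def)
  have ee: "e * e = e" unfolding e_def by (rule average_idempotent(3)[OF T])
  have "mtrace (\<tau> g) = mtrace (\<rho> g) * mtrace (\<rho> (inv g))" if "g \<in> carrier G" for g
    unfolding \<tau>_def using mtrace_kronecker[OF c ct, OF that that] c[of "inv g"] that
    by (simp add: mtrace_def)
  then have te: "mtrace e = 0"
    using average_idempotent(4)[OF T] z unfolding e_def by simp
  obtain r P Q where PQ: "P \<in> carrier_mat (n * n) r" "Q \<in> carrier_mat r (n * n)" "Q * P = 1\<^sub>m r" "P * Q = e"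
    using idempotent_splits[OF ec ee] by metis
  have "of_nat r = mtrace e" using mtrace_comm[OF PQ(1,2)] PQ by simp
  then have "r = 0" using te by simp
  then have e0: "e = 0\<^sub>m (n * n) (n * n)" using PQ by (auto intro!: eq_matI simp: scalar_prod_def)
  \<comment> \<open>this is entry \<open>((0, 0), (a, a))\<close> of the projection; summing over \<open>a\<close> evaluates it at the identity matrix\<close>
  have "(\<Sum>g\<in>carrier G. \<rho> g $$ (0, a) * \<rho> (inv g) $$ (a, 0)) = 0" if a: "a < n" for a
  proof -
    have lt: "a * n + a < n * n" "0 < n * n"
    proof -
      have "a * n + a < Suc a * n" using a by simp
      also have "\<dots> \<le> n * n" using a by (intro mult_right_mono) auto
      finally show "a * n + a < n * n" .
    qed (use n in simp)
    have "e $$ (0, a * n + a) = 0" using e0 lt by simp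
    then have "(\<Sum>g\<in>carrier G. \<tau> g $$ (0, a * n + a)) = 0"
      using lt card_carrier_ne0 unfolding e_def avg_mat_def by simp
    also have "(\<Sum>g\<in>carrier G. \<tau> g $$ (0, a * n + a)) = (\<Sum>g\<in>carrier G. \<rho> g $$ (0, a) * \<rho> (inv g) $$ (a, 0))"
    proof (rule sum.cong)
      fix g assume g: "g \<in> carrier G"
      show "\<tau> g $$ (0, a * n + a) = \<rho> g $$ (0, a) * \<rho> (inv g) $$ (a, 0)"
        unfolding \<tau>_def kronecker_index[OF c[OF g] ct[OF g] lt(2,1)]
        using a n c[of "inv g"] g by simp
    qed simp
    finally show ?thesis .
  qed
  then have "0 = (\<Sum>a<n. \<Sum>g\<in>carrier G. \<rho> g $$ (0, a) * \<rho> (inv g) $$ (a, 0))" by simp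
  also have "\<dots> = (\<Sum>g\<in>carrier G. \<Sum>a<n. \<rho> g $$ (0, a) * \<rho> (inv g) $$ (a, 0))" by (rule sum.swap)
  also have "\<dots> = (\<Sum>g\<in>carrier G. (\<rho> g * \<rho> (inv g)) $$ (0, 0))"
  proof (intro sum.cong refl)
    fix g assume g: "g \<in> carrier G"
    show "(\<Sum>a<n. \<rho> g $$ (0, a) * \<rho> (inv g) $$ (a, 0)) = (\<rho> g * \<rho> (inv g)) $$ (0, 0)"
      using c[OF g] c[OF inv_closed[OF g]] n by (simp add: scalar_prod_def lessThan_atLeast0)
  qed
  also have "\<dots> = (\<Sum>g\<in>carrier G. 1)"
    using n by (intro sum.cong refl) (simp add: matrix_repsD(3)[OF V, symmetric] matrix_repsD(2)[OF V])
  also have "\<dots> = of_nat (card (carrier G))" by simp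
  finally show False using card_carrier_ne0 by metis
qed

text \<open>
  The averages of all matrix units are intertwiners. If they all vanished, then so would the sum
  over \<open>i\<close> and \<open>j\<close> of their \<open>(i, j)\<close> entries, which is
  the inner product of the two characters; as these agree, this contradicts
  \<open>character_norm_nonzero\<close>.
\<close>

lemma nonzero_intertwiner:
  fixes \<rho> :: "'a \<Rightarrow> 'f::field_char_0 mat"
  assumes V: "(n, \<rho>) \<in> matrix_reps G" and W: "(m, \<sigma>) \<in> matrix_reps G" and n: "n > 0"
    and ch: "\<And>g. g \<in> carrier G \<Longrightarrow> mtrace (\<rho> g) = mtrace (\<sigma> g)"
  obtains f where "f \<in> carrier_mat m n" "f \<noteq> 0\<^sub>m m n" "\<And>h. h \<in> carrier G \<Longrightarrow> f * \<rho> h = \<sigma> h * f"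
proof -
  define X where "X i j = mat m n (\<lambda>(k, l). if k = i then (if l = j then 1 else 0) else (0::'f))" for i j
  define F where "F i j = avg_mat (carrier G) m n (\<lambda>g. \<sigma> g * X i j * \<rho> (inv g))" for i j
  have Xc: "X i j \<in> carrier_mat m n" for i j by (simp add: X_def)
  have int: "F i j * \<rho> h = \<sigma> h * F i j" if "h \<in> carrier G" for i j h
    unfolding F_def by (rule average_intertwines[OF V W Xc that])
  show ?thesis
  proof (cases "\<exists>i<m. \<exists>j<n. F i j $$ (i, j) \<noteq> 0")
    case True
    then obtain i j where ij: "i < m" "j < n" "F i j $$ (i, j) \<noteq> 0" by blast
    then have "F i j \<noteq> 0\<^sub>m m n" by auto
    moreover have "F i j \<in> carrier_mat m n" by (simp add: F_def)
    ultimately show ?thesis using that int by blast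
  next
    case False
    have ent: "(\<sigma> g * X i j * \<rho> (inv g)) $$ (i, j) = \<sigma> g $$ (i, i) * \<rho> (inv g) $$ (j, j)"
      if g: "g \<in> carrier G" and ij: "i < m" "j < n" for g i j
    proof -
      note s = matrix_repsD(1)[OF W g] and r = matrix_repsD(1)[OF V inv_closed[OF g]]
      have sX: "(\<sigma> g * X i j) $$ (i, l) = (if l = j then \<sigma> g $$ (i, i) else 0)" if l: "l < n" for l
        using s ij l by (simp add: X_def scalar_prod_def if_distrib[where f = "\<lambda>x. _ * x"] cong: if_cong)
      have "(\<sigma> g * X i j * \<rho> (inv g)) $$ (i, j) = (\<Sum>l = 0..<n. (\<sigma> g * X i j) $$ (i, l) * \<rho> (inv g) $$ (l, j))"
      proof -
        define Y where "Y = \<sigma> g * X i j"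
        have "Y \<in> carrier_mat m n" unfolding Y_def by (rule mult_carrier_mat[OF s Xc])
        then show ?thesis unfolding Y_def[symmetric] using r ij by (simp add: scalar_prod_def)
      qed
      also have "\<dots> = (\<Sum>l = 0..<n. if l = j then \<sigma> g $$ (i, i) * \<rho> (inv g) $$ (j, j) else 0)"
        by (intro sum.cong) (auto simp: sX)
      finally show ?thesis using ij by simp
    qed
    have z: "(\<Sum>g\<in>carrier G. \<sigma> g $$ (i, i) * \<rho> (inv g) $$ (j, j)) = 0" if ij: "i < m" "j < n" for i j
    proof -
      have "F i j $$ (i, j) = 0" using False ij by blast
      then have "(\<Sum>g\<in>carrier G. (\<sigma> g * X i j * \<rho> (inv g)) $$ (i, j)) = 0"
        using ij card_carrier_ne0 unfolding F_def avg_mat_def by simp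
      then show ?thesis using ent ij by simp
    qed
    have "(\<Sum>g\<in>carrier G. mtrace (\<rho> g) * mtrace (\<rho> (inv g))) = (\<Sum>g\<in>carrier G. mtrace (\<sigma> g) * mtrace (\<rho> (inv g)))"
      by (simp add: ch)
    also have "\<dots> = (\<Sum>g\<in>carrier G. \<Sum>i<m. \<Sum>j<n. \<sigma> g $$ (i, i) * \<rho> (inv g) $$ (j, j))"
    proof (intro sum.cong refl)
      fix g assume g: "g \<in> carrier G"
      have "mtrace (\<sigma> g) = (\<Sum>i<m. \<sigma> g $$ (i, i))" "mtrace (\<rho> (inv g)) = (\<Sum>j<n. \<rho> (inv g) $$ (j, j))"
        using matrix_repsD(1)[OF W g] matrix_repsD(1)[OF V inv_closed[OF g]] by (auto simp: mtrace_def)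
      then show "mtrace (\<sigma> g) * mtrace (\<rho> (inv g)) = (\<Sum>i<m. \<Sum>j<n. \<sigma> g $$ (i, i) * \<rho> (inv g) $$ (j, j))"
        by (simp add: sum_product)
    qed
    also have "\<dots> = (\<Sum>i<m. \<Sum>j<n. \<Sum>g\<in>carrier G. \<sigma> g $$ (i, i) * \<rho> (inv g) $$ (j, j))"
      by (subst sum.swap, intro sum.cong refl, rule sum.swap)
    also have "\<dots> = 0" by (simp add: z)
    finally show ?thesis using character_norm_nonzero[OF V n] by simp
  qed
qed

end

section \<open>Characters and classes in the Grothendieck group\<close>

definition frag_char :: "(('f::field, 'g) matrix_rep \<Rightarrow>\<^sub>0 int) \<Rightarrow> 'g \<Rightarrow> 'f" where
  "frag_char x g = (\<Sum>V\<in>Poly_Mapping.keys x. of_int (Poly_Mapping.lookup x V) * rep_char V g)"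

lemma frag_char_superset:
  assumes "finite S" "Poly_Mapping.keys x \<subseteq> S"
  shows "frag_char x g = (\<Sum>V\<in>S. of_int (Poly_Mapping.lookup x V) * rep_char V g)"
  unfolding frag_char_def
  by (rule sum.mono_neutral_left) (use assms in \<open>auto simp: in_keys_iff\<close>)

lemma frag_char_of [simp]: "frag_char (frag_of V) g = rep_char V g"
  by (simp add: frag_char_def keys_frag_of)

lemma frag_char_0 [simp]: "frag_char 0 g = 0"
  by (simp add: frag_char_def)

lemma frag_char_diff [simp]: "frag_char (x - y) g = frag_char x g - frag_char y g"
proof -
  define S where "S = Poly_Mapping.keys x \<union> Poly_Mapping.keys y \<union> Poly_Mapping.keys (x - y)"
  have "finite S" by (simp add: S_def)
  then show ?thesis
    by (subst (1 2 3) frag_char_superset[of S])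
      (auto simp: S_def lookup_minus algebra_simps sum_subtractf)
qed

lemma frag_char_minus [simp]: "frag_char (- x) g = - frag_char x g"
  using frag_char_diff[of 0 x g] by simp

lemma frag_char_add [simp]: "frag_char (x + y) g = frag_char x g + frag_char y g"
  using frag_char_diff[of x "- y" g] by simp

lemma grothendieck_presentation: "presentation (matrix_reps G) (grothendieck_relations G)"
proof
  fix r :: "('b, 'a) matrix_rep \<Rightarrow>\<^sub>0 int"
  assume "r \<in> grothendieck_relations G"
  then obtain U V W where "r = frag_of V - frag_of U - frag_of W"
    "U \<in> matrix_reps G" "V \<in> matrix_reps G" "W \<in> matrix_reps G"
    unfolding grothendieck_relations_def by blast
  then show "virtual_rep G r"
    by (simp add: frag_keys_diff)
qed

abbreviation grel :: "'g monoid \<Rightarrow> (('f::field, 'g) matrix_rep \<Rightarrow>\<^sub>0 int) set" where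
  "grel G \<equiv> relation_subgroup (matrix_reps G) (grothendieck_relations G)"

lemma short_exact_relation:
  assumes "U \<in> matrix_reps G" "V \<in> matrix_reps G" "W \<in> matrix_reps G"
    "short_exact G (vec_gmodule U) (vec_gmodule V) (vec_gmodule W)"
  shows "frag_of V - frag_of U - frag_of W \<in> grel G"
  unfolding relation_subgroup_def
  by (rule generate.incl) (unfold grothendieck_relations_def, use assms in blast)

lemma grel_char:
  assumes x: "x \<in> grel G" and g: "g \<in> carrier G"
  shows "frag_char x g = 0"
proof -
  interpret presentation "matrix_reps G" "grothendieck_relations G" by (rule grothendieck_presentation)
  show ?thesis using x
  proof (induction rule: N_induct)
    case (gen r)
    then show ?case
      unfolding grothendieck_relations_def using short_exact_char[OF _ _ _ _ g] by force
  qed auto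
qed

context finite_group begin

text \<open>
  If the projection \<open>P Q\<close> commutes with the action, then its image is a
  subrepresentation, which \<open>P\<close> and \<open>Q\<close> identify with one on
  \<open>F\<^sup>r\<close>.
\<close>

lemma compress:
  fixes \<rho> :: "'a \<Rightarrow> 'f::field_char_0 mat"
  assumes V: "(n, \<rho>) \<in> matrix_reps G"
    and P: "P \<in> carrier_mat n r" and Q: "Q \<in> carrier_mat r n" and QP: "Q * P = 1\<^sub>m r"
    and com: "\<And>g. g \<in> carrier G \<Longrightarrow> P * Q * \<rho> g = \<rho> g * (P * Q)"
  shows "(r, \<lambda>g. Q * \<rho> g * P) \<in> matrix_reps G"
    "g \<in> carrier G \<Longrightarrow> P * (Q * \<rho> g * P) = \<rho> g * P"
    "g \<in> carrier G \<Longrightarrow> Q * \<rho> g = (Q * \<rho> g * P) * Q"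
proof -
  note c = carrier_matD[OF matrix_repsD(1)[OF V]] carrier_matD[OF P] carrier_matD[OF Q]
  have com': "P * (Q * \<rho> g) = \<rho> g * (P * Q)" if "g \<in> carrier G" for g
    using com[OF that] that by (simp add: mat_assoc c)
  have QPX: "Q * (P * X) = X" if "dim_row X = r" for X :: "'f mat"
    using mat_cancel[OF QP, of X] that c by (simp add: left_mult_one_mat')
  show 1: "P * (Q * \<rho> g * P) = \<rho> g * P" if g: "g \<in> carrier G" for g
  proof -
    have "P * (Q * \<rho> g * P) = (P * (Q * \<rho> g)) * P" using g by (simp add: mat_assoc c)
    also have "\<dots> = \<rho> g * (P * (Q * P))" unfolding com'[OF g] using g by (simp add: mat_assoc c)
    also have "\<dots> = \<rho> g * P" using QP P by simp
    finally show ?thesis .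
  qed
  show 2: "Q * \<rho> g = (Q * \<rho> g * P) * Q" if g: "g \<in> carrier G" for g
  proof -
    have "(Q * \<rho> g * P) * Q = Q * (\<rho> g * (P * Q))" using g by (simp add: mat_assoc c)
    also have "\<dots> = Q * (P * (Q * \<rho> g))" using com'[OF g] by simp
    also have "\<dots> = Q * \<rho> g" using g by (intro QPX) (simp add: c)
    finally show ?thesis ..
  qed
  show "(r, \<lambda>g. Q * \<rho> g * P) \<in> matrix_reps G"
    unfolding matrix_reps_def
  proof safe
    fix g h assume g: "g \<in> carrier G" and h: "h \<in> carrier G"
    show "Q * \<rho> g * P \<in> carrier_mat r r"
      by (rule mult_carrier_mat[OF mult_carrier_mat[OF Q matrix_repsD(1)[OF V g]] P])
    have "Q * \<rho> (g \<otimes> h) * P = Q * \<rho> g * (\<rho> h * P)"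
      using g h by (simp add: mat_assoc c matrix_repsD(3)[OF V])
    also have "\<dots> = (Q * \<rho> g) * (P * (Q * \<rho> h * P))" using 1[OF h] by simp
    also have "\<dots> = (Q * \<rho> g * P) * (Q * \<rho> h * P)" using g h by (simp add: mat_assoc c)
    finally show "Q * \<rho> (g \<otimes> h) * P = (Q * \<rho> g * P) * (Q * \<rho> h * P)" .
  next
    show "Q * \<rho> \<one> * P = 1\<^sub>m r" using QP Q by (simp add: matrix_repsD(2)[OF V])
  qed
qed

text \<open>
  The complementary idempotent \<open>1 - P Q\<close> also commutes with the action, so its
  image is a complement of \<open>U\<close>. The representation \<open>U\<close> is kept as a
  parameter so that one and the same \<open>U\<close> can be split off from two different
  representations.
\<close>

lemma split_off:
  fixes \<rho> :: "'a \<Rightarrow> 'f::field_char_0 mat"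
  assumes V: "(n, \<rho>) \<in> matrix_reps G" and U: "(u, \<alpha>) \<in> matrix_reps G"
    and P: "P \<in> carrier_mat n u" and Q: "Q \<in> carrier_mat u n" and QP: "Q * P = 1\<^sub>m u"
    and iP: "\<And>g. g \<in> carrier G \<Longrightarrow> P * \<alpha> g = \<rho> g * P"
    and iQ: "\<And>g. g \<in> carrier G \<Longrightarrow> Q * \<rho> g = \<alpha> g * Q"
  obtains w \<beta> where "(w, \<beta>) \<in> matrix_reps G" "u + w = n"
    "frag_of (n, \<rho>) - frag_of (u, \<alpha>) - frag_of (w, \<beta>) \<in> grel G"
proof -
  interpret presentation "matrix_reps G" "grothendieck_relations G" by (rule grothendieck_presentation)
  note c = carrier_matD[OF matrix_repsD(1)[OF V]] carrier_matD[OF P] carrier_matD[OF Q]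
    carrier_matD[OF matrix_repsD(1)[OF U]]
  note PQ = mult_carrier_mat[OF P Q]
  define e where "e = 1\<^sub>m n - P * Q"
  have e: "e \<in> carrier_mat n n" unfolding e_def by (rule minus_carrier_mat[OF PQ])
  have PQPQ: "P * Q * (P * Q) = P * Q"
  proof -
    have "P * Q * (P * Q) = P * ((Q * P) * Q)" by (simp add: mat_assoc c)
    then show ?thesis using QP Q by simp
  qed
  have "P * Q * e = P * Q - P * Q * (P * Q)"
    unfolding e_def using mult_minus_distrib_mat[OF PQ one_carrier_mat PQ] right_mult_one_mat[OF PQ] by simp
  then have PQe: "P * Q * e = 0\<^sub>m n n" unfolding PQPQ using PQ by (auto intro!: eq_matI)
  have "e * e = e - P * Q * e"
    using minus_mult_distrib_mat[OF one_carrier_mat PQ e] e unfolding e_def[symmetric] by simp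
  then have ee: "e * e = e" unfolding PQe using e by (auto intro!: eq_matI)
  obtain w P' Q' where P': "P' \<in> carrier_mat n w" and Q': "Q' \<in> carrier_mat w n"
    and QP': "Q' * P' = 1\<^sub>m w" and e': "P' * Q' = e"
    using idempotent_splits[OF e ee] by metis
  have sum: "P * Q + P' * Q' = 1\<^sub>m n" unfolding e' e_def using P Q by (auto intro!: eq_matI)
  have com: "P' * Q' * \<rho> g = \<rho> g * (P' * Q')" if g: "g \<in> carrier G" for g
  proof -
    note r = matrix_repsD(1)[OF V g]
    have "P * Q * \<rho> g = \<rho> g * (P * Q)"
    proof -
      have "P * Q * \<rho> g = P * (Q * \<rho> g)" using g by (simp add: mat_assoc c)
      also have "\<dots> = (P * \<alpha> g) * Q" unfolding iQ[OF g] using g by (simp add: mat_assoc c)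
      also have "\<dots> = \<rho> g * (P * Q)" unfolding iP[OF g] using g by (simp add: mat_assoc c)
      finally show ?thesis .
    qed
    then show ?thesis
      unfolding e' e_def using r
      by (simp add: minus_mult_distrib_mat[OF one_carrier_mat PQ r] mult_minus_distrib_mat[OF r one_carrier_mat PQ])
  qed
  define \<beta> where "\<beta> g = Q' * \<rho> g * P'" for g
  have W: "(w, \<beta>) \<in> matrix_reps G" unfolding \<beta>_def by (rule compress(1)[OF V P' Q' QP' com])
  have "short_exact G (vec_gmodule (u, \<alpha>)) (vec_gmodule (n, \<rho>)) (vec_gmodule (w, \<beta>))"
    by (rule split_short_exact[OF U V W P Q P' Q' QP QP' sum iP])
      (use compress(3)[OF V P' Q' QP' com] in \<open>auto simp: \<beta>_def\<close>)
  then have "frag_of (n, \<rho>) - frag_of (u, \<alpha>) - frag_of (w, \<beta>) \<in> grel G"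
    by (rule short_exact_relation[OF U V W])
  moreover have "u + w = n"
  proof -
    have "of_nat n = mtrace (P * Q + P' * Q')" using sum by simp
    also have "\<dots> = mtrace (Q * P) + mtrace (Q' * P')"
      using mtrace_add[OF PQ mult_carrier_mat[OF P' Q']] mtrace_comm[OF P Q] mtrace_comm[OF P' Q'] by simp
    also have "\<dots> = (of_nat (u + w) :: 'f)" using QP QP' by simp
    finally show ?thesis by (simp only: of_nat_eq_iff)
  qed
  ultimately show ?thesis using that W by blast
qed

text \<open>
  The sequence with \<open>V\<close> in all three places is exact when \<open>V\<close> is zero,
  and gives the relation \<open>- V\<close>.
\<close>

lemma class_of_dim_zero:
  assumes V: "(0, \<rho> :: 'a \<Rightarrow> 'f::field_char_0 mat) \<in> matrix_reps G"
  shows "frag_of (0, \<rho>) \<in> grel G"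
proof -
  interpret presentation "matrix_reps G" "grothendieck_relations G" by (rule grothendieck_presentation)
  have c: "dim_row (\<rho> g) = 0" "dim_col (\<rho> g) = 0" if "g \<in> carrier G" for g
    using matrix_repsD(1)[OF V that] by auto
  have "short_exact G (vec_gmodule (0, \<rho>)) (vec_gmodule (0, \<rho>)) (vec_gmodule (0, \<rho>))"
    by (rule split_short_exact[OF V V V one_carrier_mat one_carrier_mat one_carrier_mat one_carrier_mat])
      (auto intro!: eq_matI simp: c)
  then have "frag_of (0, \<rho>) - frag_of (0, \<rho>) - frag_of (0, \<rho>) \<in> grel G"
    by (rule short_exact_relation[OF V V V])
  then show ?thesis using N_minus by force
qed

text \<open>
  Induction on the dimension, which is the value of the character at 1. For a nonzero
  intertwiner \<open>f\<close> from \<open>\<rho>\<close> to \<open>\<sigma>\<close>, averaging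
  a generalized inverse gives an equivariant \<open>h\<close> with \<open>f h f = f\<close>.
  Then \<open>h f\<close> and \<open>f h\<close> are equivariant projections with isomorphic
  nonzero images. Splitting this common summand off from both sides leaves complements with
  equal characters and smaller dimension.
\<close>

lemma same_char_same_class:
  fixes \<rho> :: "'a \<Rightarrow> 'f::field_char_0 mat"
  assumes "(n, \<rho>) \<in> matrix_reps G" "(m, \<sigma>) \<in> matrix_reps G"
    and "\<And>g. g \<in> carrier G \<Longrightarrow> mtrace (\<rho> g) = mtrace (\<sigma> g)"
  shows "frag_of (n, \<rho>) - frag_of (m, \<sigma>) \<in> grel G"
  using assms
proof (induction n arbitrary: \<rho> m \<sigma> rule: less_induct)
  case (less n)
  interpret presentation "matrix_reps G" "grothendieck_relations G" by (rule grothendieck_presentation)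
  note V = less.prems(1) and W = less.prems(2) and ch = less.prems(3)
  have "(of_nat n :: 'f) = of_nat m"
    using ch[of "\<one>"] matrix_repsD(2)[OF V] matrix_repsD(2)[OF W] by simp
  then have mn: "m = n" by (simp only: of_nat_eq_iff)
  note V = less.prems(1) and W = less.prems(2)[unfolded mn] and ch = less.prems(3)
  show ?case
  proof (cases "n = 0")
    case True
    then show ?thesis using class_of_dim_zero V W mn N_diff by auto
  next
    case False
    then obtain f where f: "f \<in> carrier_mat n n" "f \<noteq> 0\<^sub>m n n"
      and fint: "\<And>h. h \<in> carrier G \<Longrightarrow> f * \<rho> h = \<sigma> h * f"
      using nonzero_intertwiner[OF V W _ ch] by auto
    obtain r0 C D C' D' where CD: "C \<in> carrier_mat n r0" "D \<in> carrier_mat r0 n"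
      "C' \<in> carrier_mat r0 n" "D' \<in> carrier_mat n r0" "f = C * D" "C' * C = 1\<^sub>m r0" "D * D' = 1\<^sub>m r0"
      using rank_factorization[OF f(1)] by metis
    \<comment> \<open>a generalized inverse of \<open>f\<close>, not yet equivariant\<close>
    define h0 where "h0 = D' * C'"
    note d = carrier_matD[OF CD(1)] carrier_matD[OF CD(2)] carrier_matD[OF CD(3)] carrier_matD[OF CD(4)]
    have h0: "h0 \<in> carrier_mat n n" unfolding h0_def by (rule mult_carrier_mat[OF CD(4,3)])
    have fhf: "f * h0 * f = f"
    proof -
      have "f * h0 * f = C * ((D * D') * ((C' * C) * D))"
        unfolding h0_def CD(5) by (simp add: mat_assoc d)
      then show ?thesis using CD by simp
    qed
    define h where "h = avg_mat (carrier G) n n (\<lambda>g. \<rho> g * h0 * \<sigma> (inv g))"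
    have h: "h \<in> carrier_mat n n" by (simp add: h_def)
    have hint: "h * \<sigma> g = \<rho> g * h" if "g \<in> carrier G" for g
      unfolding h_def by (rule average_intertwines[OF W V h0 that])
    note c = carrier_matD[OF matrix_repsD(1)[OF V]] carrier_matD[OF matrix_repsD(1)[OF W]]
      carrier_matD[OF f(1)] carrier_matD[OF h0] carrier_matD[OF h]
    have s: "\<rho> g * h0 * \<sigma> (inv g) \<in> carrier_mat n n" if "g \<in> carrier G" for g
      by (rule mult_carrier_mat[OF mult_carrier_mat[OF matrix_repsD(1)[OF V that] h0] matrix_repsD(1)[OF W inv_closed[OF that]]])
    have "f * h = avg_mat (carrier G) n n (\<lambda>g. f * (\<rho> g * h0 * \<sigma> (inv g)))"
      unfolding h_def by (rule mult_avg_mat[OF f(1) s])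
    then have "f * h * f = avg_mat (carrier G) n n (\<lambda>g. f * (\<rho> g * h0 * \<sigma> (inv g))) * f" by simp
    also have "\<dots> = avg_mat (carrier G) n n (\<lambda>g. f * (\<rho> g * h0 * \<sigma> (inv g)) * f)"
      by (rule avg_mat_mult[OF f(1)], rule mult_carrier_mat[OF f(1) s])
    also have "\<dots> = f"
    proof (rule avg_mat_const_group[OF f(1)])
      fix g assume g: "g \<in> carrier G"
      have "f * (\<rho> g * h0 * \<sigma> (inv g)) * f = (f * \<rho> g) * h0 * (\<sigma> (inv g) * f)"
        using g by (simp add: mat_assoc c)
      also have "\<dots> = (\<sigma> g * f) * h0 * (f * \<rho> (inv g))" using g fint by simp
      also have "\<dots> = \<sigma> g * ((f * h0 * f) * \<rho> (inv g))" using g by (simp add: mat_assoc c)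
      also have "\<dots> = \<sigma> g * (\<sigma> (inv g) * f)" using g fhf fint by simp
      also have "\<dots> = \<sigma> (g \<otimes> inv g) * f" 
        using g matrix_repsD(3)[OF W g inv_closed[OF g]] by (simp add: mat_assoc c del: r_inv)
      also have "\<dots> = f" using g f(1) matrix_repsD(2)[OF W] by simp
      finally show "f * (\<rho> g * h0 * \<sigma> (inv g)) * f = f" .
    qed
    finally have fhf: "f * h * f = f" .
    \<comment> \<open>the projection onto the summand of \<open>\<rho>\<close> that \<open>f\<close> maps isomorphically into \<open>\<sigma>\<close>\<close>
    define e where "e = h * f"
    have e: "e \<in> carrier_mat n n" unfolding e_def by (rule mult_carrier_mat[OF h f(1)])
    have fe: "f * e = f" unfolding e_def using fhf by (simp add: mat_assoc c)
    have "e * e = h * (f * e)" unfolding e_def by (simp add: mat_assoc c)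
    then have ee: "e * e = e" using fe unfolding e_def by simp
    have ecom: "e * \<rho> g = \<rho> g * e" if g: "g \<in> carrier G" for g
    proof -
      have "e * \<rho> g = h * (f * \<rho> g)" unfolding e_def using g by (simp add: mat_assoc c)
      also have "\<dots> = (h * \<sigma> g) * f" unfolding fint[OF g] using g by (simp add: mat_assoc c)
      also have "\<dots> = \<rho> g * e" unfolding hint[OF g] e_def using g by (simp add: mat_assoc c)
      finally show ?thesis .
    qed
    obtain u P Q where P: "P \<in> carrier_mat n u" and Q: "Q \<in> carrier_mat u n"
      and QP: "Q * P = 1\<^sub>m u" and PQ: "P * Q = e"
      using idempotent_splits[OF e ee] by metis
    note cPQ = carrier_matD[OF P] carrier_matD[OF Q]
    have com: "P * Q * \<rho> g = \<rho> g * (P * Q)" if "g \<in> carrier G" for g using ecom[OF that] PQ by simp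
    note comp = compress[OF V P Q QP com]
    define \<alpha> where "\<alpha> g = Q * \<rho> g * P" for g
    have U: "(u, \<alpha>) \<in> matrix_reps G" unfolding \<alpha>_def by (rule comp(1))
    have Pint: "P * \<alpha> g = \<rho> g * P" if "g \<in> carrier G" for g unfolding \<alpha>_def by (rule comp(2)[OF _ that])
    have Qint: "Q * \<rho> g = \<alpha> g * Q" if "g \<in> carrier G" for g unfolding \<alpha>_def by (rule comp(3)[OF _ that])
    note ca = carrier_matD[OF matrix_repsD(1)[OF U]]
    obtain w \<beta> where 1: "(w, \<beta>) \<in> matrix_reps G" "u + w = n"
      "frag_of (n, \<rho>) - frag_of (u, \<alpha>) - frag_of (w, \<beta>) \<in> grel G"
      using split_off[OF V U P Q QP Pint Qint] by metis
    \<comment> \<open>\<open>f P\<close> and \<open>Q h\<close> embed and project the same \<open>\<alpha>\<close> in \<open>\<sigma>\<close>\<close>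
    have QP1: "(Q * h) * (f * P) = 1\<^sub>m u"
    proof -
      have "(Q * h) * (f * P) = Q * (e * P)" unfolding e_def by (simp add: mat_assoc c cPQ)
      also have "\<dots> = (Q * P) * (Q * P)" unfolding PQ[symmetric] by (simp add: mat_assoc cPQ)
      finally show ?thesis using QP by simp
    qed
    have P1int: "(f * P) * \<alpha> g = \<sigma> g * (f * P)" if g: "g \<in> carrier G" for g
    proof -
      have "(f * P) * \<alpha> g = (f * \<rho> g) * P" using Pint[OF g] g by (simp add: mat_assoc c cPQ ca)
      then show ?thesis unfolding fint[OF g] using g by (simp add: mat_assoc c cPQ ca)
    qed
    have Q1int: "(Q * h) * \<sigma> g = \<alpha> g * (Q * h)" if g: "g \<in> carrier G" for g
    proof -
      have "(Q * h) * \<sigma> g = Q * (h * \<sigma> g)" using g by (simp add: mat_assoc c cPQ)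
      also have "\<dots> = (Q * \<rho> g) * h" unfolding hint[OF g] using g by (simp add: mat_assoc c cPQ)
      also have "\<dots> = \<alpha> g * (Q * h)" unfolding Qint[OF g] using g by (simp add: mat_assoc c cPQ ca)
      finally show ?thesis .
    qed
    obtain w' \<beta>' where 2: "(w', \<beta>') \<in> matrix_reps G" "u + w' = n"
      "frag_of (n, \<sigma>) - frag_of (u, \<alpha>) - frag_of (w', \<beta>') \<in> grel G"
      using split_off[OF W U mult_carrier_mat[OF f(1) P] mult_carrier_mat[OF Q h] QP1 P1int Q1int] by metis
    have "u \<noteq> 0"
    proof
      assume "u = 0"
      then have "e = 0\<^sub>m n n" using PQ[symmetric] P Q by (auto intro!: eq_matI simp: scalar_prod_def)
      then have "f = 0\<^sub>m n n" using fe f(1) by simp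
      then show False using f(2) by simp
    qed
    then have "w < n" using 1(2) by simp
    moreover have "mtrace (\<beta> g) = mtrace (\<beta>' g)" if g: "g \<in> carrier G" for g
      using grel_char[OF 1(3) g] grel_char[OF 2(3) g] ch[OF g] by simp
    ultimately have 3: "frag_of (w, \<beta>) - frag_of (w', \<beta>') \<in> grel G"
      by (rule less.IH[OF _ 1(1) 2(1)])
    have "frag_of (n, \<rho>) - frag_of (n, \<sigma>) =
      (frag_of (n, \<rho>) - frag_of (u, \<alpha>) - frag_of (w, \<beta>))
      - (frag_of (n, \<sigma>) - frag_of (u, \<alpha>) - frag_of (w', \<beta>'))
      + (frag_of (w, \<beta>) - frag_of (w', \<beta>'))" by simp
    then show ?thesis unfolding mn using N_add[OF N_diff[OF 1(3) 2(3)] 3] by simp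
  qed
qed

end

text \<open>
  The coordinate embedding of \<open>F\<^sup>n\<close> into \<open>F\<^sup>N\<close> that sends
  the basis vector \<open>e\<^sub>j\<close> to the one with index \<open>\<iota> j\<close>.
\<close>

definition coord_embed :: "nat \<Rightarrow> nat \<Rightarrow> (nat \<Rightarrow> nat) \<Rightarrow> 'f::field mat" where
  "coord_embed N n \<iota> = mat N n (\<lambda>(i, j). if i = \<iota> j then 1 else 0)"

lemma coord_embed_carrier [simp]: "coord_embed N n \<iota> \<in> carrier_mat N n"
  by (simp add: coord_embed_def)

lemma coord_embed_orth:
  assumes "\<And>i. i < n \<Longrightarrow> \<iota> i < N"
  shows "transpose_mat (coord_embed N n \<iota>) * coord_embed N m \<kappa> =
    (mat n m (\<lambda>(i, j). if \<iota> i = \<kappa> j then 1 else 0) :: 'f::field mat)"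
  by (rule eq_matI) (use assms in \<open>auto simp: coord_embed_def scalar_prod_def sum_mat_delta\<close>)

lemma coord_embed_proj:
  assumes inj: "inj_on \<iota> {..<n}"
  shows "coord_embed N n \<iota> * transpose_mat (coord_embed N n \<iota>) =
    (mat N N (\<lambda>(i, j). if i = j \<and> i \<in> \<iota> ` {..<n} then 1 else 0) :: 'f::field mat)"
proof (rule eq_matI)
  fix a b assume "a < dim_row (mat N N (\<lambda>(i, j). if i = j \<and> i \<in> \<iota> ` {..<n} then 1 else (0::'f)))"
    "b < dim_col (mat N N (\<lambda>(i, j). if i = j \<and> i \<in> \<iota> ` {..<n} then 1 else (0::'f)))"
  then have ab: "a < N" "b < N" by auto
  have eq: "(coord_embed N n \<iota> * transpose_mat (coord_embed N n \<iota>)) $$ (a, b) =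
      (\<Sum>k = 0..<n. (if a = \<iota> k then 1 else 0) * (if b = \<iota> k then 1 else (0::'f)))"
    using ab by (simp add: coord_embed_def scalar_prod_def)
  show "(coord_embed N n \<iota> * transpose_mat (coord_embed N n \<iota>)) $$ (a, b) =
      mat N N (\<lambda>(i, j). if i = j \<and> i \<in> \<iota> ` {..<n} then 1 else (0::'f)) $$ (a, b)"
  proof (cases "a \<in> \<iota> ` {..<n}")
    case True
    then obtain c where c: "c < n" "a = \<iota> c" by blast
    have "(\<Sum>k = 0..<n. (if a = \<iota> k then 1 else 0) * (if b = \<iota> k then 1 else (0::'f))) =
        (\<Sum>k = 0..<n. (if k = c then 1 else 0) * (if b = \<iota> k then 1 else 0))"
      using c inj by (intro sum.cong) (auto simp: inj_on_def)
    then show ?thesis unfolding eq using c ab by (auto simp: sum_mat_delta)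
  next
    case False
    then have "(\<Sum>k = 0..<n. (if a = \<iota> k then 1 else 0) * (if b = \<iota> k then 1 else (0::'f))) = 0"
      by (intro sum.neutral) auto
    then show ?thesis unfolding eq using ab False by auto
  qed
qed (auto simp: coord_embed_def)

lemma mat_zero_add: "(A :: 'f::field mat) \<in> carrier_mat n m \<Longrightarrow> A + 0\<^sub>m n m = A" "A \<in> carrier_mat n m \<Longrightarrow> 0\<^sub>m n m + A = A"
  by (auto intro!: eq_matI)

context finite_group begin

text \<open>
  On \<open>F\<^sup>n\<^sup>+\<^sup>m\<close> the direct sum is \<open>P\<^sub>1 \<rho>
  Q\<^sub>1 + P\<^sub>2 \<sigma> Q\<^sub>2\<close> for the two coordinate embeddings and
  projections; everything follows from the four products \<open>Q\<^sub>i P\<^sub>j\<close> and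
  \<open>P\<^sub>1 Q\<^sub>1 + P\<^sub>2 Q\<^sub>2 = 1\<close>.
\<close>

lemma direct_sum_class:
  fixes \<rho> :: "'a \<Rightarrow> 'f::field_char_0 mat"
  assumes V: "(n, \<rho>) \<in> matrix_reps G" and W: "(m, \<sigma>) \<in> matrix_reps G"
  obtains D where "D \<in> matrix_reps G" "frag_of D - frag_of (n, \<rho>) - frag_of (m, \<sigma>) \<in> grel G"
proof -
  define P1 :: "'f mat" where "P1 = coord_embed (n + m) n (\<lambda>i. i)"
  define P2 :: "'f mat" where "P2 = coord_embed (n + m) m (\<lambda>i. n + i)"
  define Q1 where "Q1 = transpose_mat P1"
  define Q2 where "Q2 = transpose_mat P2"
  have P: "P1 \<in> carrier_mat (n + m) n" "P2 \<in> carrier_mat (n + m) m" by (simp_all add: P1_def P2_def)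
  then have Q: "Q1 \<in> carrier_mat n (n + m)" "Q2 \<in> carrier_mat m (n + m)" by (simp_all add: Q1_def Q2_def)
  note c = carrier_matD[OF matrix_repsD(1)[OF V]] carrier_matD[OF matrix_repsD(1)[OF W]]
    carrier_matD[OF P(1)] carrier_matD[OF P(2)] carrier_matD[OF Q(1)] carrier_matD[OF Q(2)]
  have o: "Q1 * P1 = 1\<^sub>m n" "Q2 * P2 = 1\<^sub>m m" "Q1 * P2 = 0\<^sub>m n m" "Q2 * P1 = 0\<^sub>m m n"
    unfolding Q1_def Q2_def P1_def P2_def by (simp_all add: coord_embed_orth) (auto intro!: eq_matI)
  have sum: "P1 * Q1 + P2 * Q2 = 1\<^sub>m (n + m)"
  proof -
    have "P1 * Q1 = mat (n + m) (n + m) (\<lambda>(i, j). if i = j \<and> i \<in> (\<lambda>i. i) ` {..<n} then 1 else 0)"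
      unfolding P1_def Q1_def by (rule coord_embed_proj) simp
    moreover have "P2 * Q2 = mat (n + m) (n + m) (\<lambda>(i, j). if i = j \<and> i \<in> (\<lambda>i. n + i) ` {..<m} then 1 else 0)"
      unfolding P2_def Q2_def by (rule coord_embed_proj) simp
    moreover have "i \<in> (\<lambda>i. n + i) ` {..<m} \<longleftrightarrow> \<not> i < n" if "i < n + m" for i
      using that by (auto intro!: image_eqI[of _ _ "i - n"])
    ultimately show ?thesis by (auto intro!: eq_matI)
  qed
  define D where "D g = P1 * \<rho> g * Q1 + P2 * \<sigma> g * Q2" for g
  have s: "P1 * \<rho> g * Q1 \<in> carrier_mat (n + m) (n + m)" "P2 * \<sigma> g * Q2 \<in> carrier_mat (n + m) (n + m)"
    if "g \<in> carrier G" for g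
    by (rule mult_carrier_mat[OF mult_carrier_mat[OF P(1) matrix_repsD(1)[OF V that]] Q(1)],
        rule mult_carrier_mat[OF mult_carrier_mat[OF P(2) matrix_repsD(1)[OF W that]] Q(2)])
  have Dc: "D g \<in> carrier_mat (n + m) (n + m)" if "g \<in> carrier G" for g
    unfolding D_def by (rule add_carrier_mat[OF s(2)[OF that]])
  have z: "X * 0\<^sub>m k l = 0\<^sub>m (dim_row X) l" if "dim_col X = k" for X :: "'f mat" and k l
    using that by (intro right_mult_zero_mat) auto
  have DP1: "D g * P1 = P1 * \<rho> g" and DP2: "D g * P2 = P2 * \<sigma> g" and QD: "Q2 * D g = \<sigma> g * Q2"
    if g: "g \<in> carrier G" for g
  proof -
    have a: "P1 * \<rho> g \<in> carrier_mat (n + m) n" "P2 * \<sigma> g \<in> carrier_mat (n + m) m"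
        "\<sigma> g * Q2 \<in> carrier_mat m (n + m)"
      by (rule mult_carrier_mat[OF P(1) matrix_repsD(1)[OF V g]], rule mult_carrier_mat[OF P(2) matrix_repsD(1)[OF W g]],
          rule mult_carrier_mat[OF matrix_repsD(1)[OF W g] Q(2)])
    have "D g * P1 = P1 * \<rho> g * (Q1 * P1) + P2 * \<sigma> g * (Q2 * P1)"
      unfolding D_def add_mult_distrib_mat[OF s[OF g] P(1)] using g by (simp add: mat_assoc c)
    also have "\<dots> = P1 * \<rho> g + 0\<^sub>m (n + m) n"
      unfolding o z[OF carrier_matD(2)[OF a(2)]] right_mult_one_mat[OF a(1)] by (simp add: c)
    also have "\<dots> = P1 * \<rho> g" by (rule mat_zero_add[OF a(1)])
    finally show "D g * P1 = P1 * \<rho> g" .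
    have "D g * P2 = P1 * \<rho> g * (Q1 * P2) + P2 * \<sigma> g * (Q2 * P2)"
      unfolding D_def add_mult_distrib_mat[OF s[OF g] P(2)] using g by (simp add: mat_assoc c)
    also have "\<dots> = 0\<^sub>m (n + m) m + P2 * \<sigma> g"
      unfolding o z[OF carrier_matD(2)[OF a(1)]] right_mult_one_mat[OF a(2)] by (simp add: c)
    also have "\<dots> = P2 * \<sigma> g" by (rule mat_zero_add[OF a(2)])
    finally show "D g * P2 = P2 * \<sigma> g" .
    have "Q2 * D g = (Q2 * P1) * (\<rho> g * Q1) + (Q2 * P2) * (\<sigma> g * Q2)"
      unfolding D_def mult_add_distrib_mat[OF Q(2) s[OF g]] using g by (simp add: mat_assoc c)
    also have "\<dots> = 0\<^sub>m m (n + m) + \<sigma> g * Q2"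
      unfolding o left_mult_one_mat[OF a(3)] using g by (subst left_mult_zero_mat[of _ n "n + m"]) (auto simp: c)
    also have "\<dots> = \<sigma> g * Q2" by (rule mat_zero_add[OF a(3)])
    finally show "Q2 * D g = \<sigma> g * Q2" .
  qed
  have D: "(n + m, D) \<in> matrix_reps G"
    unfolding matrix_reps_def
  proof safe
    fix g h assume g: "g \<in> carrier G" and h: "h \<in> carrier G"
    have "D g * D h = (D g * P1) * (\<rho> h * Q1) + (D g * P2) * (\<sigma> h * Q2)"
      unfolding D_def[of h] mult_add_distrib_mat[OF Dc[OF g] s[OF h]]
      using g h by (simp add: mat_assoc c carrier_matD[OF Dc[OF g]])
    also have "\<dots> = D (g \<otimes> h)"
      unfolding DP1[OF g] DP2[OF g] unfolding D_def matrix_repsD(3)[OF V g h] matrix_repsD(3)[OF W g h]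
      using g h by (simp add: mat_assoc c)
    finally show "D (g \<otimes> h) = D g * D h" ..
  next
    show "D \<one> = 1\<^sub>m (n + m)"
      unfolding D_def matrix_repsD(2)[OF V] matrix_repsD(2)[OF W]
      using right_mult_one_mat[OF P(1)] right_mult_one_mat[OF P(2)] sum by simp
  qed (rule Dc)
  have "short_exact G (vec_gmodule (n, \<rho>)) (vec_gmodule (n + m, D)) (vec_gmodule (m, \<sigma>))"
    by (rule split_short_exact[OF V D W P(1) Q(1) P(2) Q(2) o(1,2) sum DP1[symmetric] QD])
  then have "frag_of (n + m, D) - frag_of (n, \<rho>) - frag_of (m, \<sigma>) \<in> grel G"
    by (rule short_exact_relation[OF V D W])
  then show ?thesis using that D by blast
qed

text \<open>
  Direct sums collect the positive and the negative terms into one representation each.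
\<close>

lemma virtual_difference:
  fixes x :: "('f::field_char_0, 'a) matrix_rep \<Rightarrow>\<^sub>0 int"
  assumes "virtual_rep G x"
  shows "\<exists>V\<in>matrix_reps G. \<exists>W\<in>matrix_reps G. x - (frag_of V - frag_of W) \<in> grel G"
proof -
  interpret presentation "matrix_reps G" "grothendieck_relations G" by (rule grothendieck_presentation)
  have zero: "frag_of (zero_rep :: ('f, 'a) matrix_rep) \<in> grel G"
    using zero_rep_in[of G] unfolding zero_rep_def by (rule class_of_dim_zero)
  show ?thesis using assms
  proof (induction x rule: frag_induction)
    case zero
    show ?case by (intro bexI[OF _ zero_rep_in]) simp
  next
    case (one V)
    show ?case by (intro bexI[OF bexI[OF _ zero_rep_in] one]) (simp add: zero)
  next
    case (diff x y)
    then obtain V W V' W' where VW: "V \<in> matrix_reps G" "W \<in> matrix_reps G" "V' \<in> matrix_reps G" "W' \<in> matrix_reps G"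
      and x: "x - (frag_of V - frag_of W) \<in> grel G" and y: "y - (frag_of V' - frag_of W') \<in> grel G"
      by blast
    obtain D where D: "D \<in> matrix_reps G" "frag_of D - frag_of V - frag_of W' \<in> grel G"
      using direct_sum_class[of "fst V" "snd V" "fst W'" "snd W'"] VW by auto
    obtain D' where D': "D' \<in> matrix_reps G" "frag_of D' - frag_of W - frag_of V' \<in> grel G"
      using direct_sum_class[of "fst W" "snd W" "fst V'" "snd V'"] VW by auto
    have "(x - y) - (frag_of D - frag_of D') =
      ((x - (frag_of V - frag_of W)) - (y - (frag_of V' - frag_of W')))
      - ((frag_of D - frag_of V - frag_of W') - (frag_of D' - frag_of W - frag_of V'))" by simp
    also have "\<dots> \<in> grel G" by (intro N_diff x y D D')
    finally show ?case using D D' by blast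
  qed
qed

text \<open>
  Relations have character zero because characters are additive. Conversely a virtual
  representation is a difference \<open>V - W\<close> up to relations, and character zero means
  that \<open>V\<close> and \<open>W\<close> have the same character.
\<close>

lemma grel_iff_char:
  fixes x :: "('f::field_char_0, 'a) matrix_rep \<Rightarrow>\<^sub>0 int"
  assumes x: "virtual_rep G x"
  shows "x \<in> grel G \<longleftrightarrow> (\<forall>g\<in>carrier G. frag_char x g = 0)"
proof
  interpret presentation "matrix_reps G" "grothendieck_relations G" by (rule grothendieck_presentation)
  assume z: "\<forall>g\<in>carrier G. frag_char x g = 0"
  obtain V W where V: "V \<in> matrix_reps G" and W: "W \<in> matrix_reps G"
    and r: "x - (frag_of V - frag_of W) \<in> grel G"
    using virtual_difference[OF x] by blast
  have "rep_char V g = rep_char W g" if "g \<in> carrier G" for g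
    using grel_char[OF r that] z that by simp
  then have "frag_of V - frag_of W \<in> grel G"
    using same_char_same_class[of "fst V" "snd V" "fst W" "snd W"] V W by simp
  from N_add[OF r this] show "x \<in> grel G" by simp
qed (simp add: grel_char)

lemma grothendieck_class_eq_iff:
  fixes x y :: "('f::field_char_0, 'a) matrix_rep \<Rightarrow>\<^sub>0 int"
  assumes "virtual_rep G x" "virtual_rep G y"
  shows "grothendieck_class G x = grothendieck_class G y \<longleftrightarrow> (\<forall>g\<in>carrier G. frag_char x g = frag_char y g)"
  unfolding grothendieck_class_def
  using presentation.cls_eq_iff[OF grothendieck_presentation assms] grel_iff_char[OF frag_keys_diff[OF assms]]
  by simp

end

lemma matrix_form_char:
  fixes M :: "('f::field, 'v, 'g) gmodule"
  assumes V: "V \<in> matrix_reps G" and iso: "gmodule_iso G (vec_gmodule V) M"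
  shows "matrix_form G M \<in> matrix_reps G"
    "g \<in> carrier G \<Longrightarrow> rep_char (matrix_form G M) g = rep_char V g"
proof -
  have *: "matrix_form G M \<in> matrix_reps G \<and> gmodule_iso G (vec_gmodule (matrix_form G M)) M"
    unfolding matrix_form_def by (rule someI[of _ V]) (use assms in simp)
  then show "matrix_form G M \<in> matrix_reps G" by simp
  show "rep_char (matrix_form G M) g = rep_char V g" if "g \<in> carrier G"
    by (rule gmodule_iso_char[OF _ V _ iso that]) (use * in simp_all)
qed

lemma vec_gmodule_module: "module class_ring (vec_gmodule (n, \<rho>) :: ('f::field, 'f vec, 'g) gmodule)"
proof (rule module_criteria)
  show "\<forall>v\<in>carrier (vec_gmodule (n, \<rho>)). \<exists>w\<in>carrier (vec_gmodule (n, \<rho>)).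
      v \<oplus>\<^bsub>vec_gmodule (n, \<rho>)\<^esub> w = \<zero>\<^bsub>vec_gmodule (n, \<rho>)\<^esub>"
  proof
    fix v :: "'f vec" assume "v \<in> carrier (vec_gmodule (n, \<rho>))"
    then show "\<exists>w\<in>carrier (vec_gmodule (n, \<rho>)). v \<oplus>\<^bsub>vec_gmodule (n, \<rho>)\<^esub> w = \<zero>\<^bsub>vec_gmodule (n, \<rho>)\<^esub>"
      by (intro bexI[of _ "- v"]) auto
  qed
qed (auto simp: class_ring_simps class_cring.cring_axioms smult_smult_assoc add_smult_distrib_vec smult_add_distrib_vec
    comm_add_vec assoc_add_vec)

lemma vec_gmodule_minus:
  assumes "v \<in> carrier_vec n" "w \<in> carrier_vec n"
  shows "v \<ominus>\<^bsub>vec_gmodule (n, \<rho>)\<^esub> w = v - (w :: 'f::field vec)"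
proof -
  interpret Module.module class_ring "vec_gmodule (n, \<rho>)" by (rule vec_gmodule_module)
  have "\<ominus>\<^bsub>vec_gmodule (n, \<rho>)\<^esub> w = - w"
    by (rule M.minus_equality) (use assms in auto)
  then show ?thesis using assms unfolding a_minus_def by auto
qed

text \<open>
  The left side is the subspace by which coinvariants are formed. It is killed by
  \<open>e\<close> as \<open>e \<tau> x = e\<close>. If \<open>e v = 0\<close>, then summing
  \<open>\<tau> x v - v\<close> over the group gives \<open>- |K| v\<close>, so \<open>v\<close>
  lies in the span.
\<close>

lemma span_differences:
  fixes \<tau> :: "'c \<Rightarrow> 'f::field_char_0 mat"
  assumes K: "finite_group K" and V: "(n, \<tau>) \<in> matrix_reps K"
    and M: "module class_ring M" and cM: "carrier M = carrier_vec n" and aM: "ring.add M = (+)"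
    and zM: "ring.zero M = 0\<^sub>v n" and sM: "module.smult M = (\<cdot>\<^sub>v)"
  defines "e \<equiv> avg_mat (carrier K) n n \<tau>"
  shows "LinearCombinations.module.span class_ring M {\<tau> x *\<^sub>v v - v | x v. x \<in> carrier K \<and> v \<in> carrier_vec n} =
    {v \<in> carrier_vec n. e *\<^sub>v v = 0\<^sub>v n}"
proof
  interpret finite_group K by (fact K)
  interpret Module.module class_ring M by (fact M)
  note t = matrix_repsD(1)[OF V]
  have e: "e \<in> carrier_mat n n" by (simp add: e_def)
  let ?S = "{\<tau> x *\<^sub>v v - v | x v. x \<in> carrier K \<and> v \<in> carrier_vec n}"
  have tv: "\<tau> x *\<^sub>v v \<in> carrier_vec n" if "x \<in> carrier K" for x v
    using t[OF that] by simp
  have Sc: "?S \<subseteq> carrier M" unfolding cM using tv by auto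
  have subm: "submodule class_ring {v \<in> carrier_vec n. e *\<^sub>v v = 0\<^sub>v n} M"
    by (rule submodule.intro)
      (auto simp: M cM aM zM sM mult_add_distrib_mat_vec[OF e] mult_mat_vec[OF e] mat_mult_zero_vec[OF e])
  show "LinearCombinations.module.span class_ring M ?S \<subseteq> {v \<in> carrier_vec n. e *\<^sub>v v = 0\<^sub>v n}"
  proof (rule span_is_subset[OF _ subm], safe)
    fix x and v :: "'f vec" assume x: "x \<in> carrier K" and v: "v \<in> carrier_vec n"
    show "\<tau> x *\<^sub>v v - v \<in> carrier_vec n" using tv[OF x] v by simp
    have "e *\<^sub>v (\<tau> x *\<^sub>v v - v) = (e * \<tau> x) *\<^sub>v v - e *\<^sub>v v"
      using mult_minus_distrib_mat_vec[OF e tv[OF x] v] assoc_mult_mat_vec[OF e t[OF x] v] by simp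
    also have "e * \<tau> x = e" unfolding e_def by (rule average_idempotent(2)[OF V x])
    finally show "e *\<^sub>v (\<tau> x *\<^sub>v v - v) = 0\<^sub>v n" using e v by (auto intro!: eq_vecI)
  qed
  show "{v \<in> carrier_vec n. e *\<^sub>v v = 0\<^sub>v n} \<subseteq> LinearCombinations.module.span class_ring M ?S"
  proof safe
    fix v :: "'f vec" assume v: "v \<in> carrier_vec n" and ev: "e *\<^sub>v v = 0\<^sub>v n"
    interpret sp: submodule class_ring "span ?S" M by (rule span_is_submodule[OF Sc])
    define s where "s T = vec n (\<lambda>i. \<Sum>x\<in>T. (\<tau> x *\<^sub>v v - v) $ i)" for T
    have "s T \<in> span ?S" if "finite T" "T \<subseteq> carrier K" for T
      using that
    proof (induction T rule: finite_induct)
      case empty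
      have "s {} = 0\<^sub>v n" by (auto simp: s_def)
      then show ?case using sp.zero_closed zM by simp
    next
      case (insert x T)
      have "s (insert x T) = (\<tau> x *\<^sub>v v - v) + s T"
        using insert tv[of x v] v by (intro eq_vecI) (auto simp: s_def)
      moreover have "\<tau> x *\<^sub>v v - v \<in> span ?S"
        using insert.prems v in_own_span[OF Sc] by blast
      ultimately show ?case using sp.m_closed insert aM by auto
    qed
    then have sK: "s (carrier K) \<in> span ?S" using finite_carrier by simp
    have "v = (- 1 / of_nat (card (carrier K))) \<cdot>\<^sub>v s (carrier K)"
    proof (rule eq_vecI)
      fix i assume "i < dim_vec ((- 1 / of_nat (card (carrier K))) \<cdot>\<^sub>v s (carrier K))"
      then have i: "i < n" by (simp add: s_def)
      have "0 = (e *\<^sub>v v) $ i" using ev i by simp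
      also have "\<dots> = (\<Sum>j = 0..<n. (\<Sum>x\<in>carrier K. \<tau> x $$ (i, j)) / of_nat (card (carrier K)) * v $ j)"
        using i v by (simp add: e_def avg_mat_def scalar_prod_def)
      also have "\<dots> = (\<Sum>x\<in>carrier K. \<Sum>j = 0..<n. \<tau> x $$ (i, j) * v $ j) / of_nat (card (carrier K))"
        by (subst sum.swap) (simp add: sum_divide_distrib sum_distrib_right)
      also have "(\<Sum>x\<in>carrier K. \<Sum>j = 0..<n. \<tau> x $$ (i, j) * v $ j) = (\<Sum>x\<in>carrier K. (\<tau> x *\<^sub>v v) $ i)"
        using i v by (intro sum.cong refl) (auto simp: scalar_prod_def dest: t)
      finally have z: "(\<Sum>x\<in>carrier K. (\<tau> x *\<^sub>v v) $ i) = 0"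
        using card_carrier_ne0 by simp
      have "s (carrier K) $ i = (\<Sum>x\<in>carrier K. (\<tau> x *\<^sub>v v) $ i - v $ i)"
        unfolding s_def using i v by simp
      also have "\<dots> = - of_nat (card (carrier K)) * v $ i"
        using z by (simp add: sum_subtractf)
      finally show "v $ i = ((- 1 / of_nat (card (carrier K))) \<cdot>\<^sub>v s (carrier K)) $ i"
        using i card_carrier_ne0[where 'f = 'f] by (simp add: s_def)
    qed (use v in \<open>simp add: s_def\<close>)
    moreover have "(- 1 / of_nat (card (carrier K))) \<odot>\<^bsub>M\<^esub> s (carrier K) \<in> span ?S"
      by (rule sp.smult_closed[OF _ sK]) simp
    ultimately show "v \<in> span ?S" unfolding sM by simp
  qed
qed

section \<open>Coinvariants and the character of a composite\<close>

lemma DirProd_simps: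
  "(a, b) \<otimes>\<^bsub>A \<times>\<times> B\<^esub> (a', b') = (a \<otimes>\<^bsub>A\<^esub> a', b \<otimes>\<^bsub>B\<^esub> b')"
  "\<one>\<^bsub>A \<times>\<times> B\<^esub> = (\<one>\<^bsub>A\<^esub>, \<one>\<^bsub>B\<^esub>)" "carrier (A \<times>\<times> B) = carrier A \<times> carrier B"
  by (simp_all add: DirProd_def)

lemma finite_group_DirProd:
  assumes "finite_group A" "finite_group B"
  shows "finite_group (A \<times>\<times> B)"
  using assms DirProd_group[of A B] unfolding finite_group_def finite_group_axioms_def by (auto simp: DirProd_simps)

text \<open>
  The groups of a composite \<open>H \<rightarrow> K \<rightarrow> L\<close> in the category
  shifted by \<open>G\<close>.
\<close>

locale four_groups =
  L: finite_group L + K: finite_group K + H: finite_group H + G: finite_group G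
  for L :: "'l monoid" and K :: "'c monoid" and H :: "'h monoid" and G :: "'g monoid"
begin

lemmas factors = L.finite_group_axioms H.finite_group_axioms G.finite_group_axioms

lemma finite_group_LHG: "finite_group (triple L H G)"
  by (intro finite_group_DirProd L.finite_group_axioms H.finite_group_axioms G.finite_group_axioms)

context
  fixes n :: nat and \<tau> :: "'l \<times> 'c \<times> 'h \<times> 'g \<Rightarrow> 'f::field_char_0 mat"
  assumes T: "(n, \<tau>) \<in> matrix_reps (L \<times>\<times> K \<times>\<times> H \<times>\<times> G)"
begin

lemma tau_mult:
  assumes "l \<in> carrier L" "x \<in> carrier K" "h \<in> carrier H" "g \<in> carrier G"
    "l' \<in> carrier L" "x' \<in> carrier K" "h' \<in> carrier H" "g' \<in> carrier G"
  shows "\<tau> (l, x, h, g) * \<tau> (l', x', h', g') =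
    \<tau> (l \<otimes>\<^bsub>L\<^esub> l', x \<otimes>\<^bsub>K\<^esub> x', h \<otimes>\<^bsub>H\<^esub> h', g \<otimes>\<^bsub>G\<^esub> g')"
  using matrix_repsD(3)[OF T, of "(l, x, h, g)" "(l', x', h', g')"] assms by (simp add: DirProd_simps)

lemma tau_carrier:
  assumes "l \<in> carrier L" "x \<in> carrier K" "h \<in> carrier H" "g \<in> carrier G"
  shows "\<tau> (l, x, h, g) \<in> carrier_mat n n"
  using matrix_repsD(1)[OF T] assms by (simp add: DirProd_simps)

lemma tau_one: "\<tau> (\<one>\<^bsub>L\<^esub>, \<one>\<^bsub>K\<^esub>, \<one>\<^bsub>H\<^esub>, \<one>\<^bsub>G\<^esub>) = 1\<^sub>m n"
  using matrix_repsD(2)[OF T] by (simp add: DirProd_simps)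

text \<open>
  The action of \<open>K\<close>, whose coinvariants are taken, the remaining action of \<open>L
  \<times> H \<times> G\<close>, and the projection onto the fixed vectors of \<open>K\<close>.
\<close>

definition tauK :: "'c \<Rightarrow> 'f mat" where "tauK x = \<tau> (\<one>\<^bsub>L\<^esub>, x, \<one>\<^bsub>H\<^esub>, \<one>\<^bsub>G\<^esub>)"
definition tauL :: "'l \<times> 'h \<times> 'g \<Rightarrow> 'f mat" where "tauL = (\<lambda>(l, h, g). \<tau> (l, \<one>\<^bsub>K\<^esub>, h, g))"
definition eK :: "'f mat" where "eK = avg_mat (carrier K) n n tauK"

lemma tauK_rep: "(n, tauK) \<in> matrix_reps K"
  unfolding matrix_reps_def tauK_def by (auto simp: tau_carrier tau_mult tau_one)

lemma tauL_rep: "(n, tauL) \<in> matrix_reps (triple L H G)"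
  unfolding matrix_reps_def tauL_def by (auto simp: tau_carrier tau_mult tau_one DirProd_simps)

lemma eK_carrier: "eK \<in> carrier_mat n n" by (simp add: eK_def)

lemma tauL_eK:
  assumes "l \<in> carrier L" "h \<in> carrier H" "g \<in> carrier G"
  shows "tauL (l, h, g) * eK = avg_mat (carrier K) n n (\<lambda>x. \<tau> (l, x, h, g))"
    "eK * tauL (l, h, g) = avg_mat (carrier K) n n (\<lambda>x. \<tau> (l, x, h, g))"
proof -
  have c: "tauL (l, h, g) \<in> carrier_mat n n" using assms by (simp add: tauL_def tau_carrier)
  have k: "\<And>x. x \<in> carrier K \<Longrightarrow> tauK x \<in> carrier_mat n n" by (simp add: tauK_def tau_carrier)
  have "tauL (l, h, g) * eK = avg_mat (carrier K) n n (\<lambda>x. tauL (l, h, g) * tauK x)"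
    unfolding eK_def by (rule mult_avg_mat[OF c k])
  also have "\<dots> = avg_mat (carrier K) n n (\<lambda>x. \<tau> (l, x, h, g))"
    by (rule avg_mat_cong) (use assms in \<open>simp add: tauL_def tauK_def tau_mult\<close>)
  finally show "tauL (l, h, g) * eK = avg_mat (carrier K) n n (\<lambda>x. \<tau> (l, x, h, g))" .
  have "eK * tauL (l, h, g) = avg_mat (carrier K) n n (\<lambda>x. tauK x * tauL (l, h, g))"
    unfolding eK_def by (rule avg_mat_mult[OF c k])
  also have "\<dots> = avg_mat (carrier K) n n (\<lambda>x. \<tau> (l, x, h, g))"
    by (rule avg_mat_cong) (use assms in \<open>simp add: tauL_def tauK_def tau_mult\<close>)
  finally show "eK * tauL (l, h, g) = avg_mat (carrier K) n n (\<lambda>x. \<tau> (l, x, h, g))" .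
qed

lemma eK_tauL_commute: "p \<in> carrier (triple L H G) \<Longrightarrow> eK * tauL p = tauL p * eK"
  using tauL_eK by (auto simp: DirProd_simps)

text \<open>
  By \<open>span_differences\<close> two vectors have the same coset iff \<open>eK\<close>
  agrees on them. So the quotient space is the image of \<open>eK\<close>, and \<open>P\<close>
  identifies \<open>F\<^sup>r\<close> with this image.
\<close>

lemma coinvariants_iso:
  fixes P Q :: "'f mat"
  assumes P: "P \<in> carrier_mat n r" and Q: "Q \<in> carrier_mat r n" and QP: "Q * P = 1\<^sub>m r" and PQ: "P * Q = eK"
  shows "gmodule_iso (triple L H G) (vec_gmodule (r, \<lambda>p. Q * tauL p * P))
    (coinvariants G L K H (vec_gmodule (n, \<tau>)))"
proof -
  interpret LHG: finite_group "triple L H G" by (rule finite_group_LHG)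
  let ?V = "vec_gmodule (r, \<lambda>p. Q * tauL p * P)"
  let ?M = "vec_gmodule (n, \<tau>)"
  have com: "P * Q * tauL p = tauL p * (P * Q)" if "p \<in> carrier (triple L H G)" for p
    using eK_tauL_commute[OF that] PQ by simp
  note comp = LHG.compress[OF tauL_rep P Q QP com]
  have ee: "eK * eK = eK" unfolding eK_def by (rule K.average_idempotent(3)[OF tauK_rep])
  define D where "D = {v \<in> carrier_vec n. eK *\<^sub>v v = 0\<^sub>v n}"
  have tv: "tauK x *\<^sub>v v \<in> carrier_vec n" if "x \<in> carrier K" for x v
    using matrix_repsD(1)[OF tauK_rep that] by simp
  have span: "LinearCombinations.module.span class_ring ?M {act ?M (\<one>\<^bsub>L\<^esub>, x, \<one>\<^bsub>H\<^esub>, \<one>\<^bsub>G\<^esub>) v \<ominus>\<^bsub>?M\<^esub> v | x v.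
      x \<in> carrier K \<and> v \<in> carrier ?M} = D"
  proof -
    have eq: "\<tau> (\<one>\<^bsub>L\<^esub>, x, \<one>\<^bsub>H\<^esub>, \<one>\<^bsub>G\<^esub>) *\<^sub>v v \<ominus>\<^bsub>?M\<^esub> v = tauK x *\<^sub>v v - v"
      if "x \<in> carrier K" "v \<in> carrier_vec n" for x v
      using vec_gmodule_minus[OF tv[OF that(1)] that(2)] by (simp add: tauK_def)
    have "{act ?M (\<one>\<^bsub>L\<^esub>, x, \<one>\<^bsub>H\<^esub>, \<one>\<^bsub>G\<^esub>) v \<ominus>\<^bsub>?M\<^esub> v | x v. x \<in> carrier K \<and> v \<in> carrier ?M} =
      {tauK x *\<^sub>v v - v | x v. x \<in> carrier K \<and> v \<in> carrier_vec n}"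
      unfolding vec_gmodule_simps by (intro Collect_cong ex_cong1) (auto simp: eq)
    then show ?thesis
      using span_differences[OF K.finite_group_axioms tauK_rep vec_gmodule_module[of n \<tau>]]
      unfolding D_def eK_def by simp
  qed
  \<comment> \<open>the coset of \<open>v\<close>, by \<open>span_differences\<close>\<close>
  define C where "C v = {w \<in> carrier_vec n. eK *\<^sub>v w = eK *\<^sub>v v}" for v
  note e = eK_carrier
  have Ccos: "D +>\<^bsub>?M\<^esub> v = C v" if v: "v \<in> carrier_vec n" for v
  proof -
    have "D +>\<^bsub>?M\<^esub> v = {d + v | d. d \<in> D}" by (auto simp: a_r_coset_def')
    also have "\<dots> = C v"
    proof safe
      fix d assume "d \<in> D"
      then show "d + v \<in> C v" using v e by (simp add: D_def C_def mult_add_distrib_mat_vec[OF e])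
    next
      fix w assume w: "w \<in> C v"
      then have "w - v \<in> D" "w = (w - v) + v"
        using v e by (auto simp: D_def C_def mult_minus_distrib_mat_vec[OF e])
      then show "\<exists>d. w = d + v \<and> d \<in> D" by blast
    qed
    finally show ?thesis .
  qed
  have Cself: "v \<in> C v" if "v \<in> carrier_vec n" for v using that by (simp add: C_def)
  have Ceq: "C v = C w" if "eK *\<^sub>v v = eK *\<^sub>v w" for v w using that by (simp add: C_def)
  have UN: "(\<Union>v\<in>C w. F v) = F w" if "w \<in> carrier_vec n" "\<And>v. v \<in> C w \<Longrightarrow> F v = F w" for F :: "'f vec \<Rightarrow> 'f vec set" and w
    using that Cself by blast
  let ?N = "coinvariants G L K H ?M"
  have car: "carrier ?N = {C v | v. v \<in> carrier_vec n}"
    unfolding coinvariants_def Let_def span by (auto simp: A_RCOSETS_def' Ccos)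
  have Nadd: "C v \<oplus>\<^bsub>?N\<^esub> C w = C (v + w)" if v: "v \<in> carrier_vec n" and w: "w \<in> carrier_vec n" for v w
  proof -
    have "C v \<oplus>\<^bsub>?N\<^esub> C w = {a + b | a b. a \<in> C v \<and> b \<in> C w}"
      unfolding coinvariants_def Let_def by (auto simp: set_add_def')
    also have "\<dots> = C (v + w)"
    proof safe
      fix a b assume "a \<in> C v" "b \<in> C w"
      then show "a + b \<in> C (v + w)" using v w by (simp add: C_def mult_add_distrib_mat_vec[OF e])
    next
      fix u assume u: "u \<in> C (v + w)"
      then have uc: "u \<in> carrier_vec n" by (simp add: C_def)
      have "u - v \<in> C w"
        using u v w mult_minus_distrib_mat_vec[OF e uc v] mult_add_distrib_mat_vec[OF e v w] e
        by (auto simp: C_def intro!: eq_vecI)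
      moreover have "u = v + (u - v)" using uc v by (auto intro!: eq_vecI)
      ultimately show "\<exists>a b. u = a + b \<and> a \<in> C v \<and> b \<in> C w" using Cself[OF v] by blast
    qed
    finally show ?thesis .
  qed
  have Nsmult: "c \<odot>\<^bsub>?N\<^esub> C v = C (c \<cdot>\<^sub>v v)" if v: "v \<in> carrier_vec n" for c v
  proof -
    have "c \<odot>\<^bsub>?N\<^esub> C v = (\<Union>w\<in>C v. D +>\<^bsub>?M\<^esub> (c \<odot>\<^bsub>?M\<^esub> w))"
      unfolding coinvariants_def Let_def span by simp
    also have "\<dots> = (\<Union>w\<in>C v. C (c \<cdot>\<^sub>v w))"
      by (intro SUP_cong refl) (auto simp: C_def[of v] Ccos)
    also have "\<dots> = C (c \<cdot>\<^sub>v v)"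
      by (rule UN[OF v], rule Ceq) (use v in \<open>auto simp: C_def mult_mat_vec[OF e]\<close>)
    finally show ?thesis .
  qed
  have Nact: "act ?N p (C v) = C (tauL p *\<^sub>v v)" if v: "v \<in> carrier_vec n" and p: "p \<in> carrier (triple L H G)" for p v
  proof -
    note tc = matrix_repsD(1)[OF tauL_rep p]
    obtain l h g where p': "p = (l, h, g)" by (metis surj_pair)
    have "act ?N p (C v) = (\<Union>w\<in>C v. D +>\<^bsub>?M\<^esub> (tauL p *\<^sub>v w))"
      unfolding coinvariants_def Let_def span p' by (simp add: tauL_def)
    also have "\<dots> = (\<Union>w\<in>C v. C (tauL p *\<^sub>v w))"
      by (intro SUP_cong refl Ccos) (use tc in simp)
    also have "\<dots> = C (tauL p *\<^sub>v v)"
    proof (rule UN[OF v], rule Ceq)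
      fix w assume w: "w \<in> C v"
      then have wc: "w \<in> carrier_vec n" by (simp add: C_def)
      have ez: "eK *\<^sub>v (tauL p *\<^sub>v z) = tauL p *\<^sub>v (eK *\<^sub>v z)" if z: "z \<in> carrier_vec n" for z
        using assoc_mult_mat_vec[OF e tc z] assoc_mult_mat_vec[OF tc e z] eK_tauL_commute[OF p] by simp
      show "eK *\<^sub>v (tauL p *\<^sub>v w) = eK *\<^sub>v (tauL p *\<^sub>v v)"
        unfolding ez[OF wc] ez[OF v] using w by (simp add: C_def)
    qed
    finally show ?thesis .
  qed
  define \<phi> where "\<phi> w = C (P *\<^sub>v w)" for w
  have Pc: "P *\<^sub>v w \<in> carrier_vec n" for w using P by simp
  have eP: "eK *\<^sub>v (P *\<^sub>v w) = P *\<^sub>v w" if w: "w \<in> carrier_vec r" for w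
  proof -
    have "eK * P = P * (Q * P)" unfolding PQ[symmetric] by (rule assoc_mult_mat[OF P Q P])
    then have "eK * P = P" using QP P by simp
    then show ?thesis using assoc_mult_mat_vec[OF e P w] by simp
  qed
  have "\<phi> \<in> gmodule_hom (triple L H G) ?V ?N"
    unfolding gmodule_hom_iff
  proof (intro conjI ballI allI)
    fix w assume "w \<in> carrier ?V"
    then have w: "w \<in> carrier_vec r" by simp
    show "\<phi> w \<in> carrier ?N" unfolding car \<phi>_def using Pc by blast
    show "\<phi> (c \<odot>\<^bsub>?V\<^esub> w) = c \<odot>\<^bsub>?N\<^esub> \<phi> w" for c
      unfolding \<phi>_def Nsmult[OF Pc] using mult_mat_vec[OF P w] by simp
    fix p assume p: "p \<in> carrier (triple L H G)"
    note tc = matrix_repsD(1)[OF tauL_rep p]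
    have "P *\<^sub>v ((Q * tauL p * P) *\<^sub>v w) = (P * (Q * tauL p * P)) *\<^sub>v w"
      by (rule assoc_mult_mat_vec[OF P mult_carrier_mat[OF mult_carrier_mat[OF Q tc] P] w, symmetric])
    also have "\<dots> = tauL p *\<^sub>v (P *\<^sub>v w)"
      unfolding comp(2)[OF _ p, simplified] by (rule assoc_mult_mat_vec[OF tc P w])
    finally show "\<phi> (act ?V p w) = act ?N p (\<phi> w)"
      unfolding \<phi>_def Nact[OF Pc p] by simp
  next
    fix w w' assume "w \<in> carrier ?V" "w' \<in> carrier ?V"
    then have w: "w \<in> carrier_vec r" "w' \<in> carrier_vec r" by auto
    show "\<phi> (w \<oplus>\<^bsub>?V\<^esub> w') = \<phi> w \<oplus>\<^bsub>?N\<^esub> \<phi> w'"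
      unfolding \<phi>_def Nadd[OF Pc Pc] using mult_add_distrib_mat_vec[OF P w] by simp
  qed
  moreover have "bij_betw \<phi> (carrier_vec r) (carrier ?N)"
    unfolding bij_betw_def
  proof
    show "inj_on \<phi> (carrier_vec r)"
    proof (rule inj_onI)
      fix w w' :: "'f vec" assume w: "w \<in> carrier_vec r" "w' \<in> carrier_vec r" and eq: "\<phi> w = \<phi> w'"
      have "P *\<^sub>v w \<in> C (P *\<^sub>v w')" using eq Cself[OF Pc, of w] unfolding \<phi>_def by simp
      then have "P *\<^sub>v w = P *\<^sub>v w'" using eP[OF w(1)] eP[OF w(2)] by (simp add: C_def)
      then have "Q *\<^sub>v (P *\<^sub>v w) = Q *\<^sub>v (P *\<^sub>v w')" by simp
      then show "w = w'"
        using assoc_mult_mat_vec[OF Q P w(1)] assoc_mult_mat_vec[OF Q P w(2)] QP w by simp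
    qed
    show "\<phi> ` carrier_vec r = carrier ?N"
    proof
      show "\<phi> ` carrier_vec r \<subseteq> carrier ?N" unfolding car \<phi>_def using Pc by blast
      show "carrier ?N \<subseteq> \<phi> ` carrier_vec r"
      proof
        fix X assume "X \<in> carrier ?N"
        then obtain v where v: "v \<in> carrier_vec n" "X = C v" unfolding car by blast
        have "P *\<^sub>v (Q *\<^sub>v v) = eK *\<^sub>v v" using assoc_mult_mat_vec[OF P Q v(1)] PQ by simp
        then have "C (P *\<^sub>v (Q *\<^sub>v v)) = C v"
          using assoc_mult_mat_vec[OF e e v(1)] ee by (intro Ceq) simp
        then have "X = \<phi> (Q *\<^sub>v v)" unfolding \<phi>_def v(2) by simp
        then show "X \<in> \<phi> ` carrier_vec r" using Q by auto
      qed
    qed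
  qed
  ultimately show ?thesis unfolding gmodule_iso_def by auto
qed

text \<open>
  The trace of \<open>Q (tauL p) P\<close> is that of \<open>(tauL p) eK\<close>, the average of
  the traces of \<open>(l, x, h, g)\<close> over \<open>x\<close>.
\<close>

lemma coinvariants_char:
  shows "matrix_form (triple L H G) (coinvariants G L K H (vec_gmodule (n, \<tau>))) \<in> matrix_reps (triple L H G)"
    and "l \<in> carrier L \<Longrightarrow> h \<in> carrier H \<Longrightarrow> g \<in> carrier G \<Longrightarrow>
      rep_char (matrix_form (triple L H G) (coinvariants G L K H (vec_gmodule (n, \<tau>)))) (l, h, g) = (\<Sum>x\<in>carrier K. mtrace (\<tau> (l, x, h, g))) / of_nat (card (carrier K))"
proof -
  let ?F = "matrix_form (triple L H G) (coinvariants G L K H (vec_gmodule (n, \<tau>)))"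
  interpret LHG: finite_group "triple L H G" by (rule finite_group_LHG)
  have ee: "eK * eK = eK" unfolding eK_def by (rule K.average_idempotent(3)[OF tauK_rep])
  obtain r P Q where PQ: "P \<in> carrier_mat n r" "Q \<in> carrier_mat r n" "Q * P = 1\<^sub>m r" "P * Q = eK"
    using idempotent_splits[OF eK_carrier ee] by metis
  have com: "P * Q * tauL p = tauL p * (P * Q)" if "p \<in> carrier (triple L H G)" for p
    using eK_tauL_commute[OF that] PQ by simp
  have R: "(r, \<lambda>p. Q * tauL p * P) \<in> matrix_reps (triple L H G)"
    by (rule LHG.compress(1)[OF tauL_rep PQ(1-3) com])
  note mf = matrix_form_char[OF R coinvariants_iso[OF PQ]]
  show "?F \<in> matrix_reps (triple L H G)" by (rule mf(1))
  assume lhg: "l \<in> carrier L" "h \<in> carrier H" "g \<in> carrier G"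
  then have p: "(l, h, g) \<in> carrier (triple L H G)" by (simp add: DirProd_simps)
  note tc = matrix_repsD(1)[OF tauL_rep p]
  have "rep_char ?F (l, h, g) = mtrace (Q * tauL (l, h, g) * P)" using mf(2)[OF p] by simp
  also have "\<dots> = mtrace (Q * (tauL (l, h, g) * P))"
    using assoc_mult_mat[OF PQ(2) tc PQ(1)] by simp
  also have "\<dots> = mtrace (tauL (l, h, g) * P * Q)"
    by (rule mtrace_comm[OF PQ(2) mult_carrier_mat[OF tc PQ(1)]])
  also have "tauL (l, h, g) * P * Q = tauL (l, h, g) * eK"
    using assoc_mult_mat[OF tc PQ(1,2)] PQ(4) by simp
  also have "\<dots> = avg_mat (carrier K) n n (\<lambda>x. \<tau> (l, x, h, g))" by (rule tauL_eK(1)[OF lhg])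
  also have "mtrace \<dots> = (\<Sum>x\<in>carrier K. mtrace (\<tau> (l, x, h, g))) / of_nat (card (carrier K))"
    by (rule mtrace_avg_mat) (use lhg in \<open>simp add: tau_carrier\<close>)
  finally show "rep_char ?F (l, h, g) = (\<Sum>x\<in>carrier K. mtrace (\<tau> (l, x, h, g))) / of_nat (card (carrier K))" .
qed

end

text \<open>
  The Kronecker product of matrices is multiplicative and turns traces into products; the
  coinvariants average over \<open>K\<close>.
\<close>

lemma rep_comp_char:
  fixes V :: "('f::field_char_0, 'l \<times> 'c \<times> 'g) matrix_rep" and W :: "('f, 'c \<times> 'h \<times> 'g) matrix_rep"
  assumes V: "V \<in> matrix_reps (triple L K G)" and W: "W \<in> matrix_reps (triple K H G)"
  shows "rep_comp G L K H V W \<in> matrix_reps (triple L H G)"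
    and "l \<in> carrier L \<Longrightarrow> h \<in> carrier H \<Longrightarrow> g \<in> carrier G \<Longrightarrow>
      rep_char (rep_comp G L K H V W) (l, h, g) =
        (\<Sum>x\<in>carrier K. rep_char V (l, x, g) * rep_char W (x, h, g)) / of_nat (card (carrier K))"
proof -
  obtain m \<rho> n \<sigma> where VW: "V = (m, \<rho>)" "W = (n, \<sigma>)" by (metis surj_pair)
  note V = V[unfolded VW] and W = W[unfolded VW]
  define \<tau> where "\<tau> = (\<lambda>(l, x, h, g). kronecker (\<rho> (l, x, g)) (\<sigma> (x, h, g)))"
  have Tdef: "tensor_rep V W = (m * n, \<tau>)" by (simp add: tensor_rep_def VW \<tau>_def)
  have vc: "\<rho> (l, x, g) \<in> carrier_mat m m" if "l \<in> carrier L" "x \<in> carrier K" "g \<in> carrier G" for l x g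
    using matrix_repsD(1)[OF V] that by (simp add: DirProd_simps)
  have wc: "\<sigma> (x, h, g) \<in> carrier_mat n n" if "x \<in> carrier K" "h \<in> carrier H" "g \<in> carrier G" for x h g
    using matrix_repsD(1)[OF W] that by (simp add: DirProd_simps)
  have T1: "\<tau> (l, x, h, g) \<in> carrier_mat (m * n) (m * n)"
    if "l \<in> carrier L" "x \<in> carrier K" "h \<in> carrier H" "g \<in> carrier G" for l x h g
    using that unfolding \<tau>_def by (simp add: vc wc)
  have T2: "\<tau> (\<one>\<^bsub>L\<^esub>, \<one>\<^bsub>K\<^esub>, \<one>\<^bsub>H\<^esub>, \<one>\<^bsub>G\<^esub>) = 1\<^sub>m (m * n)"
    using matrix_repsD(2)[OF V] matrix_repsD(2)[OF W] by (simp add: \<tau>_def DirProd_simps kronecker_one)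
  have T3: "\<tau> (l \<otimes>\<^bsub>L\<^esub> l', x \<otimes>\<^bsub>K\<^esub> x', h \<otimes>\<^bsub>H\<^esub> h', g \<otimes>\<^bsub>G\<^esub> g') = \<tau> (l, x, h, g) * \<tau> (l', x', h', g')"
    if a: "l \<in> carrier L" "x \<in> carrier K" "h \<in> carrier H" "g \<in> carrier G"
      "l' \<in> carrier L" "x' \<in> carrier K" "h' \<in> carrier H" "g' \<in> carrier G" for l x h g l' x' h' g'
  proof -
    have "\<rho> (l \<otimes>\<^bsub>L\<^esub> l', x \<otimes>\<^bsub>K\<^esub> x', g \<otimes>\<^bsub>G\<^esub> g') = \<rho> (l, x, g) * \<rho> (l', x', g')"
      using matrix_repsD(3)[OF V, of "(l, x, g)" "(l', x', g')"] a by (simp add: DirProd_simps)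
    moreover have "\<sigma> (x \<otimes>\<^bsub>K\<^esub> x', h \<otimes>\<^bsub>H\<^esub> h', g \<otimes>\<^bsub>G\<^esub> g') = \<sigma> (x, h, g) * \<sigma> (x', h', g')"
      using matrix_repsD(3)[OF W, of "(x, h, g)" "(x', h', g')"] a by (simp add: DirProd_simps)
    ultimately show ?thesis
      using kronecker_mult[OF vc[of l x g] wc[of x h g] vc[of l' x' g'] wc[of x' h' g']] a by (simp add: \<tau>_def)
  qed
  have T: "(m * n, \<tau>) \<in> matrix_reps (L \<times>\<times> K \<times>\<times> H \<times>\<times> G)"
    unfolding matrix_reps_def using T1 T2 T3 by (auto simp: DirProd_simps)
  show "rep_comp G L K H V W \<in> matrix_reps (triple L H G)"
    unfolding rep_comp_def Tdef by (rule coinvariants_char(1)[OF T])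
  assume lhg: "l \<in> carrier L" "h \<in> carrier H" "g \<in> carrier G"
  have "rep_char (rep_comp G L K H V W) (l, h, g) =
      (\<Sum>x\<in>carrier K. mtrace (\<tau> (l, x, h, g))) / of_nat (card (carrier K))"
    unfolding rep_comp_def Tdef by (rule coinvariants_char(2)[OF T lhg])
  also have "(\<Sum>x\<in>carrier K. mtrace (\<tau> (l, x, h, g))) = (\<Sum>x\<in>carrier K. rep_char V (l, x, g) * rep_char W (x, h, g))"
    using lhg by (intro sum.cong refl) (simp add: \<tau>_def VW mtrace_kronecker[OF vc wc])
  finally show "rep_char (rep_comp G L K H V W) (l, h, g) =
        (\<Sum>x\<in>carrier K. rep_char V (l, x, g) * rep_char W (x, h, g)) / of_nat (card (carrier K))" .
qed

end

section \<open>The character of the group algebra\<close>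

lemma lookup_sum_single:
  "Poly_Mapping.lookup (\<Sum>i\<in>I. Poly_Mapping.single (f i) (c i)) y = (\<Sum>i\<in>I. if f i = y then c i else 0)"
  by (simp add: lookup_sum lookup_single when_def)

context finite_group begin

text \<open>
  In an enumeration of the group the action is by permutation matrices, whose trace counts the
  fixed points of \<open>z \<mapsto> a z b\<inverse>\<close>.
\<close>

lemma group_algebra_char:
  fixes X :: "'x monoid"
  assumes X: "group X"
  defines "M \<equiv> group_algebra_bimodule G :: ('f::field_char_0, 'a \<Rightarrow>\<^sub>0 'f, 'a \<times> 'a \<times> 'x) gmodule"
  shows "matrix_form (triple G G X) M \<in> matrix_reps (triple G G X)"
    and "\<lbrakk>a \<in> carrier G; b \<in> carrier G; x \<in> carrier X\<rbrakk> \<Longrightarrow>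
      rep_char (matrix_form (triple G G X) M) (a, b, x) = of_nat (card {z \<in> carrier G. a \<otimes> z \<otimes> inv b = z})"
proof -
  define n where "n = card (carrier G)"
  obtain en where en: "bij_betw en {..<n} (carrier G)"
    using ex_bij_betw_nat_finite[OF finite_carrier] unfolding n_def atLeast0LessThan by blast
  have enc: "en i \<in> carrier G" if "i < n" for i using en that unfolding bij_betw_def by auto
  have eni: "en i = en j \<longleftrightarrow> i = j" if "i < n" "j < n" for i j
    using en that unfolding bij_betw_def inj_on_def by auto
  have ens: "\<exists>i<n. z = en i" if "z \<in> carrier G" for z
    using en that unfolding bij_betw_def by auto
  define \<rho> where "\<rho> = (\<lambda>(a, b, x :: 'x). mat n n (\<lambda>(i, j). if en i = a \<otimes> en j \<otimes> inv b then 1 else (0 :: 'f)))"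
  have rc: "\<rho> p \<in> carrier_mat n n" for p by (auto simp: \<rho>_def split: prod.splits)
  have rd: "dim_row (\<rho> p) = n" "dim_col (\<rho> p) = n" for p
    using carrier_matD[OF rc[of p]] by simp_all
  have mult: "\<rho> (a \<otimes> a', b \<otimes> b', x \<otimes>\<^bsub>X\<^esub> x') = \<rho> (a, b, x) * \<rho> (a', b', x')"
    if c: "a \<in> carrier G" "b \<in> carrier G" "a' \<in> carrier G" "b' \<in> carrier G" for a b x a' b' x'
  proof (rule eq_matI)
    fix i j assume "i < dim_row (\<rho> (a, b, x) * \<rho> (a', b', x'))" "j < dim_col (\<rho> (a, b, x) * \<rho> (a', b', x'))"
    then have ij: "i < n" "j < n" by (simp_all add: rd)
    obtain k where k: "k < n" "a' \<otimes> en j \<otimes> inv b' = en k" using ens c enc[OF ij(2)] by (metis inv_closed m_closed)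
    have "(\<rho> (a, b, x) * \<rho> (a', b', x')) $$ (i, j) =
        (\<Sum>l = 0..<n. (if en i = a \<otimes> en l \<otimes> inv b then 1 else 0) * (if en l = en k then 1 else 0))"
      using ij k by (simp add: \<rho>_def scalar_prod_def)
    also have "\<dots> = (\<Sum>l = 0..<n. (if en i = a \<otimes> en l \<otimes> inv b then 1 else 0) * (if l = k then 1 else 0))"
      using k eni by (intro sum.cong) auto
    also have "\<dots> = (if en i = a \<otimes> en k \<otimes> inv b then 1 else 0)"
      using k by (simp add: sum_mat_delta)
    also have "a \<otimes> en k \<otimes> inv b = (a \<otimes> a') \<otimes> en j \<otimes> inv (b \<otimes> b')"
      using c enc[OF ij(2)] unfolding k(2)[symmetric] by (simp add: m_assoc inv_mult_group)
    finally show "\<rho> (a \<otimes> a', b \<otimes> b', x \<otimes>\<^bsub>X\<^esub> x') $$ (i, j) = (\<rho> (a, b, x) * \<rho> (a', b', x')) $$ (i, j)"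
      using ij by (simp add: \<rho>_def)
  qed (simp_all add: rd)
  have one: "\<rho> (\<one>, \<one>, \<one>\<^bsub>X\<^esub>) = 1\<^sub>m n"
    by (rule eq_matI) (auto simp: \<rho>_def enc eni)
  have R: "(n, \<rho>) \<in> matrix_reps (triple G G X)"
    unfolding matrix_reps_def using rc mult one by (auto simp: DirProd_simps)
  define \<phi> :: "'f vec \<Rightarrow> 'a \<Rightarrow>\<^sub>0 'f" where "\<phi> v = (\<Sum>i<n. Poly_Mapping.single (en i) (v $ i))" for v
  have lk: "Poly_Mapping.lookup (\<phi> v) y = (\<Sum>i<n. if en i = y then v $ i else 0)" for v y
    unfolding \<phi>_def by (rule lookup_sum_single)
  have lk_en: "Poly_Mapping.lookup (\<phi> v) (en j) = v $ j" if j: "j < n" for v j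
  proof -
    have "Poly_Mapping.lookup (\<phi> v) (en j) = (\<Sum>i<n. if i = j then v $ i else 0)"
      unfolding lk using j eni by (intro sum.cong) auto
    then show ?thesis using j by simp
  qed
  have lk_out: "Poly_Mapping.lookup (\<phi> v) y = 0" if "y \<notin> carrier G" for v y
    unfolding lk using that enc by (intro sum.neutral) auto
  have keys: "Poly_Mapping.keys (\<phi> v) \<subseteq> carrier G" for v
    using lk_out by (auto simp: in_keys_iff)
  have ext: "p = q" if "\<And>i. i < n \<Longrightarrow> Poly_Mapping.lookup p (en i) = Poly_Mapping.lookup q (en i)"
    "Poly_Mapping.keys p \<subseteq> carrier G" "Poly_Mapping.keys q \<subseteq> carrier G" for p q :: "'a \<Rightarrow>\<^sub>0 'f"
  proof (rule poly_mapping_eqI)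
    fix y show "Poly_Mapping.lookup p y = Poly_Mapping.lookup q y"
    proof (cases "y \<in> carrier G")
      case True
      then show ?thesis using ens that(1) by metis
    next
      case False
      then show ?thesis using that(2,3) by (metis in_keys_iff subsetD)
    qed
  qed
  have Mc: "carrier M = {v. Poly_Mapping.keys v \<subseteq> carrier G}" "ring.add M = (+)"
    "module.smult M = (\<lambda>c. Poly_Mapping.map ((*) c))"
    by (simp_all add: M_def group_algebra_bimodule_def)
  have Mact: "act M (a, b, x) v = (\<Sum>z\<in>carrier G. Poly_Mapping.single (a \<otimes> z \<otimes> inv b) (Poly_Mapping.lookup v z))"
    if "Poly_Mapping.keys v \<subseteq> carrier G" for a b x v
    unfolding M_def group_algebra_bimodule_def using that
    by (simp, intro sum.mono_neutral_left finite_carrier) (auto simp: in_keys_iff)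
  have "\<phi> \<in> gmodule_hom (triple G G X) (vec_gmodule (n, \<rho>)) M"
    unfolding gmodule_hom_iff
  proof (intro conjI ballI allI)
    fix v assume "v \<in> carrier (vec_gmodule (n, \<rho>))"
    then have v: "v \<in> carrier_vec n" by simp
    show "\<phi> v \<in> carrier M" using keys Mc by simp
    show "\<phi> (c \<odot>\<^bsub>vec_gmodule (n, \<rho>)\<^esub> v) = c \<odot>\<^bsub>M\<^esub> \<phi> v" for c
    proof (rule poly_mapping_eqI)
      fix y
      have "Poly_Mapping.lookup (\<phi> (c \<cdot>\<^sub>v v)) y = c * Poly_Mapping.lookup (\<phi> v) y"
        unfolding lk sum_distrib_left using v by (intro sum.cong) auto
      then show "Poly_Mapping.lookup (\<phi> (c \<odot>\<^bsub>vec_gmodule (n, \<rho>)\<^esub> v)) y = Poly_Mapping.lookup (c \<odot>\<^bsub>M\<^esub> \<phi> v) y"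
        by (simp add: Mc map.rep_eq when_def)
    qed
    fix p assume "p \<in> carrier (triple G G X)"
    then obtain a b x where p: "p = (a, b, x)" "a \<in> carrier G" "b \<in> carrier G" by (auto simp: DirProd_simps)
    have am: "act M p (\<phi> v) = (\<Sum>j<n. Poly_Mapping.single (a \<otimes> en j \<otimes> inv b) (v $ j))"
    proof -
      have "act M p (\<phi> v) = (\<Sum>z\<in>carrier G. Poly_Mapping.single (a \<otimes> z \<otimes> inv b) (Poly_Mapping.lookup (\<phi> v) z))"
        unfolding p by (rule Mact[OF keys])
      also have "\<dots> = (\<Sum>j<n. Poly_Mapping.single (a \<otimes> en j \<otimes> inv b) (Poly_Mapping.lookup (\<phi> v) (en j)))"
        by (rule sum.reindex_bij_betw[OF en, symmetric])
      finally show ?thesis by (simp add: lk_en)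
    qed
    show "\<phi> (act (vec_gmodule (n, \<rho>)) p v) = act M p (\<phi> v)"
    proof (rule ext[OF _ keys])
      fix i assume i: "i < n"
      have "Poly_Mapping.lookup (act M p (\<phi> v)) (en i) = (\<Sum>j<n. if a \<otimes> en j \<otimes> inv b = en i then v $ j else 0)"
        unfolding am by (rule lookup_sum_single)
      also have "\<dots> = (\<rho> p *\<^sub>v v) $ i"
        using i v by (auto simp: \<rho>_def p scalar_prod_def lessThan_atLeast0 intro!: sum.cong)
      finally show "Poly_Mapping.lookup (\<phi> (act (vec_gmodule (n, \<rho>)) p v)) (en i) = Poly_Mapping.lookup (act M p (\<phi> v)) (en i)"
        using lk_en[OF i] by simp
    next
      show "Poly_Mapping.keys (act M p (\<phi> v)) \<subseteq> carrier G"
      proof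
        fix y assume "y \<in> Poly_Mapping.keys (act M p (\<phi> v))"
        then have "(\<Sum>j<n. if a \<otimes> en j \<otimes> inv b = y then v $ j else 0) \<noteq> 0"
          unfolding am in_keys_iff lookup_sum_single .
        then obtain j where j: "j \<in> {..<n}" "(if a \<otimes> en j \<otimes> inv b = y then v $ j else 0) \<noteq> 0"
          by (rule sum.not_neutral_contains_not_neutral)
        then have "y = a \<otimes> en j \<otimes> inv b" by (metis (full_types))
        then show "y \<in> carrier G" using enc[of j] j(1) p(2,3) by simp
      qed
    qed
  next
    fix v w assume "v \<in> carrier (vec_gmodule (n, \<rho>))" "w \<in> carrier (vec_gmodule (n, \<rho>))"
    then show "\<phi> (v \<oplus>\<^bsub>vec_gmodule (n, \<rho>)\<^esub> w) = \<phi> v \<oplus>\<^bsub>M\<^esub> \<phi> w"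
      by (auto simp: Mc \<phi>_def single_add sum.distrib)
  qed
  moreover have "bij_betw \<phi> (carrier_vec n) (carrier M)"
    unfolding bij_betw_def
  proof
    show "inj_on \<phi> (carrier_vec n)"
      by (rule inj_onI, rule eq_vecI) (auto, metis lk_en)
    show "\<phi> ` carrier_vec n = carrier M"
    proof
      show "\<phi> ` carrier_vec n \<subseteq> carrier M" using keys Mc by auto
      show "carrier M \<subseteq> \<phi> ` carrier_vec n"
      proof
        fix p assume "p \<in> carrier M"
        then have p: "Poly_Mapping.keys p \<subseteq> carrier G" using Mc by simp
        have "p = \<phi> (vec n (\<lambda>i. Poly_Mapping.lookup p (en i)))"
          by (rule ext[OF _ p keys]) (simp add: lk_en)
        then show "p \<in> \<phi> ` carrier_vec n" by (metis image_eqI vec_carrier)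
      qed
    qed
  qed
  ultimately have iso: "gmodule_iso (triple G G X) (vec_gmodule (n, \<rho>)) M"
    unfolding gmodule_iso_def by auto
  note mf = matrix_form_char[OF R iso]
  show "matrix_form (triple G G X) M \<in> matrix_reps (triple G G X)" by (rule mf(1))
  assume abx: "a \<in> carrier G" "b \<in> carrier G" "x \<in> carrier X"
  then have "rep_char (matrix_form (triple G G X) M) (a, b, x) = mtrace (\<rho> (a, b, x))"
    using mf(2)[of "(a, b, x)"] by (simp add: DirProd_simps)
  also have "\<dots> = (\<Sum>i<n. if a \<otimes> en i \<otimes> inv b = en i then 1 else 0)"
    by (auto simp: mtrace_def \<rho>_def intro!: sum.cong)
  also have "\<dots> = (\<Sum>z\<in>carrier G. if a \<otimes> z \<otimes> inv b = z then 1 else 0)"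
    by (rule sum.reindex_bij_betw[OF en])
  also have "\<dots> = of_nat (card {z \<in> carrier G. a \<otimes> z \<otimes> inv b = z})"
    using finite_carrier by (simp add: sum.If_cases Int_def)
  finally show "rep_char (matrix_form (triple G G X) M) (a, b, x) = of_nat (card {z \<in> carrier G. a \<otimes> z \<otimes> inv b = z})" .
qed

end

section \<open>Composition on Grothendieck groups\<close>

text \<open>
  The choice of a representative does not matter on the group: by \<open>grel_char\<close> all
  of them have the same character there.
\<close>

definition class_char :: "('f::field, 'g) grothendieck \<Rightarrow> 'g \<Rightarrow> 'f" where
  "class_char r = frag_char (SOME x. x \<in> r)"

lemma grothendieck_class_char:
  assumes x: "virtual_rep G x" and g: "g \<in> carrier G"
  shows "class_char (grothendieck_class G x) g = frag_char x g"
proof -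
  interpret presentation "matrix_reps G" "grothendieck_relations G" by (rule grothendieck_presentation)
  define y where "y = (SOME y. y \<in> grothendieck_class G x)"
  have "y \<in> grothendieck_class G x"
    unfolding y_def by (rule someI[of _ x]) (simp add: grothendieck_class_def self_mem_cls[OF x])
  then have "y - x \<in> grel G" using mem_cls_iff[OF x] by (simp add: grothendieck_class_def)
  then show ?thesis using grel_char[OF _ g, of "y - x"] by (simp add: class_char_def y_def)
qed

lemma grothendieck_carrier:
  "carrier (RG TYPE('f::field) G) =
    {grothendieck_class G x | x :: ('f, 'g) matrix_rep \<Rightarrow>\<^sub>0 int. virtual_rep G x}"
  unfolding grothendieck_group_def grothendieck_class_def
  by (rule presentation.carrier_presented[OF grothendieck_presentation])

lemma grothendieck_comm_group: "comm_group (RG TYPE('f::field) G)"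
  unfolding grothendieck_group_def by (rule presentation.presented_comm_group[OF grothendieck_presentation])

lemma grothendieck_carrierE:
  assumes "r \<in> carrier (RG TYPE('f::field) G)"
  obtains x :: "('f::field, 'g) matrix_rep \<Rightarrow>\<^sub>0 int" where "virtual_rep G x" "r = grothendieck_class G x"
  using assms unfolding grothendieck_carrier by blast

lemma class_char_mult:
  assumes r: "r \<in> carrier (RG TYPE('f::field) G)" and s: "s \<in> carrier (RG TYPE('f::field) G)"
    and g: "g \<in> carrier G"
  shows "class_char (r \<otimes>\<^bsub>RG TYPE('f::field) G\<^esub> s) g = class_char r g + class_char s g"
proof -
  obtain x where x: "virtual_rep G x" "r = grothendieck_class G x" using r by (rule grothendieck_carrierE)
  obtain y where y: "virtual_rep G y" "s = grothendieck_class G y" using s by (rule grothendieck_carrierE)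
  have "r \<otimes>\<^bsub>RG TYPE('f) G\<^esub> s = grothendieck_class G (x + y)"
    unfolding x y grothendieck_group_def grothendieck_class_def
    by (rule presentation.presented_mult[OF grothendieck_presentation x(1) y(1)])
  then show ?thesis
    using grothendieck_class_char[OF x(1) g] grothendieck_class_char[OF y(1) g]
      grothendieck_class_char[OF frag_keys_add[OF x(1) y(1)] g] x y by simp
qed

lemma frag_char_extend:
  assumes "Poly_Mapping.keys x \<subseteq> S" "\<And>V. V \<in> S \<Longrightarrow> frag_char (F V) g = h (rep_char V g')"
    and h: "h 0 = 0" "\<And>a b. h (a - b) = h a - h b"
  shows "frag_char (frag_extend F x) g = h (frag_char x g')"
  using assms(1)
  by (induction x rule: frag_induction) (auto simp: assms frag_extend_diff)

text \<open>
  The laws for composition below are proved by comparing characters.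
\<close>

lemma (in finite_group) class_char_inject:
  assumes r: "r \<in> carrier (RG TYPE('f::field_char_0) G)"
    and s: "s \<in> carrier (RG TYPE('f::field_char_0) G)"
    and eq: "\<And>g. g \<in> carrier G \<Longrightarrow> class_char r g = class_char s g"
  shows "r = s"
proof -
  obtain x where x: "virtual_rep G x" "r = grothendieck_class G x" using r by (rule grothendieck_carrierE)
  obtain y where y: "virtual_rep G y" "s = grothendieck_class G y" using s by (rule grothendieck_carrierE)
  show ?thesis
    using eq unfolding x(2) y(2) grothendieck_class_eq_iff[OF x(1) y(1)]
    by (simp add: grothendieck_class_char x(1) y(1))
qed

lemma class_char_triple_eqI:
  assumes "finite_group A" "finite_group B" "finite_group C"
    and "r \<in> carrier (RG TYPE('f::field_char_0) (triple A B C))"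
    and "s \<in> carrier (RG TYPE('f::field_char_0) (triple A B C))"
    and "\<And>a b c. a \<in> carrier A \<Longrightarrow> b \<in> carrier B \<Longrightarrow> c \<in> carrier C \<Longrightarrow>
      class_char r (a, b, c) = class_char s (a, b, c)"
  shows "r = s"
  by (rule finite_group.class_char_inject[OF finite_group_DirProd[OF assms(1) finite_group_DirProd[OF assms(2,3)]] assms(4,5)])
    (use assms(6) in \<open>auto simp: DirProd_simps\<close>)

lemma class_char_triple_mult:
  assumes "r \<in> carrier (RG TYPE('f::field) (triple A B C))" "s \<in> carrier (RG TYPE('f::field) (triple A B C))"
    and "a \<in> carrier A" "b \<in> carrier B" "c \<in> carrier C"
  shows "class_char (r \<otimes>\<^bsub>RG TYPE('f::field) (triple A B C)\<^esub> s) (a, b, c) = class_char r (a, b, c) + class_char s (a, b, c)"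
  using assms by (intro class_char_mult) (simp_all add: DirProd_simps)

text \<open>
  Characters are class functions, as \<open>\<rho> (h g h\<inverse>)\<close> is a conjugate
  matrix.
\<close>

lemma (in finite_group) class_char_conj:
  assumes r: "r \<in> carrier (RG TYPE('f::field_char_0) G)" and g: "g \<in> carrier G" and h: "h \<in> carrier G"
  shows "class_char r (h \<otimes> g \<otimes> inv h) = class_char r g"
proof -
  have rep: "rep_char V (h \<otimes> g \<otimes> inv h) = rep_char V g" if V: "V \<in> matrix_reps G" for V :: "('f, 'a) matrix_rep"
  proof -
    obtain n \<rho> where "V = (n, \<rho>)" by (metis surj_pair)
    note V' = V[unfolded this] and [simp] = this
    note c = matrix_repsD(1)[OF V'] and m = matrix_repsD(3)[OF V']
    have "\<rho> (h \<otimes> g \<otimes> inv h) = (\<rho> h * \<rho> g) * \<rho> (inv h)" using g h by (simp add: m)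
    also have "mtrace \<dots> = mtrace (\<rho> (inv h) * (\<rho> h * \<rho> g))"
      by (rule mtrace_comm[OF mult_carrier_mat[OF c[OF h] c[OF g]] c[OF inv_closed[OF h]]])
    also have "\<rho> (inv h) * (\<rho> h * \<rho> g) = \<rho> (inv h \<otimes> (h \<otimes> g))" using g h by (simp add: m)
    also have "inv h \<otimes> (h \<otimes> g) = g" using g h by (simp add: m_assoc[symmetric])
    finally show ?thesis by simp
  qed
  obtain x where x: "virtual_rep G x" "r = grothendieck_class G x" using r by (rule grothendieck_carrierE)
  have "frag_char x (h \<otimes> g \<otimes> inv h) = frag_char x g"
    unfolding frag_char_def using rep x(1) by (intro sum.cong) auto
  then show ?thesis using g h by (simp add: x grothendieck_class_char)
qed

context four_groups begin

lemma frag_char_comp: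
  fixes x :: "('f::field_char_0, 'l \<times> 'c \<times> 'g) matrix_rep \<Rightarrow>\<^sub>0 int" and y :: "('f, 'c \<times> 'h \<times> 'g) matrix_rep \<Rightarrow>\<^sub>0 int"
  assumes x: "virtual_rep (triple L K G) x" and y: "virtual_rep (triple K H G) y"
    and lhg: "l \<in> carrier L" "h \<in> carrier H" "g \<in> carrier G"
  shows "frag_char (frag_biextend (\<lambda>V W. frag_of (rep_comp G L K H V W)) x y) (l, h, g) =
    (\<Sum>k\<in>carrier K. frag_char x (l, k, g) * frag_char y (k, h, g)) / of_nat (card (carrier K))"
  using x
proof (induction x rule: frag_induction)
  case (one V)
  show ?case using y
  proof (induction y rule: frag_induction)
    case (one W)
    then show ?case using rep_comp_char(2)[OF \<open>V \<in> _\<close> one lhg] by simp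
  qed (auto simp: frag_extend_diff algebra_simps sum_subtractf diff_divide_distrib)
qed (auto simp: frag_biextend_diff_left algebra_simps sum_subtractf diff_divide_distrib)

text \<open>
  The composite of two virtual representations depends only on their characters, so the union
  over all representatives in \<^const>\<open>grothendieck_comp\<close> is a union of copies of
  one class.
\<close>

lemma grothendieck_comp_class:
  fixes x :: "('f::field_char_0, 'l \<times> 'c \<times> 'g) matrix_rep \<Rightarrow>\<^sub>0 int" and y :: "('f, 'c \<times> 'h \<times> 'g) matrix_rep \<Rightarrow>\<^sub>0 int"
  assumes x: "virtual_rep (triple L K G) x" and y: "virtual_rep (triple K H G) y"
  shows "grothendieck_comp G L K H (grothendieck_class (triple L K G) x) (grothendieck_class (triple K H G) y) =
    grothendieck_class (triple L H G) (frag_biextend (\<lambda>V W. frag_of (rep_comp G L K H V W)) x y)"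
    (is "_ = ?F x y")
    and "virtual_rep (triple L H G) (frag_biextend (\<lambda>V W. frag_of (rep_comp G L K H V W)) x y)"
proof -
  have keys: "virtual_rep (triple L H G) (frag_biextend (\<lambda>V W. frag_of (rep_comp G L K H V W)) x y)"
    if "virtual_rep (triple L K G) x" "virtual_rep (triple K H G) y"
    for x :: "('f, 'l \<times> 'c \<times> 'g) matrix_rep \<Rightarrow>\<^sub>0 int" and y
    by (rule frag_biextend_keys[OF that]) (simp add: rep_comp_char(1))
  show "virtual_rep (triple L H G) (frag_biextend (\<lambda>V W. frag_of (rep_comp G L K H V W)) x y)"
    by (rule keys[OF x y])
  interpret LHG: finite_group "triple L H G" by (rule finite_group_LHG)
  interpret X: presentation "matrix_reps (triple L K G) :: ('f, 'l \<times> 'c \<times> 'g) matrix_rep set" "grothendieck_relations (triple L K G)"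
    by (rule grothendieck_presentation)
  interpret Y: presentation "matrix_reps (triple K H G) :: ('f, 'c \<times> 'h \<times> 'g) matrix_rep set" "grothendieck_relations (triple K H G)"
    by (rule grothendieck_presentation)
  have eq: "?F x' y' = ?F x y"
    if "x' \<in> grothendieck_class (triple L K G) x" "y' \<in> grothendieck_class (triple K H G) y" for x' y'
  proof -
    note that = that[unfolded grothendieck_class_def]
    note x' = X.mem_cls_keys[OF x that(1)] and y' = Y.mem_cls_keys[OF y that(2)]
    have xx: "x' - x \<in> grel (triple L K G)" and yy: "y' - y \<in> grel (triple K H G)"
      using X.mem_cls_iff[OF x] Y.mem_cls_iff[OF y] that by auto
    show ?thesis
      unfolding LHG.grothendieck_class_eq_iff[OF keys[OF x' y'] keys[OF x y]]
    proof
      fix p assume "p \<in> carrier (triple L H G)"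
      then obtain l h g where p: "p = (l, h, g)" and lhg: "l \<in> carrier L" "h \<in> carrier H" "g \<in> carrier G"
        by (auto simp: DirProd_simps)
      have "frag_char x' (l, k, g) = frag_char x (l, k, g)" "frag_char y' (k, h, g) = frag_char y (k, h, g)"
        if "k \<in> carrier K" for k
        using grel_char[OF xx, of "(l, k, g)"] grel_char[OF yy, of "(k, h, g)"] lhg that by (simp_all add: DirProd_simps)
      then show "frag_char (frag_biextend (\<lambda>V W. frag_of (rep_comp G L K H V W)) x' y') p =
        frag_char (frag_biextend (\<lambda>V W. frag_of (rep_comp G L K H V W)) x y) p"
        unfolding p frag_char_comp[OF x' y' lhg] frag_char_comp[OF x y lhg] by simp
    qed
  qed
  have "x \<in> grothendieck_class (triple L K G) x" "y \<in> grothendieck_class (triple K H G) y"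
    using X.self_mem_cls[OF x] Y.self_mem_cls[OF y] by (simp_all add: grothendieck_class_def)
  then show "grothendieck_comp G L K H (grothendieck_class (triple L K G) x) (grothendieck_class (triple K H G) y) = ?F x y"
    unfolding grothendieck_comp_def using eq by blast
qed

lemma grothendieck_comp_closed:
  assumes r: "r \<in> carrier (RG TYPE('f::field_char_0) (triple L K G))"
    and s: "s \<in> carrier (RG TYPE('f::field_char_0) (triple K H G))"
  shows "grothendieck_comp G L K H r s \<in> carrier (RG TYPE('f::field_char_0) (triple L H G))"
proof -
  obtain x where x: "virtual_rep (triple L K G) x" "r = grothendieck_class (triple L K G) x"
    using r by (rule grothendieck_carrierE)
  obtain y where y: "virtual_rep (triple K H G) y" "s = grothendieck_class (triple K H G) y"
    using s by (rule grothendieck_carrierE)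
  show ?thesis
    unfolding x(2) y(2) grothendieck_comp_class(1)[OF x(1) y(1)] grothendieck_carrier
    using grothendieck_comp_class(2)[OF x(1) y(1)] by blast
qed

lemma class_char_comp:
  assumes r: "r \<in> carrier (RG TYPE('f::field_char_0) (triple L K G))"
    and s: "s \<in> carrier (RG TYPE('f::field_char_0) (triple K H G))"
    and lhg: "l \<in> carrier L" "h \<in> carrier H" "g \<in> carrier G"
  shows "class_char (grothendieck_comp G L K H r s) (l, h, g) =
    (\<Sum>k\<in>carrier K. class_char r (l, k, g) * class_char s (k, h, g)) / of_nat (card (carrier K))"
proof -
  obtain x where x: "virtual_rep (triple L K G) x" "r = grothendieck_class (triple L K G) x"
    using r by (rule grothendieck_carrierE)
  obtain y where y: "virtual_rep (triple K H G) y" "s = grothendieck_class (triple K H G) y"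
    using s by (rule grothendieck_carrierE)
  have "class_char (grothendieck_comp G L K H r s) (l, h, g) =
      frag_char (frag_biextend (\<lambda>V W. frag_of (rep_comp G L K H V W)) x y) (l, h, g)"
    unfolding x(2) y(2) grothendieck_comp_class(1)[OF x(1) y(1)]
    by (rule grothendieck_class_char[OF grothendieck_comp_class(2)[OF x(1) y(1)]]) (use lhg in \<open>simp add: DirProd_simps\<close>)
  also have "\<dots> = (\<Sum>k\<in>carrier K. frag_char x (l, k, g) * frag_char y (k, h, g)) / of_nat (card (carrier K))"
    by (rule frag_char_comp[OF x(1) y(1) lhg])
  also have "\<dots> = (\<Sum>k\<in>carrier K. class_char r (l, k, g) * class_char s (k, h, g)) / of_nat (card (carrier K))"
    unfolding x(2) y(2) using lhg
    by (intro arg_cong2[where f = "(/)"] sum.cong refl) (simp add: grothendieck_class_char x(1) y(1) DirProd_simps)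
  finally show ?thesis .
qed

lemma grothendieck_comp_mult_left:
  assumes r: "r \<in> carrier (RG TYPE('f::field_char_0) (triple L K G))"
    and r': "r' \<in> carrier (RG TYPE('f::field_char_0) (triple L K G))"
    and s: "s \<in> carrier (RG TYPE('f::field_char_0) (triple K H G))"
  shows "grothendieck_comp G L K H (r \<otimes>\<^bsub>RG TYPE('f::field_char_0) (triple L K G)\<^esub> r') s =
    grothendieck_comp G L K H r s \<otimes>\<^bsub>RG TYPE('f::field_char_0) (triple L H G)\<^esub> grothendieck_comp G L K H r' s"
    (is "?lhs = ?rhs")
proof -
  interpret A: comm_group "RG TYPE('f) (triple L K G)" by (rule grothendieck_comm_group)
  interpret B: comm_group "RG TYPE('f) (triple L H G)" by (rule grothendieck_comm_group)
  note rr = A.m_closed[OF r r'] and cl = grothendieck_comp_closed[OF r s] grothendieck_comp_closed[OF r' s]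
  show ?thesis
  proof (rule class_char_triple_eqI[OF factors grothendieck_comp_closed[OF rr s] B.m_closed[OF cl]])
    fix l h g assume lhg: "l \<in> carrier L" "h \<in> carrier H" "g \<in> carrier G"
    then show "class_char ?lhs (l, h, g) = class_char ?rhs (l, h, g)"
      by (simp add: class_char_triple_mult[OF cl] class_char_comp[OF r s] class_char_comp[OF r' s]
          class_char_comp[OF rr s] class_char_triple_mult[OF r r'] distrib_right sum.distrib add_divide_distrib)
  qed
qed

lemma grothendieck_comp_mult_right:
  assumes r: "r \<in> carrier (RG TYPE('f::field_char_0) (triple L K G))"
    and s: "s \<in> carrier (RG TYPE('f::field_char_0) (triple K H G))"
    and s': "s' \<in> carrier (RG TYPE('f::field_char_0) (triple K H G))"
  shows "grothendieck_comp G L K H r (s \<otimes>\<^bsub>RG TYPE('f::field_char_0) (triple K H G)\<^esub> s') =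
    grothendieck_comp G L K H r s \<otimes>\<^bsub>RG TYPE('f::field_char_0) (triple L H G)\<^esub> grothendieck_comp G L K H r s'"
    (is "?lhs = ?rhs")
proof -
  interpret A: comm_group "RG TYPE('f) (triple K H G)" by (rule grothendieck_comm_group)
  interpret B: comm_group "RG TYPE('f) (triple L H G)" by (rule grothendieck_comm_group)
  note ss = A.m_closed[OF s s'] and cl = grothendieck_comp_closed[OF r s] grothendieck_comp_closed[OF r s']
  show ?thesis
  proof (rule class_char_triple_eqI[OF factors grothendieck_comp_closed[OF r ss] B.m_closed[OF cl]])
    fix l h g assume lhg: "l \<in> carrier L" "h \<in> carrier H" "g \<in> carrier G"
    then show "class_char ?lhs (l, h, g) = class_char ?rhs (l, h, g)"
      by (simp add: class_char_triple_mult[OF cl] class_char_comp[OF r s] class_char_comp[OF r s']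
          class_char_comp[OF r ss] class_char_triple_mult[OF s s'] distrib_left sum.distrib add_divide_distrib)
  qed
qed

end

text \<open>
  Both characters are the double sum of \<open>r (m, l, g) s (l, k, g) t (k, h, g)\<close>,
  divided by \<open>|L| |K|\<close>.
\<close>

lemma grothendieck_comp_assoc:
  assumes "finite_group G" "finite_group M" "finite_group L" "finite_group K" "finite_group H"
    and r: "r \<in> carrier (RG TYPE('f::field_char_0) (triple M L G))"
    and s: "s \<in> carrier (RG TYPE('f::field_char_0) (triple L K G))"
    and t: "t \<in> carrier (RG TYPE('f::field_char_0) (triple K H G))"
  shows "grothendieck_comp G M K H (grothendieck_comp G M L K r s) t =
    grothendieck_comp G M L H r (grothendieck_comp G L K H s t)"
    (is "?lhs = ?rhs")
proof -
  interpret MLK: four_groups M L K G using assms by (simp add: four_groups_def)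
  interpret MKH: four_groups M K H G using assms by (simp add: four_groups_def)
  interpret MLH: four_groups M L H G using assms by (simp add: four_groups_def)
  interpret LKH: four_groups L K H G using assms by (simp add: four_groups_def)
  note rs = MLK.grothendieck_comp_closed[OF r s] and st = LKH.grothendieck_comp_closed[OF s t]
  show ?thesis
  proof (rule class_char_triple_eqI[OF MKH.factors MKH.grothendieck_comp_closed[OF rs t] MLH.grothendieck_comp_closed[OF r st]])
    fix m h g assume mhg: "m \<in> carrier M" "h \<in> carrier H" "g \<in> carrier G"
    let ?cK = "of_nat (card (carrier K)) :: 'f" and ?cL = "of_nat (card (carrier L)) :: 'f"
    have "class_char ?lhs (m, h, g) =
      (\<Sum>k\<in>carrier K. (\<Sum>l\<in>carrier L. class_char r (m, l, g) * class_char s (l, k, g)) / ?cL * class_char t (k, h, g)) / ?cK"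
      unfolding MKH.class_char_comp[OF rs t mhg] using mhg
      by (intro arg_cong2[where f = "(/)"] sum.cong refl) (simp add: MLK.class_char_comp[OF r s])
    also have "\<dots> = (\<Sum>k\<in>carrier K. \<Sum>l\<in>carrier L. class_char r (m, l, g) * class_char s (l, k, g) * class_char t (k, h, g)) / (?cL * ?cK)"
      by (simp add: sum_distrib_right sum_divide_distrib)
    also have "\<dots> = (\<Sum>l\<in>carrier L. \<Sum>k\<in>carrier K. class_char r (m, l, g) * class_char s (l, k, g) * class_char t (k, h, g)) / (?cL * ?cK)"
      by (subst sum.swap) simp
    also have "\<dots> = (\<Sum>l\<in>carrier L. class_char r (m, l, g) * ((\<Sum>k\<in>carrier K. class_char s (l, k, g) * class_char t (k, h, g)) / ?cK)) / ?cL"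
      by (simp add: sum_distrib_left sum_divide_distrib mult.assoc mult.commute[of ?cL ?cK])
    also have "\<dots> = class_char ?rhs (m, h, g)"
      unfolding MLH.class_char_comp[OF r st mhg] using mhg
      by (intro arg_cong2[where f = "(/)"] sum.cong refl) (simp add: LKH.class_char_comp[OF s t])
    finally show "class_char ?lhs (m, h, g) = class_char ?rhs (m, h, g)" .
  qed
qed

definition bimodule_class :: "'g monoid \<Rightarrow> 'h monoid \<Rightarrow> ('f::field, 'h \<times> 'h \<times> 'g) grothendieck" where
  "bimodule_class G H = grothendieck_class (triple H H G)
    (frag_of (matrix_form (triple H H G) (group_algebra_bimodule H)))"

lemma bimodule_class_closed:
  fixes G :: "'g monoid" and H :: "'h monoid"
  assumes "finite_group G" "finite_group H"
  shows "bimodule_class G H \<in> carrier (RG TYPE('f::field_char_0) (triple H H G))"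
proof -
  interpret H: finite_group H by fact
  have G: "group G" using assms(1) by (simp add: finite_group_def)
  let ?V = "matrix_form (triple H H G) (group_algebra_bimodule H :: ('f, 'h \<Rightarrow>\<^sub>0 'f, 'h \<times> 'h \<times> 'g) gmodule)"
  have "?V \<in> matrix_reps (triple H H G)" by (rule H.group_algebra_char(1)[OF G])
  then have "virtual_rep (triple H H G) (frag_of ?V)" by simp
  then show ?thesis unfolding bimodule_class_def grothendieck_carrier by blast
qed

lemma bimodule_class_char:
  assumes "finite_group G" "finite_group H" and abg: "a \<in> carrier H" "b \<in> carrier H" "g \<in> carrier G"
  shows "class_char (bimodule_class G H :: ('f::field_char_0, _) grothendieck) (a, b, g) =
    of_nat (card {z \<in> carrier H. a \<otimes>\<^bsub>H\<^esub> z \<otimes>\<^bsub>H\<^esub> inv\<^bsub>H\<^esub> b = z})"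
proof -
  interpret H: finite_group H by fact
  have G: "group G" using assms(1) by (simp add: finite_group_def)
  note c = H.group_algebra_char[OF G, where 'f = 'f]
  have "class_char (bimodule_class G H :: ('f::field_char_0, _) grothendieck) (a, b, g) =
    frag_char (frag_of (matrix_form (triple H H G) (group_algebra_bimodule H))) (a, b, g)"
    unfolding bimodule_class_def
    by (rule grothendieck_class_char) (use c(1) abg in \<open>simp_all add: DirProd_simps\<close>)
  then show ?thesis using c(2)[OF abg] by simp
qed

text \<open>
  For each \<open>z\<close> exactly one \<open>x\<close> satisfies \<open>x z h\<inverse> =
  z\<close>, namely \<open>x = z h z\<inverse>\<close>. So the character of the composite at
  \<open>(l, h, g)\<close> is the average over \<open>z\<close> of the values of
  \<open>r\<close> at \<open>(l, z h z\<inverse>, g)\<close>, and these are all equal.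
\<close>

lemma grothendieck_comp_id_right:
  assumes fG: "finite_group G" and fL: "finite_group L" and fH: "finite_group H"
    and r: "r \<in> carrier (RG TYPE('f::field_char_0) (triple L H G))"
  shows "grothendieck_comp G L H H r (bimodule_class G H) = r"
proof -
  interpret H: finite_group H by fact
  interpret LHH: four_groups L H H G using assms by (simp add: four_groups_def)
  interpret LHG: finite_group "triple L H G" by (rule LHH.finite_group_LHG)
  note b = bimodule_class_closed[OF fG fH, where 'f = 'f]
  show ?thesis
  proof (rule class_char_triple_eqI[OF fL fH fG LHH.grothendieck_comp_closed[OF r b] r])
    fix l h g assume lhg: "l \<in> carrier L" "h \<in> carrier H" "g \<in> carrier G"
    let ?fix = "\<lambda>x z. x \<otimes>\<^bsub>H\<^esub> z \<otimes>\<^bsub>H\<^esub> inv\<^bsub>H\<^esub> h = z"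
    have "class_char (grothendieck_comp G L H H r (bimodule_class G H)) (l, h, g) =
      (\<Sum>x\<in>carrier H. class_char r (l, x, g) * of_nat (card {z \<in> carrier H. ?fix x z})) / of_nat (card (carrier H))"
      unfolding LHH.class_char_comp[OF r b lhg] using lhg
      by (intro arg_cong2[where f = "(/)"] sum.cong refl) (simp add: bimodule_class_char[OF fG fH])
    also have "(\<Sum>x\<in>carrier H. class_char r (l, x, g) * of_nat (card {z \<in> carrier H. ?fix x z})) =
      (\<Sum>x\<in>carrier H. \<Sum>z\<in>carrier H. if ?fix x z then class_char r (l, x, g) else 0)"
      using H.finite_carrier by (intro sum.cong refl) (simp add: sum.If_cases Int_def mult.commute)
    also have "\<dots> = (\<Sum>z\<in>carrier H. \<Sum>x\<in>carrier H. if ?fix x z then class_char r (l, x, g) else 0)"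
      by (rule sum.swap)
    also have "\<dots> = (\<Sum>z\<in>carrier H. class_char r (l, h, g))"
    proof (rule sum.cong[OF refl])
      fix z assume z: "z \<in> carrier H"
      define y where "y = z \<otimes>\<^bsub>H\<^esub> h \<otimes>\<^bsub>H\<^esub> inv\<^bsub>H\<^esub> z"
      have yH: "y \<in> carrier H" using z lhg by (simp add: y_def)
      have iff: "?fix x z \<longleftrightarrow> x = y" if x: "x \<in> carrier H" for x
      proof
        assume "?fix x z"
        then have "z \<otimes>\<^bsub>H\<^esub> h = x \<otimes>\<^bsub>H\<^esub> z" using x z lhg by (metis H.inv_solve_right H.m_closed)
        then have "y = x \<otimes>\<^bsub>H\<^esub> z \<otimes>\<^bsub>H\<^esub> inv\<^bsub>H\<^esub> z" unfolding y_def by simp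
        then show "x = y" using x z by (simp add: H.m_assoc)
      next
        assume "x = y"
        then show "?fix x z" using z lhg by (simp add: y_def H.m_assoc)
      qed
      have "(\<Sum>x\<in>carrier H. if ?fix x z then class_char r (l, x, g) else 0) =
        (\<Sum>x\<in>carrier H. if x = y then class_char r (l, y, g) else 0)"
        by (rule sum.cong) (auto simp: iff)
      also have "\<dots> = class_char r (l, y, g)" using yH H.finite_carrier by simp
      also have "\<dots> = class_char r (l, h, g)"
      proof -
        let ?P = "triple L H G"
        have iv: "inv\<^bsub>?P\<^esub> (\<one>\<^bsub>L\<^esub>, z, \<one>\<^bsub>G\<^esub>) = (\<one>\<^bsub>L\<^esub>, inv\<^bsub>H\<^esub> z, \<one>\<^bsub>G\<^esub>)"
          by (rule LHG.inv_equality) (use z in \<open>simp_all add: DirProd_simps\<close>)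
        have "(\<one>\<^bsub>L\<^esub>, z, \<one>\<^bsub>G\<^esub>) \<otimes>\<^bsub>?P\<^esub> (l, h, g) \<otimes>\<^bsub>?P\<^esub> inv\<^bsub>?P\<^esub> (\<one>\<^bsub>L\<^esub>, z, \<one>\<^bsub>G\<^esub>) = (l, y, g)"
          unfolding iv using lhg by (simp add: DirProd_simps y_def)
        then show ?thesis
          using LHG.class_char_conj[OF r, of "(l, h, g)" "(\<one>\<^bsub>L\<^esub>, z, \<one>\<^bsub>G\<^esub>)"] lhg z by (simp add: DirProd_simps)
      qed
      finally show "(\<Sum>x\<in>carrier H. if ?fix x z then class_char r (l, x, g) else 0) = class_char r (l, h, g)" .
    qed
    finally show "class_char (grothendieck_comp G L H H r (bimodule_class G H)) (l, h, g) = class_char r (l, h, g)"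
      using H.card_carrier_ne0[where 'f = 'f] by simp
  qed
qed

section \<open>Extension of scalars and inflation\<close>

definition inflate_rep :: "(rat, 'l \<times> 'h \<times> unit) matrix_rep \<Rightarrow> ('f::field_char_0, 'l \<times> 'h \<times> 'g) matrix_rep" where
  "inflate_rep = (\<lambda>(n, \<rho>). (n, \<lambda>(l, h, g). map_mat of_rat (\<rho> (l, h, ()))))"

lemma map_mat_of_rat_mult:
  assumes "A \<in> carrier_mat n m" "B \<in> carrier_mat m k"
  shows "map_mat of_rat (A * B) = map_mat of_rat A * (map_mat of_rat B :: 'f::field_char_0 mat)"
  by (rule eq_matI) (use assms in \<open>auto simp: scalar_prod_def of_rat_sum of_rat_mult\<close>)

lemma map_mat_of_rat_one: "map_mat of_rat (1\<^sub>m n) = (1\<^sub>m n :: 'f::field_char_0 mat)"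
  by (rule eq_matI) auto

lemma singleton_group_simps:
  "carrier (singleton_group a) = {a}" "\<one>\<^bsub>singleton_group a\<^esub> = a" "x \<otimes>\<^bsub>singleton_group a\<^esub> y = a"
  by (simp_all add: singleton_group_def)

lemma finite_group_unit: "finite_group trivial_group"
  by (simp add: finite_group_def finite_group_axioms_def singleton_group_simps)

lemma inflate_rep_closed:
  assumes "V \<in> matrix_reps (triple L H trivial_group)"
  shows "inflate_rep V \<in> matrix_reps (triple L H G)"
proof -
  obtain n \<rho> where V: "V = (n, \<rho>)" by (metis surj_pair)
  note R = assms[unfolded V]
  have c: "\<rho> (l, h, ()) \<in> carrier_mat n n" if "l \<in> carrier L" "h \<in> carrier H" for l h
    using matrix_repsD(1)[OF R] that by (simp add: DirProd_simps singleton_group_simps)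
  have m: "\<rho> (l \<otimes>\<^bsub>L\<^esub> l', h \<otimes>\<^bsub>H\<^esub> h', ()) = \<rho> (l, h, ()) * \<rho> (l', h', ())"
    if "l \<in> carrier L" "h \<in> carrier H" "l' \<in> carrier L" "h' \<in> carrier H" for l h l' h'
    using matrix_repsD(3)[OF R, of "(l, h, ())" "(l', h', ())"] that by (simp add: DirProd_simps singleton_group_simps)
  have o: "\<rho> (\<one>\<^bsub>L\<^esub>, \<one>\<^bsub>H\<^esub>, ()) = 1\<^sub>m n"
    using matrix_repsD(2)[OF R] by (simp add: DirProd_simps singleton_group_simps)
  show ?thesis
    unfolding V inflate_rep_def matrix_reps_def
    by (auto simp: DirProd_simps c m o map_mat_of_rat_one map_mat_of_rat_mult[OF c c])
qed

lemma inflate_rep_char: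
  assumes "V \<in> matrix_reps (triple L H trivial_group)" "l \<in> carrier L" "h \<in> carrier H"
  shows "rep_char (inflate_rep V) (l, h, g) = of_rat (rep_char V (l, h, ()))"
proof -
  obtain n \<rho> where V: "V = (n, \<rho>)" by (metis surj_pair)
  have "\<rho> (l, h, ()) \<in> carrier_mat n n"
    using matrix_repsD(1)[of n \<rho> _ "(l, h, ())"] assms unfolding V by (simp add: DirProd_simps singleton_group_simps)
  then show ?thesis unfolding V inflate_rep_def by (simp add: mtrace_def of_rat_sum)
qed

definition base_change ::
    "'g monoid \<Rightarrow> 'l monoid \<Rightarrow> 'h monoid \<Rightarrow> (rat, 'l \<times> 'h \<times> unit) grothendieck \<Rightarrow>
      ('f::field_char_0, 'l \<times> 'h \<times> 'g) grothendieck" where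
  "base_change G L H r =
    grothendieck_class (triple L H G) (frag_extend (\<lambda>V. frag_of (inflate_rep V)) (SOME x. x \<in> r))"

lemma base_change:
  fixes G :: "'g monoid" and L :: "'l monoid" and H :: "'h monoid"
  assumes r: "r \<in> carrier (RG TYPE(rat) (triple L H trivial_group))"
  shows base_change_closed:
      "base_change G L H r \<in> carrier (RG TYPE('f::field_char_0) (triple L H G))"
    and base_change_char: "\<lbrakk>l \<in> carrier L; h \<in> carrier H; g \<in> carrier G\<rbrakk> \<Longrightarrow>
      class_char (base_change G L H r :: ('f::field_char_0, 'l \<times> 'h \<times> 'g) grothendieck) (l, h, g) = of_rat (class_char r (l, h, ()))"
proof -
  interpret presentation "matrix_reps (triple L H trivial_group) :: (rat, 'l \<times> 'h \<times> unit) matrix_rep set"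
    "grothendieck_relations (triple L H trivial_group)"
    by (rule grothendieck_presentation)
  obtain x0 :: "(rat, 'l \<times> 'h \<times> unit) matrix_rep \<Rightarrow>\<^sub>0 int"
    where x0: "virtual_rep (triple L H trivial_group) x0"
    and r0: "r = grothendieck_class (triple L H trivial_group) x0"
    using r by (rule grothendieck_carrierE)
  define x where "x = (SOME x. x \<in> r)"
  have "x \<in> r" unfolding x_def
    by (rule someI[of _ x0]) (simp add: r0 grothendieck_class_def self_mem_cls[OF x0])
  then have x: "virtual_rep (triple L H trivial_group) x"
    using mem_cls_keys[OF x0] by (simp add: r0 grothendieck_class_def)
  let ?y = "frag_extend (\<lambda>V. frag_of (inflate_rep V)) x :: ('f, 'l \<times> 'h \<times> 'g) matrix_rep \<Rightarrow>\<^sub>0 int"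
  have y: "virtual_rep (triple L H G) ?y"
    by (rule frag_extend_keys[OF x]) (simp add: inflate_rep_closed)
  show "base_change G L H r \<in> carrier (RG TYPE('f) (triple L H G))"
    unfolding base_change_def x_def[symmetric] grothendieck_carrier using y by blast
  assume lhg: "l \<in> carrier L" "h \<in> carrier H" "g \<in> carrier G"
  have "class_char (base_change G L H r :: ('f, 'l \<times> 'h \<times> 'g) grothendieck) (l, h, g) = frag_char ?y (l, h, g)"
    unfolding base_change_def x_def[symmetric]
    by (rule grothendieck_class_char[OF y]) (use lhg in \<open>simp add: DirProd_simps\<close>)
  also have "\<dots> = of_rat (frag_char x (l, h, ()))"
    by (rule frag_char_extend[OF x]) (use lhg in \<open>simp_all add: inflate_rep_char of_rat_diff\<close>)
  also have "frag_char x (l, h, ()) = class_char r (l, h, ())"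
    by (simp add: class_char_def x_def)
  finally show "class_char (base_change G L H r :: ('f, 'l \<times> 'h \<times> 'g) grothendieck) (l, h, g) = of_rat (class_char r (l, h, ()))" .
qed

lemma base_change_mult:
  fixes G :: "'g monoid" and L :: "'l monoid" and H :: "'h monoid"
  assumes fg: "finite_group G" "finite_group L" "finite_group H"
    and r: "r \<in> carrier (RG TYPE(rat) (triple L H trivial_group))"
    and s: "s \<in> carrier (RG TYPE(rat) (triple L H trivial_group))"
  shows "base_change G L H (r \<otimes>\<^bsub>RG TYPE(rat) (triple L H trivial_group)\<^esub> s) =
    base_change G L H r \<otimes>\<^bsub>RG TYPE('f::field_char_0) (triple L H G)\<^esub> base_change G L H s"
    (is "?lhs = ?rhs")
proof -
  interpret A: comm_group "RG TYPE(rat) (triple L H trivial_group)" by (rule grothendieck_comm_group)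
  interpret B: comm_group "RG TYPE('f) (triple L H G)" by (rule grothendieck_comm_group)
  note rs = A.m_closed[OF r s]
  note c = base_change_closed[OF r, of G, where 'f = 'f] base_change_closed[OF s, of G, where 'f = 'f]
  show ?thesis
  proof (rule class_char_triple_eqI[OF fg(2,3,1) base_change_closed[OF rs] B.m_closed[OF c]])
    fix l h g assume "l \<in> carrier L" "h \<in> carrier H" "g \<in> carrier G"
    then show "class_char ?lhs (l, h, g) = class_char ?rhs (l, h, g)"
      by (simp add: base_change_char r s rs class_char_triple_mult[OF c] class_char_triple_mult[OF r s]
          singleton_group_simps of_rat_add)
  qed
qed

text \<open>
  The character of a class in the image of \<open>base_change\<close> is constant in
  \<open>g\<close>, and in the character formula for a composite \<open>g\<close> is only
  carried along.
\<close>

lemma base_change_comp: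
  fixes G :: "'g monoid" and L :: "'l monoid" and K :: "'c monoid" and H :: "'h monoid"
  assumes fg: "finite_group G" "finite_group L" "finite_group K" "finite_group H"
    and r: "r \<in> carrier (RG TYPE(rat) (triple L K trivial_group))"
    and s: "s \<in> carrier (RG TYPE(rat) (triple K H trivial_group))"
  shows "(base_change G L H (grothendieck_comp trivial_group L K H r s) :: ('f::field_char_0, 'l \<times> 'h \<times> 'g) grothendieck) =
    grothendieck_comp G L K H (base_change G L K r) (base_change G K H s)"
    (is "?lhs = ?rhs")
proof -
  interpret Q: four_groups L K H trivial_group using fg finite_group_unit by (simp add: four_groups_def)
  interpret F: four_groups L K H G using fg by (simp add: four_groups_def)
  note rs = Q.grothendieck_comp_closed[OF r s]
  note c = base_change_closed[OF r, of G, where 'f = 'f] base_change_closed[OF s, of G, where 'f = 'f]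
  show ?thesis
  proof (rule class_char_triple_eqI[OF F.factors base_change_closed[OF rs] F.grothendieck_comp_closed[OF c]])
    fix l h g assume lhg: "l \<in> carrier L" "h \<in> carrier H" "g \<in> carrier G"
    then show "class_char ?lhs (l, h, g) = class_char ?rhs (l, h, g)"
      by (simp add: base_change_char[OF rs] base_change_char[OF r] base_change_char[OF s] F.class_char_comp[OF c]
          Q.class_char_comp[OF r s] singleton_group_simps of_rat_divide of_rat_sum of_rat_mult)
  qed
qed

lemma base_change_bimodule_class:
  fixes G :: "'g monoid" and H :: "'h monoid"
  assumes fg: "finite_group G" "finite_group H"
  shows "(base_change G H H (bimodule_class trivial_group H) :: ('f::field_char_0, 'h \<times> 'h \<times> 'g) grothendieck) = bimodule_class G H"
    (is "?lhs = ?rhs")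
proof -
  note b = bimodule_class_closed[OF finite_group_unit fg(2), where 'f = rat]
  show ?thesis
  proof (rule class_char_triple_eqI[OF fg(2,2,1) base_change_closed[OF b] bimodule_class_closed[OF fg]])
    fix l h g assume "l \<in> carrier H" "h \<in> carrier H" "g \<in> carrier G"
    then show "class_char ?lhs (l, h, g) = class_char ?rhs (l, h, g)"
      by (simp add: base_change_char[OF b] bimodule_class_char fg finite_group_unit singleton_group_simps)
  qed
qed

section \<open>Extending the coefficients of an abelian group\<close>

lemma frag_biextend_add_right: "frag_biextend f x (y + z) = frag_biextend f x y + frag_biextend f x z"
  using frag_biextend_diff_right[of f x y "- z"] frag_biextend_diff_right[of f x 0 z] by simp

lemma tensor_relationsE:
  assumes "r \<in> tensor_relations A"
  obtains (scalar) a b x where "x \<in> carrier A" "r = frag_of (a + b, x) - frag_of (a, x) - frag_of (b, x)"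
    | (vector) a x y where "x \<in> carrier A" "y \<in> carrier A"
      "r = frag_of (a, x \<otimes>\<^bsub>A\<^esub> y) - frag_of (a, x) - frag_of (a, y)"
  using assms unfolding tensor_relations_def by blast

lemma tensor_presentation:
  fixes A :: "'a monoid"
  assumes "comm_group A"
  shows "presentation (UNIV \<times> carrier A :: ('k::field \<times> 'a) set) (tensor_relations A)"
proof
  interpret comm_group A by fact
  fix r :: "'k \<times> 'a \<Rightarrow>\<^sub>0 int" assume "r \<in> tensor_relations A"
  then show "tensor_frag A r"
    by (cases rule: tensor_relationsE) (simp_all add: frag_keys_diff)
qed

abbreviation trel :: "'a monoid \<Rightarrow> ('k::field \<times> 'a \<Rightarrow>\<^sub>0 int) set" where
  "trel A \<equiv> relation_subgroup (UNIV \<times> carrier A) (tensor_relations A)"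

lemma tensor_relations_scalar:
  "x \<in> carrier A \<Longrightarrow> frag_of (a + b, x) - frag_of (a, x) - frag_of (b, x) \<in> tensor_relations A"
  unfolding tensor_relations_def by blast

lemma tensor_relations_vector:
  "x \<in> carrier A \<Longrightarrow> y \<in> carrier A \<Longrightarrow>
    frag_of (a, x \<otimes>\<^bsub>A\<^esub> y) - frag_of (a, x) - frag_of (a, y) \<in> tensor_relations A"
  unfolding tensor_relations_def by blast

lemma trel_gen: "r \<in> tensor_relations A \<Longrightarrow> r \<in> trel A"
  unfolding relation_subgroup_def by (rule generate.incl)

text \<open>
  Multiplication by \<open>c\<close> on \<open>k \<otimes> A\<close>, on representatives.
\<close>

definition scale_frag :: "'k::field \<Rightarrow> ('k \<times> 'a \<Rightarrow>\<^sub>0 int) \<Rightarrow> ('k \<times> 'a \<Rightarrow>\<^sub>0 int)" where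
  "scale_frag c = frag_extend (\<lambda>(a, r). frag_of (c * a, r))"

lemma scale_frag_keys:
  "tensor_frag A x \<Longrightarrow> tensor_frag A (scale_frag c x)"
  unfolding scale_frag_def by (erule frag_extend_keys) auto

lemma scale_frag_trel:
  fixes A :: "'a monoid" and x :: "'k::field \<times> 'a \<Rightarrow>\<^sub>0 int"
  assumes A: "comm_group A" and x: "x \<in> trel A"
  shows "scale_frag c x \<in> trel A"
  unfolding scale_frag_def
proof (rule frag_extend_respects[OF tensor_presentation[OF A] tensor_presentation[OF A] _ x])
  fix r :: "'k \<times> 'a \<Rightarrow>\<^sub>0 int" assume "r \<in> tensor_relations A"
  then show "frag_extend (\<lambda>(a, r). frag_of (c * a, r)) r \<in> trel A"
    by (cases rule: tensor_relationsE)
      (simp_all add: frag_extend_diff distrib_left trel_gen tensor_relations_scalar tensor_relations_vector)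
qed

lemma scalar_extension_carrier:
  assumes A: "comm_group A"
  shows "carrier (scalar_extension TYPE('k::field) A) =
    {tensor_class A x | x :: 'k \<times> 'a \<Rightarrow>\<^sub>0 int. tensor_frag A x}"
  unfolding scalar_extension_def Let_def tensor_class_def
  by (simp add: presentation.carrier_presented[OF tensor_presentation[OF A]])

lemma scalar_extension_zero:
  assumes A: "comm_group A"
  shows "\<zero>\<^bsub>scalar_extension TYPE('k::field) A\<^esub> = tensor_class A 0"
  unfolding scalar_extension_def Let_def tensor_class_def
  by (simp add: presentation.presented_one[OF tensor_presentation[OF A]])

lemma scalar_extension_add:
  fixes x y :: "'k::field \<times> 'a \<Rightarrow>\<^sub>0 int"
  assumes A: "comm_group A" and "tensor_frag A x" "tensor_frag A y"
  shows "tensor_class A x \<oplus>\<^bsub>scalar_extension TYPE('k) A\<^esub> tensor_class A y = tensor_class A (x + y)"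
  unfolding scalar_extension_def Let_def tensor_class_def
  by (simp add: presentation.presented_mult[OF tensor_presentation[OF A] assms(2,3)])

lemma tensor_class_eqI:
  fixes x y :: "'k::field \<times> 'a \<Rightarrow>\<^sub>0 int"
  assumes A: "comm_group A" and "tensor_frag A x" "tensor_frag A y"
    and "x - y \<in> trel A"
  shows "tensor_class A x = tensor_class A y"
  unfolding tensor_class_def using presentation.cls_eq_iff[OF tensor_presentation[OF A] assms(2,3)] assms(4) by simp

text \<open>
  Operations on classes are unions over all representatives; compatibility with the relations
  collapses them.
\<close>

lemma UN_tensor_class:
  fixes x :: "'k::field \<times> 'a \<Rightarrow>\<^sub>0 int"
  assumes A: "comm_group A" and B: "comm_group B" and x: "tensor_frag A x"
    and keys: "\<And>x. tensor_frag A x \<Longrightarrow> tensor_frag B (frag_extend f x)"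
    and rel: "\<And>x. x \<in> trel A \<Longrightarrow> frag_extend f x \<in> trel B"
  shows "(\<Union>x'\<in>tensor_class A x. tensor_class B (frag_extend f x')) = tensor_class B (frag_extend f x)"
  unfolding tensor_class_def[of A]
proof (rule presentation.UN_cls[OF tensor_presentation[OF A] x])
  fix x' :: "'k \<times> 'a \<Rightarrow>\<^sub>0 int" assume x': "tensor_frag A x'" "x' - x \<in> trel A"
  show "tensor_class B (frag_extend f x') = tensor_class B (frag_extend f x)"
    by (rule tensor_class_eqI[OF B keys[OF x'(1)] keys[OF x]])
      (use rel[OF x'(2)] in \<open>simp add: frag_extend_diff\<close>)
qed

lemma scalar_extension_smult:
  fixes x :: "'k::field \<times> 'a \<Rightarrow>\<^sub>0 int"
  assumes A: "comm_group A" and x: "tensor_frag A x"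
  shows "c \<odot>\<^bsub>scalar_extension TYPE('k) A\<^esub> tensor_class A x = tensor_class A (scale_frag c x)"
proof -
  have "c \<odot>\<^bsub>scalar_extension TYPE('k) A\<^esub> tensor_class A x =
      (\<Union>x'\<in>tensor_class A x. tensor_class A (frag_extend (\<lambda>(a, r). frag_of (c * a, r)) x'))"
    by (simp add: scalar_extension_def Let_def)
  also have "\<dots> = tensor_class A (scale_frag c x)"
    unfolding scale_frag_def
    by (rule UN_tensor_class[OF A A x]) (simp_all add: scale_frag_keys[unfolded scale_frag_def] scale_frag_trel[OF A, unfolded scale_frag_def])
  finally show ?thesis .
qed

lemma scale_frag_simps:
  "scale_frag c (x + y) = scale_frag c x + scale_frag c y" "scale_frag c (x - y) = scale_frag c x - scale_frag c y"
  "scale_frag c 0 = 0" "scale_frag c (frag_of (a, r)) = frag_of (c * a, r)"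
  by (simp_all add: scale_frag_def frag_extend_add frag_extend_diff)

lemma scale_frag_scale: "scale_frag c (scale_frag d x) = scale_frag (c * d) x"
proof -
  have "Poly_Mapping.keys x \<subseteq> UNIV" by simp
  then show ?thesis by (induction x rule: frag_induction) (auto simp: scale_frag_simps mult.assoc)
qed

lemma scale_frag_one: "scale_frag 1 x = x"
proof -
  have "Poly_Mapping.keys x \<subseteq> UNIV" by simp
  then show ?thesis by (induction x rule: frag_induction) (auto simp: scale_frag_simps)
qed

text \<open>
  This is the one module axiom that holds only modulo the relations; the others are identities
  between formal sums.
\<close>

lemma scale_frag_add_scalar:
  assumes A: "comm_group A" and x: "tensor_frag A x"
  shows "scale_frag (c + d) x - (scale_frag c x + scale_frag d x) \<in> trel A"
proof -
  interpret presentation "UNIV \<times> carrier A" "tensor_relations A" by (rule tensor_presentation[OF A])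
  show ?thesis using x
  proof (induction x rule: frag_induction)
    case (one p)
    then obtain a r where p: "p = (a, r)" "r \<in> carrier A" by auto
    show ?case
      using trel_gen[OF tensor_relations_scalar[OF p(2), of "c * a" "d * a"]]
      by (simp add: p scale_frag_simps distrib_right diff_diff_eq)
  next
    case (diff x y)
    have "scale_frag (c + d) (x - y) - (scale_frag c (x - y) + scale_frag d (x - y)) =
      (scale_frag (c + d) x - (scale_frag c x + scale_frag d x)) - (scale_frag (c + d) y - (scale_frag c y + scale_frag d y))"
      by (simp add: scale_frag_simps)
    then show ?case using N_diff[OF diff] by simp
  qed (simp add: scale_frag_simps)
qed

text \<open>
  The multiplicative fields are arbitrary, so that the lemma covers
  \<^const>\<open>P_End\<close>, which carries composition as its multiplication.
\<close>

lemma scalar_extension_module: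
  fixes A :: "'a monoid"
  assumes A: "comm_group A"
  shows "Module.module class_ring (scalar_extension TYPE('k::field) A \<lparr>monoid.mult := m, monoid.one := e\<rparr>)"
proof -
  let ?M = "scalar_extension TYPE('k) A"
  have E: "\<exists>x. tensor_frag A x \<and> X = tensor_class A x" if "X \<in> carrier ?M" for X
    using that unfolding scalar_extension_carrier[OF A] by blast
  have I: "tensor_class A x \<in> carrier ?M" if "tensor_frag A x" for x
    using that unfolding scalar_extension_carrier[OF A] by blast
  note s = scalar_extension_add[OF A] scalar_extension_smult[OF A] scalar_extension_zero[OF A]
    frag_keys_add scale_frag_keys
  show ?thesis
  proof (rule module_criteria, goal_cases)
    case 1 show ?case by (rule class_cring.cring_axioms)
  next
    case 2 show ?case using I[of 0] by (simp add: s)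
  next
    case 3 show ?case by (auto dest!: E simp: s I)
  next
    case 4
    have "\<exists>Y\<in>carrier ?M. X \<oplus>\<^bsub>?M\<^esub> Y = \<zero>\<^bsub>?M\<^esub>" if X: "X \<in> carrier ?M" for X
    proof -
      obtain x where x: "tensor_frag A x" "X = tensor_class A x" using E[OF X] by blast
      have k: "tensor_frag A (- x)" using x by simp
      show ?thesis by (rule bexI[OF _ I[OF k]]) (simp add: x s k)
    qed
    then show ?case by simp
  next
    case 5 show ?case by (auto dest!: E simp: s I)
  next
    case 6 show ?case by (auto dest!: E simp: s add.commute)
  next
    case 7 show ?case by (auto dest!: E simp: s add.assoc)
  next
    case 8 show ?case by (auto dest!: E simp: s)
  next
    case 9 show ?case by (auto dest!: E simp: s scale_frag_scale)
  next
    case 10 show ?case by (auto dest!: E simp: s scale_frag_one)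
  next
    case 11
    have "(a + b) \<odot>\<^bsub>?M\<^esub> X = a \<odot>\<^bsub>?M\<^esub> X \<oplus>\<^bsub>?M\<^esub> b \<odot>\<^bsub>?M\<^esub> X" if X: "X \<in> carrier ?M" for a b X
    proof -
      obtain x where x: "tensor_frag A x" "X = tensor_class A x" using E[OF X] by blast
      show ?thesis unfolding x(2) using tensor_class_eqI[OF A _ _ scale_frag_add_scalar[OF A x(1)]] x(1) by (simp add: s)
    qed
    then show ?case by simp
  next
    case 12 show ?case by (auto dest!: E simp: s scale_frag_simps)
  qed
qed

section \<open>Bilinear extension of a biadditive map\<close>

text \<open>
  On representatives, \<open>(a \<otimes> r, b \<otimes> s) \<mapsto> a b \<otimes> m r
  s\<close>.
\<close>

definition bimul :: "('a \<Rightarrow> 'b \<Rightarrow> 'c) \<Rightarrow> ('k::field \<times> 'a \<Rightarrow>\<^sub>0 int) \<Rightarrow> ('k \<times> 'b \<Rightarrow>\<^sub>0 int) \<Rightarrow> ('k \<times> 'c \<Rightarrow>\<^sub>0 int)" where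
  "bimul m = frag_biextend (\<lambda>(a, r) (b, s). frag_of (a * b, m r s))"

locale biadditive =
  fixes A :: "'a monoid" and B :: "'b monoid" and C :: "'c monoid" and m :: "'a \<Rightarrow> 'b \<Rightarrow> 'c"
  assumes A: "comm_group A" and B: "comm_group B" and C: "comm_group C"
    and closed: "r \<in> carrier A \<Longrightarrow> s \<in> carrier B \<Longrightarrow> m r s \<in> carrier C"
    and left: "r \<in> carrier A \<Longrightarrow> r' \<in> carrier A \<Longrightarrow> s \<in> carrier B \<Longrightarrow> m (r \<otimes>\<^bsub>A\<^esub> r') s = m r s \<otimes>\<^bsub>C\<^esub> m r' s"
    and right: "r \<in> carrier A \<Longrightarrow> s \<in> carrier B \<Longrightarrow> s' \<in> carrier B \<Longrightarrow> m r (s \<otimes>\<^bsub>B\<^esub> s') = m r s \<otimes>\<^bsub>C\<^esub> m r s'"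
begin

lemma bimul_keys:
  assumes "tensor_frag A x" "tensor_frag B y"
  shows "tensor_frag C (bimul m x y)"
  unfolding bimul_def by (rule frag_biextend_keys[OF assms]) (auto simp: closed)

lemma bimul_respects:
  fixes x x' :: "'k::field \<times> 'a \<Rightarrow>\<^sub>0 int"
  assumes x: "tensor_frag A x" "tensor_frag A x'" "x' - x \<in> trel A"
    and y: "tensor_frag B y" "tensor_frag B y'" "y' - y \<in> trel B"
  shows "bimul m x' y' - bimul m x y \<in> trel C"
  unfolding bimul_def
proof (rule frag_biextend_respects[OF tensor_presentation[OF A] tensor_presentation[OF B] tensor_presentation[OF C] _ _ x y])
  fix r :: "'k \<times> 'a \<Rightarrow>\<^sub>0 int" and q :: "'k \<times> 'b" assume r: "r \<in> tensor_relations A" and q: "q \<in> UNIV \<times> carrier B"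
  obtain b s where q': "q = (b, s)" "s \<in> carrier B" using q by auto
  show "frag_extend (\<lambda>p. (case p of (a, r) \<Rightarrow> \<lambda>(b, s). frag_of (a * b, m r s)) q) r \<in> trel C"
    using r
    by (cases rule: tensor_relationsE)
      (simp_all add: q' frag_extend_diff distrib_right left closed trel_gen tensor_relations_scalar tensor_relations_vector)
next
  fix p :: "'k \<times> 'a" and r :: "'k \<times> 'b \<Rightarrow>\<^sub>0 int" assume p: "p \<in> UNIV \<times> carrier A" and r: "r \<in> tensor_relations B"
  obtain a s where p': "p = (a, s)" "s \<in> carrier A" using p by auto
  show "frag_extend ((case p of (a, r) \<Rightarrow> \<lambda>(b, s). frag_of (a * b, m r s))) r \<in> trel C"
    using r
    by (cases rule: tensor_relationsE)
      (simp_all add: p' frag_extend_diff distrib_left right closed trel_gen tensor_relations_scalar tensor_relations_vector)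
qed

lemma UN_bimul:
  fixes x :: "'k::field \<times> 'a \<Rightarrow>\<^sub>0 int"
  assumes x: "tensor_frag A x" and y: "tensor_frag B y"
  shows "(\<Union>x'\<in>tensor_class A x. \<Union>y'\<in>tensor_class B y. tensor_class C (bimul m x' y')) = tensor_class C (bimul m x y)"
proof -
  interpret PA: presentation "UNIV \<times> carrier A :: ('k \<times> 'a) set" "tensor_relations A" by (rule tensor_presentation[OF A])
  interpret PB: presentation "UNIV \<times> carrier B :: ('k \<times> 'b) set" "tensor_relations B" by (rule tensor_presentation[OF B])
  have eq: "tensor_class C (bimul m x' y') = tensor_class C (bimul m x y)"
    if "x' \<in> tensor_class A x" "y' \<in> tensor_class B y" for x' y'
  proof -
    note that = that[unfolded tensor_class_def]
    note x' = PA.mem_cls_keys[OF x that(1)] and y' = PB.mem_cls_keys[OF y that(2)]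
    have "x' - x \<in> trel A" "y' - y \<in> trel B" using PA.mem_cls_iff[OF x] PB.mem_cls_iff[OF y] that by auto
    then show ?thesis
      by (intro tensor_class_eqI[OF C bimul_keys[OF x' y'] bimul_keys[OF x y]] bimul_respects x y x' y')
  qed
  have "x \<in> tensor_class A x" "y \<in> tensor_class B y"
    using PA.self_mem_cls[OF x] PB.self_mem_cls[OF y] by (simp_all add: tensor_class_def)
  then show ?thesis using eq by blast
qed

end

lemma bimul_scale_right: "bimul m x (scale_frag c y) = scale_frag c (bimul m x y)"
proof -
  have "Poly_Mapping.keys x \<subseteq> UNIV" "Poly_Mapping.keys y \<subseteq> UNIV" by simp_all
  then show ?thesis
  proof (induction x rule: frag_induction)
    case (one p)
    obtain a r where p: "p = (a, r)" by fastforce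
    from one(2) show ?case
      by (induction y rule: frag_induction)
        (auto simp: p bimul_def scale_frag_simps frag_extend_diff mult.left_commute)
  qed (auto simp: bimul_def scale_frag_simps frag_biextend_diff_left)
qed

text \<open>
  The map \<open>id \<otimes> \<phi>\<close> on representatives.
\<close>

definition map_frag :: "('a \<Rightarrow> 'b) \<Rightarrow> ('k::field \<times> 'a \<Rightarrow>\<^sub>0 int) \<Rightarrow> ('k \<times> 'b \<Rightarrow>\<^sub>0 int)" where
  "map_frag \<phi> = frag_extend (\<lambda>(a, r). frag_of (a, \<phi> r))"

lemma map_frag_simps:
  "map_frag \<phi> (x + y) = map_frag \<phi> x + map_frag \<phi> y" "map_frag \<phi> (x - y) = map_frag \<phi> x - map_frag \<phi> y"
  "map_frag \<phi> 0 = 0" "map_frag \<phi> (frag_of (a, r)) = frag_of (a, \<phi> r)"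
  by (simp_all add: map_frag_def frag_extend_add frag_extend_diff)

lemma map_frag_scale: "map_frag \<phi> (scale_frag c x) = scale_frag c (map_frag \<phi> x)"
proof -
  have "Poly_Mapping.keys x \<subseteq> UNIV" by simp
  then show ?thesis by (induction x rule: frag_induction) (auto simp: scale_frag_simps map_frag_simps)
qed

lemma map_frag_bimul:
  assumes x: "Poly_Mapping.keys x \<subseteq> UNIV \<times> S" and y: "Poly_Mapping.keys y \<subseteq> UNIV \<times> S'"
    and hom: "\<And>r s. r \<in> S \<Longrightarrow> s \<in> S' \<Longrightarrow> \<phi>'' (m r s) = m' (\<phi> r) (\<phi>' s)"
  shows "map_frag \<phi>'' (bimul m x y) = bimul m' (map_frag \<phi> x) (map_frag \<phi>' y)"
  using x
proof (induction x rule: frag_induction)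
  case (one p)
  obtain a r where p: "p = (a, r)" "r \<in> S" using one by auto
  show ?case using y
    by (induction y rule: frag_induction)
      (auto simp: p bimul_def map_frag_simps frag_extend_diff hom)
qed (auto simp: bimul_def map_frag_simps frag_biextend_diff_left)

lemma map_frag_keys:
  assumes "\<And>r. r \<in> carrier A \<Longrightarrow> \<phi> r \<in> carrier B" "tensor_frag A x"
  shows "tensor_frag B (map_frag \<phi> x)"
  unfolding map_frag_def by (rule frag_extend_keys[OF assms(2)]) (use assms(1) in auto)

lemma map_frag_trel:
  fixes A :: "'a monoid" and B :: "'b monoid" and x :: "'k::field \<times> 'a \<Rightarrow>\<^sub>0 int"
  assumes A: "comm_group A" and B: "comm_group B" and hom: "\<phi> \<in> hom A B" and x: "x \<in> trel A"
  shows "map_frag \<phi> x \<in> trel B"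
  unfolding map_frag_def
proof (rule frag_extend_respects[OF tensor_presentation[OF A] tensor_presentation[OF B] _ x])
  fix r :: "'k \<times> 'a \<Rightarrow>\<^sub>0 int" assume "r \<in> tensor_relations A"
  then show "frag_extend (\<lambda>(a, r). frag_of (a, \<phi> r)) r \<in> trel B"
    by (cases rule: tensor_relationsE)
      (simp_all add: frag_extend_diff trel_gen tensor_relations_scalar tensor_relations_vector
        hom_in_carrier[OF hom] hom_mult[OF hom])
qed

definition scalar_extension_map :: "'a monoid \<Rightarrow> 'b monoid \<Rightarrow> ('a \<Rightarrow> 'b) \<Rightarrow>
    ('k::field \<times> 'a \<Rightarrow>\<^sub>0 int) set \<Rightarrow> ('k \<times> 'b \<Rightarrow>\<^sub>0 int) set" where
  "scalar_extension_map A B \<phi> X = (\<Union>x\<in>X. tensor_class B (map_frag \<phi> x))"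

lemma scalar_extension_map_class:
  fixes A :: "'a monoid" and B :: "'b monoid" and x :: "'k::field \<times> 'a \<Rightarrow>\<^sub>0 int"
  assumes A: "comm_group A" and B: "comm_group B" and hom: "\<phi> \<in> hom A B"
    and x: "tensor_frag A x"
  shows "scalar_extension_map A B \<phi> (tensor_class A x) = tensor_class B (map_frag \<phi> x)"
  unfolding scalar_extension_map_def map_frag_def
  by (rule UN_tensor_class[OF A B x])
    (simp_all add: map_frag_keys[unfolded map_frag_def, OF hom_in_carrier[OF hom]]
      map_frag_trel[OF A B hom, unfolded map_frag_def])

text \<open>
  On generators this is associativity of multiplication in \<open>k\<close> and of the four
  maps.
\<close>

lemma bimul_assoc:
  fixes x :: "'k::field \<times> 'a \<Rightarrow>\<^sub>0 int"
  assumes "\<And>r s t. r \<in> S1 \<Longrightarrow> s \<in> S2 \<Longrightarrow> t \<in> S3 \<Longrightarrow> h (f r s) t = h' r (f' s t)"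
    and "Poly_Mapping.keys x \<subseteq> UNIV \<times> S1" "Poly_Mapping.keys y \<subseteq> UNIV \<times> S2" "Poly_Mapping.keys z \<subseteq> UNIV \<times> S3"
  shows "bimul h (bimul f x y) z = bimul h' x (bimul f' y z)"
  unfolding bimul_def
  by (rule frag_biextend_assoc[OF _ assms(2-4)]) (auto simp: assms(1) mult.assoc)

lemma bimul_unit_right:
  fixes x :: "'k::field \<times> 'a \<Rightarrow>\<^sub>0 int"
  assumes "\<And>r. r \<in> S \<Longrightarrow> m r i = r" and x: "Poly_Mapping.keys x \<subseteq> UNIV \<times> S"
  shows "bimul m x (frag_of (1, i)) = x"
  using x
  by (induction x rule: frag_induction) (auto simp: bimul_def assms(1) frag_extend_diff)

section \<open>The category of the shifted functor\<close>

lemma kR_carrierE: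
  assumes "X \<in> carrier (kR TYPE('k::field) TYPE('f::field) \<Gamma>)"
  obtains x :: "'k::field \<times> ('f::field, 'g) grothendieck \<Rightarrow>\<^sub>0 int"
  where "tensor_frag (RG TYPE('f::field) \<Gamma>) x" "X = kR_class \<Gamma> x"
  using assms unfolding kR_def scalar_extension_carrier[OF grothendieck_comm_group] kR_class_def by blast

lemma kR_carrierI:
  fixes x :: "'k::field \<times> ('f::field, 'g) grothendieck \<Rightarrow>\<^sub>0 int"
  assumes "tensor_frag (RG TYPE('f) \<Gamma>) x"
  shows "kR_class \<Gamma> x \<in> carrier (kR TYPE('k) TYPE('f) \<Gamma>)"
  using assms unfolding kR_def scalar_extension_carrier[OF grothendieck_comm_group] kR_class_def by blast

lemma kR_add:
  fixes x y :: "'k::field \<times> ('f::field, 'g) grothendieck \<Rightarrow>\<^sub>0 int"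
  assumes "tensor_frag (RG TYPE('f) \<Gamma>) x" "tensor_frag (RG TYPE('f) \<Gamma>) y"
  shows "kR_class \<Gamma> x \<oplus>\<^bsub>kR TYPE('k) TYPE('f) \<Gamma>\<^esub> kR_class \<Gamma> y = kR_class \<Gamma> (x + y)"
  unfolding kR_def kR_class_def by (rule scalar_extension_add[OF grothendieck_comm_group assms])

lemma kR_smult:
  fixes x :: "'k::field \<times> ('f::field, 'g) grothendieck \<Rightarrow>\<^sub>0 int"
  assumes "tensor_frag (RG TYPE('f) \<Gamma>) x"
  shows "c \<odot>\<^bsub>kR TYPE('k) TYPE('f) \<Gamma>\<^esub> kR_class \<Gamma> x = kR_class \<Gamma> (scale_frag c x)"
  unfolding kR_def kR_class_def by (rule scalar_extension_smult[OF grothendieck_comm_group assms])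

lemma kR_zero: "\<zero>\<^bsub>kR TYPE('k::field) TYPE('f::field) \<Gamma>\<^esub> = kR_class \<Gamma> 0"
  unfolding kR_def kR_class_def by (rule scalar_extension_zero[OF grothendieck_comm_group])

context four_groups begin

text \<open>
  With this, composition on \<open>k \<otimes> R\<close> inherits its laws from the Grothendieck
  groups through the lemmas on \<^const>\<open>bimul\<close>.
\<close>

lemma comp_biadditive:
  "biadditive (RG TYPE('f::field_char_0) (triple L K G)) (RG TYPE('f) (triple K H G))
    (RG TYPE('f) (triple L H G)) (grothendieck_comp G L K H)"
  by (rule biadditive.intro)
    (simp_all add: grothendieck_comm_group grothendieck_comp_closed grothendieck_comp_mult_left grothendieck_comp_mult_right)

lemma kR_comp_class:
  fixes x :: "'k::field \<times> ('f::field_char_0, 'l \<times> 'c \<times> 'g) grothendieck \<Rightarrow>\<^sub>0 int"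
  assumes "tensor_frag (RG TYPE('f) (triple L K G)) x"
    "tensor_frag (RG TYPE('f) (triple K H G)) y"
  shows "kR_comp G L K H (kR_class (triple L K G) x) (kR_class (triple K H G) y) =
    kR_class (triple L H G) (bimul (grothendieck_comp G L K H) x y)"
  using biadditive.UN_bimul[OF comp_biadditive assms]
  unfolding kR_comp_def kR_class_def bimul_def .

lemmas bimul_comp_keys = biadditive.bimul_keys[OF comp_biadditive]

lemma kR_comp_closed:
  assumes "X \<in> carrier (kR TYPE('k::field) TYPE('f::field_char_0) (triple L K G))"
    "Y \<in> carrier (kR TYPE('k) TYPE('f) (triple K H G))"
  shows "kR_comp G L K H X Y \<in> carrier (kR TYPE('k) TYPE('f) (triple L H G))"
  using assms by (elim kR_carrierE) (simp add: kR_comp_class kR_carrierI bimul_comp_keys)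

lemma kR_comp_linear_right:
  assumes X: "X \<in> carrier (kR TYPE('k::field) TYPE('f::field_char_0) (triple L K G))"
    and Y: "Y \<in> carrier (kR TYPE('k) TYPE('f) (triple K H G))"
  shows "Z \<in> carrier (kR TYPE('k) TYPE('f) (triple K H G)) \<Longrightarrow>
      kR_comp G L K H X (Y \<oplus>\<^bsub>kR TYPE('k) TYPE('f) (triple K H G)\<^esub> Z) =
      kR_comp G L K H X Y \<oplus>\<^bsub>kR TYPE('k) TYPE('f) (triple L H G)\<^esub> kR_comp G L K H X Z"
    and "kR_comp G L K H X (c \<odot>\<^bsub>kR TYPE('k) TYPE('f) (triple K H G)\<^esub> Y) =
      c \<odot>\<^bsub>kR TYPE('k) TYPE('f) (triple L H G)\<^esub> kR_comp G L K H X Y"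
    and "kR_comp G L K H X (\<zero>\<^bsub>kR TYPE('k) TYPE('f) (triple K H G)\<^esub>) = \<zero>\<^bsub>kR TYPE('k) TYPE('f) (triple L H G)\<^esub>"
proof -
  let ?A = "kR TYPE('k) TYPE('f) (triple K H G)"
  let ?B = "kR TYPE('k) TYPE('f) (triple L H G)"
  obtain x where x: "tensor_frag (RG TYPE('f) (triple L K G)) x" "X = kR_class (triple L K G) x"
    using X by (rule kR_carrierE)
  obtain y where y: "tensor_frag (RG TYPE('f) (triple K H G)) y" "Y = kR_class (triple K H G) y"
    using Y by (rule kR_carrierE)
  show "kR_comp G L K H X (c \<odot>\<^bsub>?A\<^esub> Y) =
      c \<odot>\<^bsub>?B\<^esub> kR_comp G L K H X Y"
    unfolding x(2) y(2)
    by (simp add: kR_smult y(1) x(1) kR_comp_class scale_frag_keys bimul_comp_keys bimul_scale_right)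
  show "kR_comp G L K H X (\<zero>\<^bsub>?A\<^esub>) = \<zero>\<^bsub>?B\<^esub>"
    unfolding x(2) kR_zero by (simp add: x(1) kR_comp_class) (simp add: bimul_def)
  assume "Z \<in> carrier (?A)"
  then obtain z where z: "tensor_frag (RG TYPE('f) (triple K H G)) z" "Z = kR_class (triple K H G) z"
    by (rule kR_carrierE)
  have "bimul m x (y + z) = bimul m x y + bimul m x z" for m :: "_ \<Rightarrow> _ \<Rightarrow> ('f, 'l \<times> 'h \<times> 'g) grothendieck"
    by (simp add: bimul_def frag_biextend_add_right)
  then show "kR_comp G L K H X (Y \<oplus>\<^bsub>?A\<^esub> Z) =
      kR_comp G L K H X Y \<oplus>\<^bsub>?B\<^esub> kR_comp G L K H X Z"
    unfolding x(2) y(2) z(2)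
    by (simp add: kR_add y(1) x(1) z(1) kR_comp_class frag_keys_add bimul_comp_keys)
qed

end

lemma kR_comp_assoc:
  assumes fg: "finite_group G" "finite_group M" "finite_group L" "finite_group K" "finite_group H"
    and X: "X \<in> carrier (kR TYPE('k::field) TYPE('f::field_char_0) (triple M L G))"
    and Y: "Y \<in> carrier (kR TYPE('k) TYPE('f) (triple L K G))"
    and Z: "Z \<in> carrier (kR TYPE('k) TYPE('f) (triple K H G))"
  shows "kR_comp G M K H (kR_comp G M L K X Y) Z = kR_comp G M L H X (kR_comp G L K H Y Z)"
proof -
  interpret MLK: four_groups M L K G using fg by (simp add: four_groups_def)
  interpret MKH: four_groups M K H G using fg by (simp add: four_groups_def)
  interpret MLH: four_groups M L H G using fg by (simp add: four_groups_def)
  interpret LKH: four_groups L K H G using fg by (simp add: four_groups_def)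
  obtain x where x: "tensor_frag (RG TYPE('f) (triple M L G)) x" "X = kR_class (triple M L G) x"
    using X by (rule kR_carrierE)
  obtain y where y: "tensor_frag (RG TYPE('f) (triple L K G)) y" "Y = kR_class (triple L K G) y"
    using Y by (rule kR_carrierE)
  obtain z where z: "tensor_frag (RG TYPE('f) (triple K H G)) z" "Z = kR_class (triple K H G) z"
    using Z by (rule kR_carrierE)
  show ?thesis
    unfolding x(2) y(2) z(2) MLK.kR_comp_class[OF x(1) y(1)] LKH.kR_comp_class[OF y(1) z(1)]
      MKH.kR_comp_class[OF MLK.bimul_comp_keys[OF x(1) y(1)] z(1)]
      MLH.kR_comp_class[OF x(1) LKH.bimul_comp_keys[OF y(1) z(1)]]
    by (rule arg_cong[where f = "kR_class _"], rule bimul_assoc[OF _ x(1) y(1) z(1)], rule grothendieck_comp_assoc[OF fg])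
qed

lemma P_id_alt: "P_id G H = kR_class (triple H H G) (frag_of (1, bimodule_class G H))"
  unfolding P_id_def bimodule_class_def ..

lemma P_id_closed:
  assumes "finite_group G" "finite_group H"
  shows "P_id G H \<in> carrier (kR TYPE('k::field) TYPE('f::field_char_0) (triple H H G))"
  unfolding P_id_alt by (rule kR_carrierI) (use bimodule_class_closed[OF assms] in simp)

lemma kR_comp_P_id:
  assumes fg: "finite_group G" "finite_group L" "finite_group H"
    and X: "X \<in> carrier (kR TYPE('k::field) TYPE('f::field_char_0) (triple L H G))"
  shows "kR_comp G L H H X (P_id G H) = X"
proof -
  interpret LHH: four_groups L H H G using fg by (simp add: four_groups_def)
  obtain x where x: "tensor_frag (RG TYPE('f) (triple L H G)) x" "X = kR_class (triple L H G) x"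
    using X by (rule kR_carrierE)
  have k: "tensor_frag (RG TYPE('f) (triple H H G)) (frag_of (1, bimodule_class G H))"
    using bimodule_class_closed[OF fg(1,3), where 'f = 'f] by simp
  show ?thesis
    unfolding P_id_alt x(2) LHH.kR_comp_class[OF x(1) k]
    by (rule arg_cong[where f = "kR_class _"], rule bimul_unit_right[OF _ x(1)], rule grothendieck_comp_id_right[OF fg])
qed

text \<open>
  On morphisms, the functor from the category of \<open>kR\<^sub>\<rat>\<close> to that of
  \<open>kR\<^sub>F\<^sub>,\<^sub>G\<close> which is the identity on objects.
\<close>

definition kR_base_change where
  "kR_base_change (F :: 'f::field_char_0 itself) G L H =
    scalar_extension_map (RG TYPE(rat) (triple L H trivial_group)) (RG F (triple L H G)) (base_change G L H)"

lemma base_change_hom: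
  assumes "finite_group G" "finite_group L" "finite_group H"
  shows "base_change G L H \<in> hom (RG TYPE(rat) (triple L H trivial_group)) (RG TYPE('f::field_char_0) (triple L H G))"
  by (rule homI) (simp_all add: base_change_closed base_change_mult[OF assms])

lemma map_frag_base_change_keys:
  assumes "tensor_frag (RG TYPE(rat) (triple L H trivial_group)) x"
  shows "tensor_frag (RG TYPE('f::field_char_0) (triple L H G)) (map_frag (base_change G L H) x)"
  by (rule map_frag_keys[OF base_change_closed assms])

lemma kR_base_change_class:
  fixes G :: "'g monoid" and L :: "'l monoid" and H :: "'h monoid"
    and x :: "'k::field \<times> (rat, 'l \<times> 'h \<times> unit) grothendieck \<Rightarrow>\<^sub>0 int"
  assumes fg: "finite_group G" "finite_group L" "finite_group H"
    and x: "tensor_frag (RG TYPE(rat) (triple L H trivial_group)) x"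
  shows "kR_base_change TYPE('f::field_char_0) G L H (kR_class (triple L H trivial_group) x) =
    kR_class (triple L H G) (map_frag (base_change G L H) x)"
  unfolding kR_base_change_def kR_class_def
  by (rule scalar_extension_map_class[OF grothendieck_comm_group grothendieck_comm_group base_change_hom[OF fg] x])

lemma kR_base_change_closed:
  assumes fg: "finite_group G" "finite_group L" "finite_group H"
    and X: "X \<in> carrier (kR TYPE('k::field) TYPE(rat) (triple L H trivial_group))"
  shows "kR_base_change TYPE('f::field_char_0) G L H X \<in> carrier (kR TYPE('k::field) TYPE('f::field_char_0) (triple L H G))"
  using X
  by (elim kR_carrierE)
    (simp add: kR_base_change_class[OF fg] kR_carrierI map_frag_base_change_keys)

lemma kR_base_change_linear:
  fixes G :: "'g monoid" and L :: "'l monoid" and H :: "'h monoid"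
  assumes fg: "finite_group G" "finite_group L" "finite_group H"
    and X: "X \<in> carrier (kR TYPE('k::field) TYPE(rat) (triple L H trivial_group))"
  shows "Y \<in> carrier (kR TYPE('k) TYPE(rat) (triple L H trivial_group)) \<Longrightarrow>
      kR_base_change TYPE('f::field_char_0) G L H (X \<oplus>\<^bsub>kR TYPE('k) TYPE(rat) (triple L H trivial_group)\<^esub> Y) =
      kR_base_change TYPE('f) G L H X \<oplus>\<^bsub>kR TYPE('k) TYPE('f) (triple L H G)\<^esub> kR_base_change TYPE('f) G L H Y"
    and "kR_base_change TYPE('f) G L H (c \<odot>\<^bsub>kR TYPE('k) TYPE(rat) (triple L H trivial_group)\<^esub> X) =
      c \<odot>\<^bsub>kR TYPE('k) TYPE('f) (triple L H G)\<^esub> kR_base_change TYPE('f) G L H X"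
    and "kR_base_change TYPE('f) G L H \<zero>\<^bsub>kR TYPE('k) TYPE(rat) (triple L H trivial_group)\<^esub> =
      \<zero>\<^bsub>kR TYPE('k) TYPE('f) (triple L H G)\<^esub>"
proof -
  let ?A = "kR TYPE('k) TYPE(rat) (triple L H trivial_group)"
  let ?B = "kR TYPE('k) TYPE('f) (triple L H G)"
  let ?Phi = "kR_base_change TYPE('f) G L H"
  note bc = kR_base_change_class[OF fg, where 'f = 'f and 'k = 'k]
  note mk = map_frag_base_change_keys[where 'f = 'f]
  obtain x where x: "tensor_frag (RG TYPE(rat) (triple L H trivial_group)) x"
    "X = kR_class (triple L H trivial_group) x"
    using X by (rule kR_carrierE)
  show "?Phi (c \<odot>\<^bsub>?A\<^esub> X) =
      c \<odot>\<^bsub>?B\<^esub> ?Phi X"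
    unfolding x(2) by (simp add: kR_smult x(1) bc scale_frag_keys mk map_frag_scale)
  show "?Phi \<zero>\<^bsub>?A\<^esub> =
      \<zero>\<^bsub>?B\<^esub>"
    unfolding kR_zero by (simp add: bc map_frag_simps)
  assume "Y \<in> carrier (?A)"
  then obtain y where y: "tensor_frag (RG TYPE(rat) (triple L H trivial_group)) y"
    "Y = kR_class (triple L H trivial_group) y"
    by (rule kR_carrierE)
  show "?Phi (X \<oplus>\<^bsub>?A\<^esub> Y) =
      ?Phi X \<oplus>\<^bsub>?B\<^esub> ?Phi Y"
    unfolding x(2) y(2) by (simp add: kR_add x(1) y(1) bc frag_keys_add mk map_frag_simps)
qed

lemma kR_base_change_comp:
  assumes fg: "finite_group G" "finite_group L" "finite_group K" "finite_group H"
    and X: "X \<in> carrier (kR TYPE('k::field) TYPE(rat) (triple L K trivial_group))"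
    and Y: "Y \<in> carrier (kR TYPE('k::field) TYPE(rat) (triple K H trivial_group))"
  shows "kR_base_change TYPE('f::field_char_0) G L H (kR_comp trivial_group L K H X Y) =
    kR_comp G L K H (kR_base_change TYPE('f::field_char_0) G L K X) (kR_base_change TYPE('f::field_char_0) G K H Y)"
proof -
  interpret Q: four_groups L K H trivial_group using fg finite_group_unit by (simp add: four_groups_def)
  interpret F: four_groups L K H G using fg by (simp add: four_groups_def)
  obtain x where x: "tensor_frag (RG TYPE(rat) (triple L K trivial_group)) x"
    "X = kR_class (triple L K trivial_group) x"
    using X by (rule kR_carrierE)
  obtain y where y: "tensor_frag (RG TYPE(rat) (triple K H trivial_group)) y"
    "Y = kR_class (triple K H trivial_group) y"
    using Y by (rule kR_carrierE)
  note mx = map_frag_base_change_keys[OF x(1), of G, where 'f = 'f]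
    and my = map_frag_base_change_keys[OF y(1), of G, where 'f = 'f]
  show ?thesis
    unfolding x(2) y(2) Q.kR_comp_class[OF x(1) y(1)] kR_base_change_class[OF fg(1,2,3) x(1)]
      kR_base_change_class[OF fg(1,3,4) y(1)] kR_base_change_class[OF fg(1,2,4) Q.bimul_comp_keys[OF x(1) y(1)]]
    by (subst F.kR_comp_class[OF mx my], rule arg_cong[where f = "kR_class _"],
        rule map_frag_bimul[OF x(1) y(1)], rule base_change_comp[OF fg])
qed

lemma kR_base_change_P_id:
  assumes fg: "finite_group G" "finite_group H"
  shows "kR_base_change TYPE('f::field_char_0) G H H (P_id trivial_group H) = P_id G H"
proof -
  have k: "Poly_Mapping.keys (frag_of (1, bimodule_class trivial_group H)) \<subseteq>
      UNIV \<times> carrier (RG TYPE(rat) (triple H H trivial_group))"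
    using bimodule_class_closed[OF finite_group_unit fg(2), where 'f = rat] by simp
  show ?thesis
    unfolding P_id_alt kR_base_change_class[OF fg(1,2,2) k] map_frag_simps base_change_bimodule_class[OF fg] ..
qed

section \<open>The essential algebra\<close>

lemma quotient_trivial_iff:
  assumes M: "Module.module class_ring (M :: ('k::field, 'm) module)" and I: "submodule class_ring I M"
  shows "carrier (M Quot I) = {\<zero>\<^bsub>M Quot I\<^esub>} \<longleftrightarrow> I = carrier M"
proof -
  interpret Module.module class_ring M by (fact M)
  interpret submodule class_ring I M by (fact I)
  have q: "carrier (M Quot I) = {I +>\<^bsub>M\<^esub> a | a. a \<in> carrier M}" "\<zero>\<^bsub>M Quot I\<^esub> = I"
    by (auto simp: FactRing_def A_RCOSETS_def')
  have mem: "a \<in> I +>\<^bsub>M\<^esub> a" if "a \<in> carrier M" for a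
  proof -
    have "\<zero>\<^bsub>M\<^esub> \<oplus>\<^bsub>M\<^esub> a \<in> I +>\<^bsub>M\<^esub> a"
      unfolding a_r_coset_def' using submodule.zero_closed[OF I] by blast
    then show ?thesis using that by simp
  qed
  show ?thesis
  proof
    assume "carrier (M Quot I) = {\<zero>\<^bsub>M Quot I\<^esub>}"
    then have "I +>\<^bsub>M\<^esub> a = I" if "a \<in> carrier M" for a using that unfolding q by blast
    then show "I = carrier M" using mem subset by blast
  next
    assume eq: "I = carrier M"
    have all: "carrier M +>\<^bsub>M\<^esub> a = carrier M" if a: "a \<in> carrier M" for a
    proof
      show "carrier M +>\<^bsub>M\<^esub> a \<subseteq> carrier M" using a by (auto simp: a_r_coset_def')
      show "carrier M \<subseteq> carrier M +>\<^bsub>M\<^esub> a"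
      proof
        fix b assume b: "b \<in> carrier M"
        have "b = (b \<ominus>\<^bsub>M\<^esub> a) \<oplus>\<^bsub>M\<^esub> a" using a b by (simp add: a_minus_def M.add.m_assoc M.l_neg)
        then show "b \<in> carrier M +>\<^bsub>M\<^esub> a" using a b M.minus_closed unfolding a_r_coset_def' by blast
      qed
    qed
    show "carrier (M Quot I) = {\<zero>\<^bsub>M Quot I\<^esub>}"
      unfolding q unfolding eq
    proof (intro equalityI subsetI)
      fix Y assume "Y \<in> {carrier M +>\<^bsub>M\<^esub> a | a. a \<in> carrier M}"
      then show "Y \<in> {carrier M}" using all by auto
    next
      fix Y assume "Y \<in> {carrier M}"
      then have "Y = carrier M +>\<^bsub>M\<^esub> \<zero>\<^bsub>M\<^esub>" using all[OF M.zero_closed] by simp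
      then show "Y \<in> {carrier M +>\<^bsub>M\<^esub> a | a. a \<in> carrier M}" using M.zero_closed by blast
    qed
  qed
qed

lemma P_End_simps:
  "carrier (P_End k F G H) = carrier (kR k F (triple H H G))"
  "ring.add (P_End k F G H) = ring.add (kR k F (triple H H G))"
  "ring.zero (P_End k F G H) = ring.zero (kR k F (triple H H G))"
  "module.smult (P_End k F G H) = module.smult (kR k F (triple H H G))"
  by (simp_all add: P_End_def P_hom_def)

lemma P_End_module: "Module.module class_ring (P_End TYPE('k::field) TYPE('f::field) G H)"
  unfolding P_End_def P_hom_def kR_def by (rule scalar_extension_module[OF grothendieck_comm_group])

definition factoring_morphisms where
  "factoring_morphisms (k :: 'k::field itself) (F :: 'f::field itself) G H =
    {kR_comp G H K H u v | (K :: nat monoid) u v.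
       group K \<and> finite (carrier K) \<and> card (carrier K) < card (carrier H) \<and>
       u \<in> carrier (P_hom k F G K H) \<and> v \<in> carrier (P_hom k F G H K)}"

lemma factoring_morphismsI:
  assumes "finite_group (K :: nat monoid)" "card (carrier K) < card (carrier H)"
    "u \<in> carrier (kR k F (triple H K G))" "v \<in> carrier (kR k F (triple K H G))"
  shows "kR_comp G H K H u v \<in> factoring_morphisms k F G H"
  using assms unfolding factoring_morphisms_def P_hom_def finite_group_def finite_group_axioms_def by blast

lemma factoring_morphismsE:
  assumes "w \<in> factoring_morphisms k F G H"
  obtains K :: "nat monoid" and u v where "finite_group K" "card (carrier K) < card (carrier H)"
    "u \<in> carrier (kR k F (triple H K G))" "v \<in> carrier (kR k F (triple K H G))" "w = kR_comp G H K H u v"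
  using assms unfolding factoring_morphisms_def P_hom_def finite_group_def finite_group_axioms_def by blast

lemma essential_ideal_alt:
  "essential_ideal k F G H = LinearCombinations.module.span class_ring (P_End k F G H) (factoring_morphisms k F G H)"
  unfolding essential_ideal_def factoring_morphisms_def ..

lemma factoring_morphisms_closed:
  assumes "finite_group G" "finite_group H"
  shows "factoring_morphisms TYPE('k::field) TYPE('f::field_char_0) G H \<subseteq> carrier (P_End TYPE('k::field) TYPE('f::field_char_0) G H)"
proof
  fix w :: "('k, 'f, 'b \<times> 'b \<times> 'a) kR" assume "w \<in> factoring_morphisms TYPE('k) TYPE('f) G H"
  then obtain K :: "nat monoid" and u v where K: "finite_group K" and uv: "u \<in> carrier (kR TYPE('k) TYPE('f) (triple H K G))"
    "v \<in> carrier (kR TYPE('k) TYPE('f) (triple K H G))" and w: "w = kR_comp G H K H u v"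
    by (rule factoring_morphismsE)
  interpret four_groups H K H G using assms K by (simp add: four_groups_def)
  show "w \<in> carrier (P_End TYPE('k) TYPE('f) G H)"
    unfolding w P_End_simps by (rule kR_comp_closed[OF uv])
qed

lemma essential_ideal_submodule:
  assumes "finite_group G" "finite_group H"
  shows "submodule class_ring (essential_ideal TYPE('k::field) TYPE('f::field_char_0) G H) (P_End TYPE('k::field) TYPE('f::field_char_0) G H)"
  unfolding essential_ideal_alt
  by (rule LinearCombinations.module.span_is_submodule[OF P_End_module factoring_morphisms_closed[OF assms]])

lemma essential_ideal_minimal:
  assumes "submodule class_ring N (P_End TYPE('k::field) TYPE('f::field) G H)"
    "factoring_morphisms TYPE('k::field) TYPE('f::field) G H \<subseteq> N"
  shows "essential_ideal TYPE('k::field) TYPE('f::field) G H \<subseteq> N"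
  unfolding essential_ideal_alt
  by (rule LinearCombinations.module.span_is_subset[OF P_End_module assms(2,1)])

lemma factoring_in_essential_ideal:
  assumes "finite_group G" "finite_group H"
  shows "factoring_morphisms TYPE('k::field) TYPE('f::field_char_0) G H \<subseteq> essential_ideal TYPE('k::field) TYPE('f::field_char_0) G H"
  unfolding essential_ideal_alt
  by (rule LinearCombinations.module.in_own_span[OF P_End_module factoring_morphisms_closed[OF assms]])

text \<open>
  The elements \<open>Z\<close> with \<open>X \<circ> Z\<close> in the ideal form a subspace. It
  contains the generators, since \<open>X \<circ> (u \<circ> v) = (X \<circ> u) \<circ>
  v\<close> factors through the same group.
\<close>

lemma essential_ideal_left:
  fixes G :: "'g monoid" and H :: "'h monoid"
  assumes fg: "finite_group G" "finite_group H"
    and X: "X \<in> carrier (kR TYPE('k::field) TYPE('f::field_char_0) (triple H H G))"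
    and Y: "Y \<in> essential_ideal TYPE('k) TYPE('f) G H"
  shows "kR_comp G H H H X Y \<in> essential_ideal TYPE('k) TYPE('f) G H"
proof -
  interpret HHH: four_groups H H H G using fg by (simp add: four_groups_def)
  let ?I = "essential_ideal TYPE('k) TYPE('f) G H" and ?E = "P_End TYPE('k) TYPE('f) G H"
  interpret I: submodule class_ring ?I ?E by (rule essential_ideal_submodule[OF fg])
  define N where "N = {Z \<in> carrier ?E. kR_comp G H H H X Z \<in> ?I}"
  interpret E: Module.module class_ring ?E by (rule P_End_module)
  note c = E.M.add.m_closed E.smult_closed E.M.zero_closed
  have "submodule class_ring N ?E"
  proof (rule submodule.intro[OF P_End_module])
    show "N \<subseteq> carrier ?E" by (auto simp: N_def)
    show "Z \<oplus>\<^bsub>?E\<^esub> Z' \<in> N" if "Z \<in> N" "Z' \<in> N" for Z Z'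
      using that I.m_closed E.M.add.m_closed unfolding N_def P_End_simps
      by (simp add: HHH.kR_comp_linear_right[OF X])
    show "\<zero>\<^bsub>?E\<^esub> \<in> N"
      using I.zero_closed E.M.zero_closed unfolding N_def P_End_simps
      by (simp add: HHH.kR_comp_linear_right(3)[OF X X])
    show "a \<odot>\<^bsub>?E\<^esub> Z \<in> N" if "a \<in> carrier class_ring" "Z \<in> N" for a Z
      using that I.smult_closed E.smult_closed unfolding N_def P_End_simps
      by (simp add: HHH.kR_comp_linear_right(2)[OF X])
  qed
  moreover have "factoring_morphisms TYPE('k) TYPE('f) G H \<subseteq> N"
  proof
    fix w assume w: "w \<in> factoring_morphisms TYPE('k) TYPE('f) G H"
    then obtain K :: "nat monoid" and u v where K: "finite_group K" "card (carrier K) < card (carrier H)"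
      and u: "u \<in> carrier (kR TYPE('k) TYPE('f) (triple H K G))"
      and v: "v \<in> carrier (kR TYPE('k) TYPE('f) (triple K H G))" and wuv: "w = kR_comp G H K H u v"
      by (rule factoring_morphismsE)
    interpret HHK: four_groups H H K G using fg K by (simp add: four_groups_def)
    have "kR_comp G H H H X w = kR_comp G H K H (kR_comp G H H K X u) v"
      unfolding wuv by (rule kR_comp_assoc[OF fg(1) fg(2) fg(2) K(1) fg(2) X u v, symmetric])
    also have "\<dots> \<in> ?I"
      using factoring_in_essential_ideal[OF fg] factoring_morphismsI[OF K HHK.kR_comp_closed[OF X u] v] by blast
    finally show "w \<in> N" unfolding N_def using w factoring_morphisms_closed[OF fg] by blast
  qed
  ultimately have "?I \<subseteq> N" by (rule essential_ideal_minimal)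
  then show ?thesis using Y unfolding N_def by blast
qed

text \<open>
  As the functor is the identity on objects, it maps a morphism through \<open>K\<close> to a
  morphism through \<open>K\<close>. By linearity it is enough to know this for the generators.
\<close>

lemma essential_ideal_base_change:
  fixes G :: "'g monoid" and H :: "'h monoid"
  assumes fg: "finite_group G" "finite_group H"
    and Y: "Y \<in> essential_ideal TYPE('k::field) TYPE(rat) trivial_group H"
  shows "kR_base_change TYPE('f::field_char_0) G H H Y \<in> essential_ideal TYPE('k) TYPE('f) G H"
proof -
  let ?I = "essential_ideal TYPE('k) TYPE('f) G H" and ?E = "P_End TYPE('k) TYPE('f) G H"
  let ?Q = "P_End TYPE('k) TYPE(rat) trivial_group H"
  let ?\<Phi> = "kR_base_change TYPE('f) G H H"
  interpret I: submodule class_ring ?I ?E by (rule essential_ideal_submodule[OF fg])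
  define N where "N = {Z \<in> carrier ?Q. ?\<Phi> Z \<in> ?I}"
  interpret Q: Module.module class_ring ?Q by (rule P_End_module)
  note lin = kR_base_change_linear[OF fg(1,2,2), where 'f = 'f and 'k = 'k]
  have "submodule class_ring N ?Q"
  proof (rule submodule.intro[OF P_End_module])
    show "N \<subseteq> carrier ?Q" by (auto simp: N_def)
    show "Z \<oplus>\<^bsub>?Q\<^esub> Z' \<in> N" if "Z \<in> N" "Z' \<in> N" for Z Z'
      using that I.m_closed Q.M.add.m_closed unfolding N_def P_End_simps by (simp add: lin)
    show "\<zero>\<^bsub>?Q\<^esub> \<in> N"
      using I.zero_closed Q.M.zero_closed unfolding N_def P_End_simps
      by (simp add: lin(3)[OF Q.M.zero_closed[unfolded P_End_simps]])
    show "a \<odot>\<^bsub>?Q\<^esub> Z \<in> N" if "a \<in> carrier class_ring" "Z \<in> N" for a Z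
      using that I.smult_closed Q.smult_closed unfolding N_def P_End_simps by (simp add: lin(2))
  qed
  moreover have "factoring_morphisms TYPE('k) TYPE(rat) trivial_group H \<subseteq> N"
  proof
    fix w assume w: "w \<in> factoring_morphisms TYPE('k) TYPE(rat) trivial_group H"
    then obtain K :: "nat monoid" and u v where K: "finite_group K" "card (carrier K) < card (carrier H)"
      and u: "u \<in> carrier (kR TYPE('k) TYPE(rat) (triple H K trivial_group))"
      and v: "v \<in> carrier (kR TYPE('k) TYPE(rat) (triple K H trivial_group))"
      and wuv: "w = kR_comp trivial_group H K H u v"
      by (rule factoring_morphismsE)
    have "?\<Phi> w = kR_comp G H K H (kR_base_change TYPE('f) G H K u) (kR_base_change TYPE('f) G K H v)"
      unfolding wuv by (rule kR_base_change_comp[OF fg(1,2) K(1) fg(2) u v])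
    also have "\<dots> \<in> ?I"
      using factoring_in_essential_ideal[OF fg]
        factoring_morphismsI[OF K kR_base_change_closed[OF fg(1,2) K(1) u] kR_base_change_closed[OF fg(1) K(1) fg(2) v]] by blast
    finally show "w \<in> N" unfolding N_def using w factoring_morphisms_closed[OF finite_group_unit fg(2)] by blast
  qed
  ultimately have "essential_ideal TYPE('k) TYPE(rat) trivial_group H \<subseteq> N" by (rule essential_ideal_minimal)
  then show ?thesis using Y unfolding N_def by blast
qed

theorem proposition3p21:
  fixes G :: "'g monoid" and H :: "'h monoid"
  assumes "group G" and "finite (carrier G)"
    and "group H" and "finite (carrier H)"
    and "carrier (essential_algebra TYPE('k::field_char_0) TYPE('f::field_char_0) G H) \<noteq>
      {\<zero>\<^bsub>essential_algebra TYPE('k) TYPE('f) G H\<^esub>}"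
  shows "carrier (essential_algebra TYPE('k) TYPE(rat) (singleton_group ()) H) \<noteq>
      {\<zero>\<^bsub>essential_algebra TYPE('k) TYPE(rat) (singleton_group ()) H\<^esub>}"
proof
  have fg: "finite_group G" "finite_group H"
    using assms by (simp_all add: finite_group_def finite_group_axioms_def)
  note quotient = quotient_trivial_iff[OF P_End_module essential_ideal_submodule, folded essential_algebra_def]
  assume "carrier (essential_algebra TYPE('k) TYPE(rat) (singleton_group ()) H) =
      {\<zero>\<^bsub>essential_algebra TYPE('k) TYPE(rat) (singleton_group ()) H\<^esub>}"
  then have "P_id (singleton_group ()) H \<in> essential_ideal TYPE('k) TYPE(rat) (singleton_group ()) H"
    unfolding quotient[OF finite_group_unit fg(2)]
    using P_id_closed[OF finite_group_unit fg(2)] by (simp add: P_End_simps)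
  from essential_ideal_base_change[OF fg this]
  have id: "P_id G H \<in> essential_ideal TYPE('k) TYPE('f) G H"
    unfolding kR_base_change_P_id[OF fg] .
  have "X \<in> essential_ideal TYPE('k) TYPE('f) G H" if "X \<in> carrier (P_End TYPE('k) TYPE('f) G H)" for X
  proof -
    have X: "X \<in> carrier (kR TYPE('k) TYPE('f) (H \<times>\<times> H \<times>\<times> G))" using that by (simp add: P_End_simps)
    show ?thesis using essential_ideal_left[OF fg X id] kR_comp_P_id[OF fg(1,2,2) X] by simp
  qed
  then have "essential_ideal TYPE('k) TYPE('f) G H = carrier (P_End TYPE('k) TYPE('f) G H)"
    using submodule.subset[OF essential_ideal_submodule[OF fg]] by blast
  then show False using assms(5) quotient[OF fg] by blast
qed

end
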